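(* Let $K$ be an algebraic number field with discriminant $\Delta$ over $\mathbf Q$, ring of integers $\mathcal O$, and $s$ complex places, and let $d=(2/\pi)^s|\Delta|^{1/2}$. Let $S$ be a finite set of places of $K$ containing the set $S_\infty$ of archimedean places and containing all finite places $\mathfrak p$ with $\mathfrak N\mathfrak p\le d$. Write $m_S=\max\{\mathfrak N\mathfrak p : \mathfrak p\in S-S_\infty\}$ if $S\ne S_\infty$ and $m_S=1$ if $S=S_\infty$. Then the group $K_S$ is generated by the set of those $a\in K_S$ satisfying $H(a)\le d\,m_S$, and also by the set of those $a\in\mathcal O\cap K_S$ satisfying $H(a)\le d^2m_S$.
   Context: For a finite place $\mathfrak p$ (nonzero prime ideal of $\mathcal O$), $\mathfrak N\mathfrak p$ is the cardinality of its residue class field. $K_S=\{a\in K^* : |a|_{\mathfrak p}=1\text{ for all places }\mathfrak p\notin S\}$ is the group of $S$-units. The height is $H(a)=\prod_{\mathfrak p}\max\{1,|a|_{\mathfrak p}\}$ over all places, where $|\cdot|_{\mathfrak p}$ is normalized by $|2|_{\mathfrak p}=2$ if $\mathfrak p$ is real, $|2|_{\mathfrak p}=4$ if $\mathfrak p$ is complex, and $|K^*|_{\mathfrak p}=(\mathfrak N\mathfrak p)^{\mathbf Z}$ if $\mathfrak p$ is finite. Equivalently, $H(a)=\mathfrak N(\mathcal O+\mathcal Oa)^{-1}\prod_{i=1}^{r+s}\max\{1,|a_i|\}^{n_i}$, where $\mathfrak N$ is the ideal norm, $r$ is the number of real places, $a_1,\dots,a_r\in\mathbf R$ and $a_{r+1},\dots,a_{r+s}\in\mathbf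 C$ are the images of $a$ under embeddings representing the archimedean places, $n_i=1$ for $i\le r$ and $n_i=2$ for $i>r$. *)

theory Defs
  imports
    Complex_Main
    "HOL-Computational_Algebra.Polynomial"
    "HOL-Algebra.Multiplicative_Group"
    "HOL-Algebra.Generated_Groups"
    "HOL-Algebra.Ideal_Product"
    "HOL-Algebra.QuotRing"
    "Jordan_Normal_Form.Determinant"
    "Jordan_Normal_Form.VS_Connect"
begin

definition number_field :: "'a::field_char_0 itself \<Rightarrow> bool" where
  "number_field _ \<longleftrightarrow>
     (\<exists>B::'a set. finite_dimensional_vector_space (\<lambda>(q::rat) x. of_rat q * x) B)"

definition integer_ring :: "'a::field ring" where
  "integer_ring = class_ring\<lparr>carrier := {x. algebraic_int x}\<rparr>"

definition embeddings :: "('a::field \<Rightarrow> complex) set" where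
  "embeddings = {\<sigma>. field_hom \<sigma>}"

definition integral_basis :: "'a::field_char_0 set \<Rightarrow> bool" where
  "integral_basis B \<longleftrightarrow>
     \<not> Modules.module.dependent (\<lambda>(k::int) x. of_int k * x) B \<and>
     Modules.module.span (\<lambda>(k::int) x. of_int k * x) B = carrier integer_ring"

text \<open>
  The discriminant is \<open>(det (\<sigma>\<^sub>i (\<omega>\<^sub>j)))\<^sup>2\<close> for any integral basis \<open>\<omega>\<^sub>1, \<dots>, \<omega>\<^sub>n\<close>, where
  \<open>\<sigma>\<^sub>1, \<dots>, \<sigma>\<^sub>n\<close> are the embeddings into the complex numbers. It does not depend on the basis or on
  either ordering.
\<close>

definition discriminant :: "'a::field_char_0 itself \<Rightarrow> int" where
  "discriminant _ = (THE D. \<exists>\<omega> \<sigma>.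
     distinct \<omega> \<and> integral_basis (set \<omega> :: 'a set) \<and>
     distinct \<sigma> \<and> set \<sigma> = embeddings \<and>
     of_int D =
       (Determinant.det (Matrix.mat (length \<sigma>) (length \<omega>) (\<lambda>(i, j). (\<sigma> ! i) (\<omega> ! j))))\<^sup>2)"

text \<open>
  An archimedean place is represented by its set of embeddings, a singleton \<open>{\<sigma>}\<close> if the place is
  real and a pair of conjugate embeddings if it is complex. A finite place is represented by a
  nonzero prime ideal of the ring of integers.
\<close>

datatype 'a place = Arch_place "('a \<Rightarrow> complex) set" | Fin_place "'a set"

definition real_places :: "'a::field place set" where
  "real_places = {Arch_place {\<sigma>} |\<sigma>. \<sigma> \<in> embeddings \<and> cnj \<circ> \<sigma> = \<sigma>}"

definition complex_places :: "'a::field place set" where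
  "complex_places = {Arch_place {\<sigma>, cnj \<circ> \<sigma>} |\<sigma>. \<sigma> \<in> embeddings \<and> cnj \<circ> \<sigma> \<noteq> \<sigma>}"

definition arch_places :: "'a::field place set" where
  "arch_places = real_places \<union> complex_places"

definition fin_places :: "'a::field place set" where
  "fin_places = {Fin_place P |P. primeideal P integer_ring \<and> P \<noteq> {0}}"

definition places :: "'a::field place set" where
  "places = arch_places \<union> fin_places"

definition residue_norm :: "'a::field set \<Rightarrow> nat" where
  "residue_norm P = card (carrier (integer_ring Quot P))"

definition integer_valuation :: "'a::field set \<Rightarrow> 'a \<Rightarrow> nat" where
  "integer_valuation P x = (GREATEST n. x \<in> P [^]\<^bsub>ideals_set integer_ring\<^esub> n)"

text \<open>
  The valuation is extended from nonzero integers to nonzero field elements through fractions. It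
  is not meaningful at \<open>0\<close>.
\<close>

definition valuation :: "'a::field set \<Rightarrow> 'a \<Rightarrow> int" where
  "valuation P a = (THE k. \<exists>x y.
     algebraic_int x \<and> x \<noteq> 0 \<and> algebraic_int y \<and> y \<noteq> 0 \<and> a = x / y \<and>
     k = int (integer_valuation P x) - int (integer_valuation P y))"

text \<open>
  The product over the embeddings of an archimedean place gives \<open>|\<sigma>(a)|\<close> at a real place and
  \<open>|\<sigma>(a)|\<^sup>2\<close> at a complex place.
\<close>

fun place_abs :: "'a::field place \<Rightarrow> 'a \<Rightarrow> real" where
  "place_abs (Arch_place E) a = (\<Prod>\<sigma>\<in>E. cmod (\<sigma> a))"
| "place_abs (Fin_place P) a =
     (if a = 0 then 0 else real (residue_norm P) powi (- valuation P a))"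

definition S_units :: "'a::field place set \<Rightarrow> 'a set" where
  "S_units S = {a. a \<noteq> 0 \<and> (\<forall>v\<in>places - S. place_abs v a = 1)}"

text \<open>
  A product over an infinite set is \<open>1\<close> in HOL, so the height is written over the places that
  contribute a factor different from \<open>1\<close>; there are only finitely many of them.
\<close>

definition height :: "'a::field \<Rightarrow> real" where
  "height a =
     (\<Prod>v\<in>{v \<in> places. max 1 (place_abs v a) \<noteq> 1}. max 1 (place_abs v a))"

definition max_residue_norm :: "'a::field place set \<Rightarrow> nat" where
  "max_residue_norm S =
     (if S = arch_places then 1 else Max {residue_norm P |P. Fin_place P \<in> S - arch_places})"

end

theory Submission
  imports Defs "Jordan_Normal_Form.Char_Poly" "HOL-Analysis.Analysis"
begin

text \<open>
  For a nonzero ideal \<open>J\<close> and bounds \<open>t\<^sub>v\<close> at the infinite places with product \<open>d \<cdot> N(J)\<close>,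
  Minkowski's theorem gives a nonzero \<open>\<alpha> \<in> J\<close> with \<open>|\<alpha>|\<^sub>v \<le> t\<^sub>v\<close>. Then \<open>\<alpha> J\<^sup>-\<^sup>1\<close> has norm at most \<open>d\<close>,
  so that \<open>\<alpha>\<close> is an \<open>S\<close>-unit if \<open>J\<close> is supported on \<open>S\<close>. An integral \<open>S\<close>-unit \<open>x\<close> is reached from \<open>1\<close> by
  a path of such data \<open>(J, t)\<close>: the bounds move continuously while \<open>J\<close> is fixed, and \<open>J\<close> descends
  from \<open>\<O>\<close> to \<open>x \<O>\<close> one prime of \<open>S\<close> at a time. Elements belonging to neighbouring data have a quotient
  of height at most \<open>d m\<^sub>S\<close>; for the continuous part neighbours exist because an interval is connected
  and only finitely many \<open>\<alpha>\<close> occur.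

  Unique factorisation of ideals is avoided. Ideals enter through their index in \<open>\<O>\<close>, the index of a
  principal ideal is the norm by the same volume argument as Minkowski's theorem, and a height is
  estimated from above by the indices of prime powers.
\<close>


text \<open>The factor m_S is the price of one prime step. Suppose J' contains J with [J':J] = q,
  and the bounds for J' are those for J shrunk by q^(-1/n). Then both chosen elements lie in J' and
  obey the bounds of J, whose product is d [O:J] = d q [O:J']; so their quotient has height at most
  d q, where q is at most the norm of a prime in S. In the second statement one factor d comes from
  this quotient and the other from its denominator. Most index estimates are inequalities, proved by
  maps that are injective on classes (\<open>finite_cosets_hom\<close>). Blichfeldt's theorem is
  used with multiplicity [O:J] + 1 and a pigeonhole argument modulo J, so that only O needs a
  Z-basis. Real coordinates are indexed by all embeddings, not by places, so that no member of a
  conjugate pair is singled out. The discriminant is defined through a square matrix of embeddings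
  against a basis, so the number of embeddings must first be compared with the degree; this is done
  by extending homomorphisms through a tower of subfields.\<close>

no_notation Matrix.vec_index (infixl \<open>$\<close> 100)
hide_const (open) Determinant.det

section \<open>Algebraic integers\<close>

abbreviation zscale :: "int \<Rightarrow> 'a::comm_ring_1 \<Rightarrow> 'a" where
  "zscale \<equiv> (\<lambda>k x. of_int k * x)"

interpretation zmod: Modules.module "zscale :: int \<Rightarrow> 'a::comm_ring_1 \<Rightarrow> 'a"
  by unfold_locales (auto simp: algebra_simps)

lemma zspan_mult_closed:
  assumes "\<And>v. v \<in> V \<Longrightarrow> c * v \<in> zmod.span V" and "x \<in> zmod.span V"
  shows "c * x \<in> zmod.span V"
  using assms(2)
proof (induction rule: zmod.span_induct_alt)
  case base
  then show ?case by (simp add: zmod.span_zero)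
next
  case (step k x y)
  have "c * (of_int k * x + y) = of_int k * (c * x) + c * y"
    by (simp add: algebra_simps)
  then show ?case
    using step assms(1) by (simp add: zmod.span_add zmod.span_scale)
qed

text \<open>The determinant trick: multiplication by \<open>g\<close> on the generators
  \<open>V\<close> is given by an integer matrix \<open>A\<close>, and the list of generators is an
  eigenvector for \<open>g\<close>, nonzero because of \<open>v0\<close>. So \<open>g\<close> is a
  root of the monic integral polynomial \<open>char_poly A\<close>.\<close>

lemma algebraic_int_eigenvector:
  fixes g :: "'a::field_char_0"
  assumes fin: "finite V" and v0: "v0 \<in> V" "v0 \<noteq> 0"
    and stable: "\<And>v. v \<in> V \<Longrightarrow> g * v \<in> zmod.span V"
  shows "algebraic_int g"
proof -
  define n where "n = card V"
  obtain f where f: "bij_betw f {0..<n} V"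
    using ex_bij_betw_nat_finite[OF fin] n_def by auto
  have "\<exists>u. g * v = (\<Sum>w\<in>V. of_int (u w) * w)" if "v \<in> V" for v
    using stable[OF that] zmod.span_finite[OF fin] by auto
  then obtain u where u: "\<And>v. v \<in> V \<Longrightarrow> g * v = (\<Sum>w\<in>V. of_int (u v w) * w)"
    by metis
  define A where "A = Matrix.mat n n (\<lambda>(i, j). u (f i) (f j))"
  define B where "B = map_mat (of_int :: int \<Rightarrow> 'a) A"
  have A: "A \<in> carrier_mat n n" and B: "B \<in> carrier_mat n n"
    by (auto simp: A_def B_def)
  define x where "x = Matrix.vec n f"
  have "B *\<^sub>v x = g \<cdot>\<^sub>v x"
  proof (rule eq_vecI)
    show "dim_vec (B *\<^sub>v x) = dim_vec (g \<cdot>\<^sub>v x)" by (simp add: B_def A_def x_def)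
    fix i assume "i < dim_vec (g \<cdot>\<^sub>v x)"
    then have i: "i < n" by (simp add: x_def)
    then have fi: "f i \<in> V" using f by (auto simp: bij_betw_def)
    have "vec_index (B *\<^sub>v x) i = (\<Sum>j = 0..<n. of_int (u (f i) (f j)) * f j)"
      using i by (simp add: B_def A_def x_def scalar_prod_def)
    also have "\<dots> = (\<Sum>w\<in>V. of_int (u (f i) w) * w)"
      using sum.reindex_bij_betw[OF f, of "\<lambda>w. of_int (u (f i) w) * w"] by simp
    also have "\<dots> = g * f i" using u[OF fi] by simp
    finally show "vec_index (B *\<^sub>v x) i = vec_index (g \<cdot>\<^sub>v x) i"
      using i by (simp add: x_def)
  qed
  moreover have "x \<noteq> 0\<^sub>v n"
  proof
    assume "x = 0\<^sub>v n"
    moreover obtain i where "i < n" "f i = v0"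
      using f v0(1) by (auto simp: bij_betw_def image_iff)
    ultimately show False using v0(2) by (metis index_vec index_zero_vec(1) x_def)
  qed
  ultimately have "eigenvalue B g"
    unfolding eigenvalue_def eigenvector_def using B by (intro exI[of _ x]) (auto simp: x_def)
  then have "poly (char_poly B) g = 0"
    using eigenvalue_root_char_poly[OF B] by simp
  moreover have "char_poly B = map_poly of_int (char_poly A)"
    unfolding B_def by (rule of_int_hom.char_poly_hom[OF A])
  moreover have "lead_coeff (char_poly A) = 1"
    using degree_monic_char_poly[OF A] by simp
  ultimately show ?thesis
    by (auto simp: algebraic_int_altdef_ipoly)
qed

lemma algebraic_int_power_mem_span:
  fixes x :: "'a::field_char_0"
  assumes "algebraic_int x"
  obtains m where "m > 0" "x ^ m \<in> zmod.span ((\<lambda>i. x ^ i) ` {..<m})"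
proof -
  obtain p where p: "poly (map_poly of_int p) x = 0" "lead_coeff p = 1"
    using assms by (auto simp: algebraic_int_altdef_ipoly)
  define m where "m = degree p"
  have "m > 0"
  proof (rule ccontr)
    assume "\<not> m > 0"
    then have "degree p = 0" by (simp add: m_def)
    then obtain c where "p = [:c:]" by (rule degree_eq_zeroE)
    with p show False by simp
  qed
  have "0 = (\<Sum>i\<le>m. of_int (coeff p i) * x ^ i)"
    using p(1) by (simp add: poly_altdef degree_map_poly coeff_map_poly m_def)
  also have "\<dots> = x ^ m + (\<Sum>i<m. of_int (coeff p i) * x ^ i)"
    using p(2) by (simp add: lessThan_Suc_atMost[symmetric] m_def)
  finally have "x ^ m = - (\<Sum>i<m. of_int (coeff p i) * x ^ i)"
    by (simp add: eq_neg_iff_add_eq_0)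
  moreover have "- (\<Sum>i<m. of_int (coeff p i) * x ^ i) \<in> zmod.span ((\<lambda>i. x ^ i) ` {..<m})"
    by (intro zmod.span_neg zmod.span_sum zmod.span_scale zmod.span_base) auto
  ultimately show ?thesis using that \<open>m > 0\<close> by auto
qed

text \<open>The monomials x^i y^j with i < m and j < n span a Z-module stable under both
  \<open>x\<close> and \<open>y\<close>, hence under sum and product;
  \<open>algebraic_int_eigenvector\<close> applies with the generator 1.\<close>

lemma algebraic_int_plus_times:
  fixes x y :: "'a::field_char_0"
  assumes "algebraic_int x" "algebraic_int y"
  shows algebraic_int_plus: "algebraic_int (x + y)" and algebraic_int_times: "algebraic_int (x * y)"
proof -
  obtain m where m: "m > 0" "x ^ m \<in> zmod.span ((\<lambda>i. x ^ i) ` {..<m})"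
    using algebraic_int_power_mem_span[OF assms(1)] .
  obtain n where n: "n > 0" "y ^ n \<in> zmod.span ((\<lambda>i. y ^ i) ` {..<n})"
    using algebraic_int_power_mem_span[OF assms(2)] .
  define V where "V = (\<lambda>(i, j). x ^ i * y ^ j) ` ({..<m} \<times> {..<n})"
  have fin: "finite V" by (simp add: V_def)
  have 1: "(1::'a) \<in> V" using m n by (force simp: V_def)
  have vm: "x ^ i * y ^ j \<in> V" if "i < m" "j < n" for i j
    using that by (auto simp: V_def)
  \<comment> \<open>As in \<open>zspan_mult_closed\<close>, but from one generating set
    \<open>U\<close> (powers of a single element) into the span of another.\<close>
  have aux: "z * w \<in> zmod.span V"
    if "w \<in> zmod.span U" "\<And>u. u \<in> U \<Longrightarrow> z * u \<in> zmod.span V" for z w :: 'a and U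
    using that(1)
  proof (induction rule: zmod.span_induct_alt)
    case base
    then show ?case by (simp add: zmod.span_zero)
  next
    case (step k a b)
    have "z * (of_int k * a + b) = of_int k * (z * a) + z * b"
      by (simp add: algebra_simps)
    then show ?case using step that(2) by (simp add: zmod.span_add zmod.span_scale)
  qed
  have xV: "x * v \<in> zmod.span V" if "v \<in> V" for v
  proof -
    obtain i j where ij: "i < m" "j < n" "v = x ^ i * y ^ j"
      using \<open>v \<in> V\<close> by (auto simp: V_def)
    show ?thesis
    proof (cases "Suc i < m")
      case True
      then show ?thesis using vm[of "Suc i" j] ij by (auto intro!: zmod.span_base simp: mult.assoc)
    next
      case False
      \<comment> \<open>Here i = m - 1, and the monic relation expresses x^m through lower
        powers.\<close>
      then have "x * v = y ^ j * x ^ m" using ij by (metis Suc_lessI mult.assoc mult.commute power_Suc)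
      moreover have "y ^ j * x ^ m \<in> zmod.span V"
      proof (rule aux[OF m(2)])
        fix u assume "u \<in> (\<lambda>i. x ^ i) ` {..<m}"
        then obtain k where "k < m" "u = x ^ k" by auto
        then have "y ^ j * u \<in> V" using vm[of k j] ij by (metis mult.commute)
        then show "y ^ j * u \<in> zmod.span V" by (rule zmod.span_base)
      qed
      ultimately show ?thesis by simp
    qed
  qed
  have yV: "y * v \<in> zmod.span V" if "v \<in> V" for v
  proof -
    obtain i j where ij: "i < m" "j < n" "v = x ^ i * y ^ j"
      using \<open>v \<in> V\<close> by (auto simp: V_def)
    show ?thesis
    proof (cases "Suc j < n")
      case True
      then show ?thesis using vm[of i "Suc j"] ij by (auto intro!: zmod.span_base simp: mult.left_commute)
    next
      case False
      then have "y * v = x ^ i * y ^ n"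
        using ij by (metis Suc_lessI mult.left_commute power_Suc)
      moreover have "x ^ i * y ^ n \<in> zmod.span V"
        by (rule aux[OF n(2)]) (use ij vm in \<open>auto intro!: zmod.span_base\<close>)
      ultimately show ?thesis by simp
    qed
  qed
  show "algebraic_int (x + y)"
    by (rule algebraic_int_eigenvector[OF fin 1])
      (auto simp: distrib_right intro!: zmod.span_add xV yV)
  show "algebraic_int (x * y)"
    by (rule algebraic_int_eigenvector[OF fin 1])
      (auto simp: mult.assoc intro!: zspan_mult_closed[OF xV] yV)
qed

lemma algebraic_int_diff:
  fixes x y :: "'a::field_char_0"
  shows "algebraic_int x \<Longrightarrow> algebraic_int y \<Longrightarrow> algebraic_int (x - y)"
  using algebraic_int_plus[of x "- y"] by simp

lemma algebraic_int_sum: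
  fixes f :: "'b \<Rightarrow> 'a::field_char_0"
  shows "(\<And>i. i \<in> A \<Longrightarrow> algebraic_int (f i)) \<Longrightarrow> algebraic_int (sum f A)"
  by (induction A rule: infinite_finite_induct) (auto intro: algebraic_int_plus)

lemma algebraic_int_prod:
  fixes f :: "'b \<Rightarrow> 'a::field_char_0"
  shows "(\<And>i. i \<in> A \<Longrightarrow> algebraic_int (f i)) \<Longrightarrow> algebraic_int (prod f A)"
  by (induction A rule: infinite_finite_induct) (auto intro: algebraic_int_times)

lemma algebraic_int_power:
  fixes x :: "'a::field_char_0"
  shows "algebraic_int x \<Longrightarrow> algebraic_int (x ^ n)"
  by (induction n) (auto intro: algebraic_int_times)

text \<open>The multiplier is the leading coefficient \<open>a\<close> of an integer polynomial of
  \<open>x\<close>, up to sign: a^(m-1) times the equation of \<open>x\<close> is a monic equation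
  for a x.\<close>

lemma algebraic_scaled_algebraic_int:
  fixes x :: "'a::field_char_0"
  assumes "algebraic x"
  obtains k :: int where "k > 0" "algebraic_int (of_int k * x)"
proof -
  obtain p where p: "\<forall>i. coeff p i \<in> \<int>" "p \<noteq> 0" "poly p x = 0"
    using assms by (auto simp: algebraic_def)
  have "\<exists>c. \<forall>i. coeff p i = of_int (c i)"
    using p(1) unfolding Ints_def image_iff by (intro choice) auto
  then obtain c where c: "\<And>i. coeff p i = of_int (c i)"
    by auto
  define m a where "m = degree p" and "a = c (degree p)"
  have a: "a \<noteq> 0" using p(2) c[of "degree p"] by (auto simp: a_def)
  have "m > 0"
  proof (rule ccontr)
    assume "\<not> m > 0"
    then have "degree p = 0" by (simp add: m_def)
    then obtain r where "p = [:r:]" by (rule degree_eq_zeroE)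
    with p show False by simp
  qed
  define y where "y = of_int a * x"
  define V where "V = (\<lambda>i. y ^ i) ` {..<m}"
  have rel: "of_int a * x ^ m = - (\<Sum>i<m. of_int (c i) * x ^ i)"
  proof -
    have "0 = (\<Sum>i\<le>m. of_int (c i) * x ^ i)"
      using p(3) by (simp add: poly_altdef c m_def)
    also have "\<dots> = of_int a * x ^ m + (\<Sum>i<m. of_int (c i) * x ^ i)"
      by (simp add: lessThan_Suc_atMost[symmetric] m_def a_def)
    finally show ?thesis by (simp add: eq_neg_iff_add_eq_0)
  qed
  \<comment> \<open>In the term of degree i, a^(m-1) splits as a^(m-1-i) a^i; the second factor
    turns x^i into y^i and the first stays in the integer coefficient.\<close>
  have "y ^ m = of_int a ^ (m - 1) * (of_int a * x ^ m)"
    using \<open>m > 0\<close> by (cases m) (auto simp: y_def power_mult_distrib)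
  also have "\<dots> = - (\<Sum>i<m. of_int (c i * a ^ (m - 1 - i)) * y ^ i)"
  proof -
    have "of_int a ^ (m - 1) * (of_int (c i) * x ^ i)
        = of_int (c i * a ^ (m - 1 - i)) * y ^ i" if "i < m" for i
    proof -
      have "m - 1 = (m - 1 - i) + i" using that by simp
      then have "(of_int a :: 'a) ^ (m - 1) = of_int a ^ (m - 1 - i) * of_int a ^ i"
        by (metis power_add)
      then show ?thesis by (simp add: y_def power_mult_distrib)
    qed
    then have "(\<Sum>i<m. of_int a ^ (m - 1) * (of_int (c i) * x ^ i))
        = (\<Sum>i<m. of_int (c i * a ^ (m - 1 - i)) * y ^ i)"
      by (intro sum.cong) auto
    then show ?thesis unfolding rel by (simp only: mult_minus_right sum_distrib_left)
  qed
  finally have *: "y ^ m = - (\<Sum>i<m. of_int (c i * a ^ (m - 1 - i)) * y ^ i)" .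
  have ym: "y ^ m \<in> zmod.span V"
    unfolding * V_def by (intro zmod.span_neg zmod.span_sum zmod.span_scale zmod.span_base) auto
  have "algebraic_int y"
  proof (rule algebraic_int_eigenvector)
    show "finite V" "(1::'a) \<noteq> 0" by (auto simp: V_def)
    show "1 \<in> V" unfolding V_def using \<open>m > 0\<close> by (intro image_eqI[of _ _ 0]) auto
    fix v assume "v \<in> V"
    then obtain i where i: "i < m" "v = y ^ i" by (auto simp: V_def)
    show "y * v \<in> zmod.span V"
    proof (cases "Suc i < m")
      case True
      then show ?thesis using i by (auto simp: V_def intro!: zmod.span_base image_eqI[of _ _ "Suc i"])
    next
      case False
      then have "y * v = y ^ m" using i by (metis Suc_lessI power_Suc)
      then show ?thesis using ym by simp
    qed
  qed
  then have "algebraic_int (of_int \<bar>a\<bar> * x)"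
    by (cases "a > 0") (auto simp: y_def)
  then show ?thesis using a by (intro that[of "\<bar>a\<bar>"]) auto
qed

section \<open>Complex embeddings\<close>

interpretation qvs: vector_space "\<lambda>(q::rat) (x::'a::field_char_0). of_rat q * x"
  by unfold_locales (auto simp: algebra_simps of_rat_add of_rat_mult)

section \<open>Subfields of K, polynomials over them and homomorphisms into the complex
  numbers\<close>

definition subfield_set :: "'a::field set \<Rightarrow> bool" where
  "subfield_set F \<longleftrightarrow> 0 \<in> F \<and> 1 \<in> F \<and>
     (\<forall>x\<in>F. \<forall>y\<in>F. x + y \<in> F \<and> x * y \<in> F) \<and> (\<forall>x\<in>F. - x \<in> F \<and> inverse x \<in> F)"

text \<open>Subfields are sets inside the fixed type, so that a tower can be climbed by induction. A
  homomorphism is a total function whose values off \<open>F\<close> are arbitrary; hence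
  homomorphisms are always compared on \<open>F\<close> only.\<close>

definition hom_on :: "'a::field set \<Rightarrow> ('a \<Rightarrow> complex) \<Rightarrow> bool" where
  "hom_on F \<sigma> \<longleftrightarrow> \<sigma> 1 = 1 \<and> (\<forall>x\<in>F. \<forall>y\<in>F. \<sigma> (x + y) = \<sigma> x + \<sigma> y \<and> \<sigma> (x * y) = \<sigma> x * \<sigma> y)"

definition poly_over :: "'a::field set \<Rightarrow> 'a poly \<Rightarrow> bool" where
  "poly_over F p \<longleftrightarrow> (\<forall>i. coeff p i \<in> F)"

lemma subfield_set_sum:
  assumes "subfield_set F" "\<And>i. i \<in> A \<Longrightarrow> f i \<in> F"
  shows "sum f A \<in> F"
  using assms(2) by (induction A rule: infinite_finite_induct) (use assms(1) in \<open>auto simp: subfield_set_def\<close>)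

lemma subfield_setD:
  assumes "subfield_set F"
  shows "0 \<in> F" "1 \<in> F" "x \<in> F \<Longrightarrow> y \<in> F \<Longrightarrow> x + y \<in> F" "x \<in> F \<Longrightarrow> y \<in> F \<Longrightarrow> x * y \<in> F"
    "x \<in> F \<Longrightarrow> - x \<in> F" "x \<in> F \<Longrightarrow> inverse x \<in> F"
    "x \<in> F \<Longrightarrow> y \<in> F \<Longrightarrow> x - y \<in> F" "x \<in> F \<Longrightarrow> y \<in> F \<Longrightarrow> x / y \<in> F"
proof -
  note s = assms[unfolded subfield_set_def]
  show "0 \<in> F" "1 \<in> F" "x \<in> F \<Longrightarrow> y \<in> F \<Longrightarrow> x + y \<in> F" "x \<in> F \<Longrightarrow> y \<in> F \<Longrightarrow> x * y \<in> F"
    "x \<in> F \<Longrightarrow> - x \<in> F" "x \<in> F \<Longrightarrow> inverse x \<in> F"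
    using s by auto
  show "x - y \<in> F" if "x \<in> F" "y \<in> F"
  proof -
    have "x + - y \<in> F" using s that by blast
    then show ?thesis by simp
  qed
  show "x / y \<in> F" if "x \<in> F" "y \<in> F"
    unfolding divide_inverse using s that by blast
qed

lemma poly_over_const:
  assumes "subfield_set F"
  shows "poly_over F 0" "poly_over F 1" "c \<in> F \<Longrightarrow> poly_over F [:c:]" "c \<in> F \<Longrightarrow> poly_over F (monom c n)"
  using subfield_setD[OF assms] by (auto simp: poly_over_def coeff_pCons split: nat.splits)

lemma poly_over_arith:
  assumes "subfield_set F" "poly_over F p" "poly_over F q"
  shows "poly_over F (p + q)" "poly_over F (p - q)" "poly_over F (p * q)"
  using subfield_setD[OF assms(1)] assms(2,3)
  by (auto simp: poly_over_def coeff_mult intro!: subfield_set_sum[OF assms(1)])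

lemma subfield_set_of_nat: "subfield_set F \<Longrightarrow> of_nat n \<in> F"
  by (induction n) (auto simp: subfield_set_def)

lemma subfield_set_of_rat:
  fixes F :: "'a::field_char_0 set"
  assumes "subfield_set F"
  shows "of_rat q \<in> F"
proof -
  have *: "of_int k \<in> F" for k
    by (cases k rule: int_cases2) (use subfield_set_of_nat[OF assms] subfield_setD[OF assms] in auto)
  obtain a b where "quotient_of q = (a, b)" by force
  then have "q = of_int a / of_int b" by (rule quotient_of_div)
  then show ?thesis by (simp add: of_rat_divide * subfield_setD[OF assms])
qed

lemma poly_over_pderiv:
  assumes "subfield_set F" "poly_over F p"
  shows "poly_over F (pderiv p)"
  unfolding poly_over_def coeff_pderiv
proof
  fix i
  have "of_nat (Suc i) \<in> F" "coeff p (Suc i) \<in> F"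
    using subfield_set_of_nat[OF assms(1)] assms(2) by (blast, simp add: poly_over_def)
  then show "of_nat (Suc i) * coeff p (Suc i) \<in> F"
    by (rule subfield_setD(4)[OF assms(1)])
qed

lemma poly_over_division:
  assumes F: "subfield_set F" and g: "poly_over F g" and h: "poly_over F h" "h \<noteq> 0"
  shows "\<exists>q r. poly_over F q \<and> poly_over F r \<and> g = q * h + r \<and> (r = 0 \<or> degree r < degree h)"
  using g
proof (induction "degree g" arbitrary: g rule: less_induct)
  case less
  show ?case
  proof (cases "g = 0 \<or> degree g < degree h")
    case True
    then show ?thesis using less.prems by (intro exI[of _ 0] exI[of _ g]) (auto simp: poly_over_const[OF F])
  next
    case False
    define t where "t = monom (lead_coeff g / lead_coeff h) (degree g - degree h)"
    have t: "poly_over F t"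
      unfolding t_def using less.prems h
      by (intro poly_over_const[OF F] subfield_setD[OF F]) (auto simp: poly_over_def)
    define g' where "g' = g - t * h"
    have g': "poly_over F g'" unfolding g'_def using less.prems h t by (intro poly_over_arith[OF F])
    have "degree h \<le> degree g" using False by simp
    then have "degree (t * h) \<le> degree g"
      using degree_mult_le[of t h] degree_monom_le[of "lead_coeff g / lead_coeff h" "degree g - degree h"]
      unfolding t_def by linarith
    then have "degree g' \<le> degree g" unfolding g'_def by (rule degree_diff_le[OF order_refl])
    moreover have "coeff g' (degree g) = 0"
      using False h(2) by (simp add: g'_def t_def coeff_monom_mult)
    ultimately have "g' = 0 \<or> degree g' < degree g" by (rule eq_zero_or_degree_less)
    then have "\<exists>q r. poly_over F q \<and> poly_over F r \<and> g' = q * h + r \<and> (r = 0 \<or> degree r < degree h)"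
    proof
      assume "g' = 0"
      then show ?thesis by (intro exI[of _ 0] exI[of _ 0]) (auto simp: poly_over_const[OF F])
    next
      assume "degree g' < degree g"
      then show ?thesis using less.hyps g' by blast
    qed
    then obtain q r where "poly_over F q" "poly_over F r" "g' = q * h + r" "r = 0 \<or> degree r < degree h"
      by blast
    then show ?thesis
      by (intro exI[of _ "q + t"] exI[of _ r]) (auto simp: g'_def poly_over_arith[OF F] t algebra_simps)
  qed
qed

text \<open>\<open>g\<close> is a minimal polynomial of \<open>\<alpha>\<close>. An element m of
  least degree in the ideal generated by \<open>h\<close> and \<open>g\<close> divides both. Since m
  divides \<open>h\<close>, it does not vanish at \<open>\<alpha>\<close>, so the cofactor of m in
  \<open>g\<close> does; minimality of \<open>g\<close> then forces m to be constant.\<close>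

lemma poly_over_bezout:
  assumes F: "subfield_set F" and g: "poly_over F g" "g \<noteq> 0" "poly g \<alpha> = 0"
    and g_min: "\<And>p. poly_over F p \<Longrightarrow> p \<noteq> 0 \<Longrightarrow> poly p \<alpha> = 0 \<Longrightarrow> degree g \<le> degree p"
    and h: "poly_over F h" "poly h \<alpha> \<noteq> 0"
  shows "\<exists>a b. poly_over F a \<and> poly_over F b \<and> a * h + b * g = 1"
proof -
  define P where "P = (\<lambda>m. m \<noteq> 0 \<and> (\<exists>a b. poly_over F a \<and> poly_over F b \<and> a * h + b * g = m))"
  have "poly_over F 0 \<and> poly_over F 1 \<and> 0 * h + 1 * g = g" by (simp add: poly_over_const[OF F])
  then have "P g" unfolding P_def using g(2) by blast
  then obtain m where m: "P m" "\<And>p. P p \<Longrightarrow> degree m \<le> degree p"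
    using ex_has_least_nat[of P g degree] by blast
  obtain a b where ab: "poly_over F a" "poly_over F b" "a * h + b * g = m" and m0: "m \<noteq> 0"
    using m(1) by (auto simp: P_def)
  have mF: "poly_over F m" using ab g h by (auto intro!: poly_over_arith[OF F])
  have dvd: "\<exists>q. poly_over F q \<and> a' * h + b' * g = q * m" if ab': "poly_over F a'" "poly_over F b'" for a' b'
  proof -
    have "poly_over F (a' * h + b' * g)" using ab' g h by (auto intro!: poly_over_arith[OF F])
    then obtain q r where q: "poly_over F q" "poly_over F r" "a' * h + b' * g = q * m + r"
       "r = 0 \<or> degree r < degree m"
      using poly_over_division[OF F _ mF m0] by blast
    have "r = a' * h + b' * g - q * m" using q(3) by simp
    also have "\<dots> = (a' - q * a) * h + (b' - q * b) * g"
      unfolding ab(3)[symmetric] by (simp add: algebra_simps)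
    finally have "r = (a' - q * a) * h + (b' - q * b) * g" .
    moreover have "poly_over F (a' - q * a)" "poly_over F (b' - q * b)"
      using ab ab' q by (auto intro!: poly_over_arith[OF F])
    ultimately have "P r" if "r \<noteq> 0" using that unfolding P_def by blast
    then have "r = 0" using m(2) q(4) by force
    then show ?thesis using q by auto
  qed
  obtain q1 where q1: "poly_over F q1" "h = q1 * m"
    using dvd[of 1 0] by (auto simp: poly_over_const[OF F])
  obtain q2 where q2: "poly_over F q2" "g = q2 * m"
    using dvd[of 0 1] by (auto simp: poly_over_const[OF F])
  have "poly m \<alpha> \<noteq> 0" using h(2) q1 by auto
  then have "poly q2 \<alpha> = 0" using g(3) q2 by simp
  moreover have "q2 \<noteq> 0" using q2 g(2) by auto
  ultimately have "degree g \<le> degree q2" using g_min q2(1) by blast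
  moreover have "degree g = degree q2 + degree m"
    using q2 \<open>q2 \<noteq> 0\<close> m0 by (simp add: degree_mult_eq)
  ultimately have "degree m = 0" by simp
  then obtain c where c: "m = [:c:]" by (rule degree_eq_zeroE)
  with m0 have "c \<noteq> 0" by simp
  have "c \<in> F" using mF c by (auto simp: poly_over_def coeff_pCons split: nat.splits dest: spec[of _ 0])
  then have ic: "poly_over F [:inverse c:]" by (intro poly_over_const[OF F] subfield_setD[OF F])
  have "([:inverse c:] * a) * h + ([:inverse c:] * b) * g = [:inverse c:] * m"
    using ab(3) by (metis distrib_left mult.assoc)
  also have "\<dots> = 1" using c \<open>c \<noteq> 0\<close> by (simp add: one_pCons)
  finally show ?thesis using ic ab poly_over_arith(3)[OF F] by blast
qed

lemma hom_on_0:
  assumes "subfield_set F" "hom_on F \<sigma>"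
  shows "\<sigma> 0 = 0"
proof -
  have "\<sigma> (0 + 0) = \<sigma> 0 + \<sigma> 0" using assms unfolding hom_on_def subfield_set_def by blast
  then show ?thesis by simp
qed

lemma hom_on_sum:
  assumes "subfield_set F" "hom_on F \<sigma>" "\<And>i. i \<in> A \<Longrightarrow> f i \<in> F"
  shows "\<sigma> (sum f A) = (\<Sum>i\<in>A. \<sigma> (f i))"
  using assms(3)
proof (induction A rule: infinite_finite_induct)
  case (insert x A)
  have "\<sigma> (f x + sum f A) = \<sigma> (f x) + \<sigma> (sum f A)"
    using insert.prems subfield_set_sum[OF assms(1), of A f] assms(2) unfolding hom_on_def by blast
  then show ?case using insert by simp
qed (auto simp: hom_on_0[OF assms(1,2)])

lemma hom_on_inj:
  assumes "subfield_set F" "hom_on F \<sigma>" "x \<in> F" "\<sigma> x = 0"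
  shows "x = 0"
proof (rule ccontr)
  assume "x \<noteq> 0"
  then have "\<sigma> (x * inverse x) = 1" using assms by (simp add: hom_on_def)
  moreover have "\<sigma> (x * inverse x) = \<sigma> x * \<sigma> (inverse x)"
    using assms(1,2,3) unfolding hom_on_def by (simp add: subfield_setD)
  ultimately show False using assms(4) by simp
qed

lemma map_poly_hom_on:
  assumes F: "subfield_set F" and \<sigma>: "hom_on F \<sigma>" and p: "poly_over F p" and q: "poly_over F q"
  shows "map_poly \<sigma> (p + q) = map_poly \<sigma> p + map_poly \<sigma> q"
    "map_poly \<sigma> (p * q) = map_poly \<sigma> p * map_poly \<sigma> q"
proof -
  note c = coeff_map_poly[of \<sigma>, OF hom_on_0[OF F \<sigma>]]
  show "map_poly \<sigma> (p + q) = map_poly \<sigma> p + map_poly \<sigma> q"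
    by (rule poly_eqI) (use p q \<sigma> in \<open>auto simp: c hom_on_def poly_over_def\<close>)
  show "map_poly \<sigma> (p * q) = map_poly \<sigma> p * map_poly \<sigma> q"
  proof (rule poly_eqI)
    fix n
    have "\<sigma> (\<Sum>i\<le>n. coeff p i * coeff q (n - i)) = (\<Sum>i\<le>n. \<sigma> (coeff p i * coeff q (n - i)))"
      by (rule hom_on_sum[OF F \<sigma>]) (use p q subfield_setD(4)[OF F] in \<open>auto simp: poly_over_def\<close>)
    also have "\<dots> = (\<Sum>i\<le>n. \<sigma> (coeff p i) * \<sigma> (coeff q (n - i)))"
      using p q \<sigma> by (auto simp: poly_over_def hom_on_def)
    finally show "coeff (map_poly \<sigma> (p * q)) n = coeff (map_poly \<sigma> p * map_poly \<sigma> q) n"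
      by (simp add: c coeff_mult)
  qed
qed

lemma map_poly_hom_on_basic:
  assumes F: "subfield_set F" and \<sigma>: "hom_on F \<sigma>"
  shows "map_poly \<sigma> 1 = 1" "map_poly \<sigma> [:c:] = [:\<sigma> c:]"
    "poly_over F p \<Longrightarrow> degree (map_poly \<sigma> p) = degree p"
    "poly_over F p \<Longrightarrow> map_poly \<sigma> (pderiv p) = pderiv (map_poly \<sigma> p)"
proof -
  note c = coeff_map_poly[of \<sigma>, OF hom_on_0[OF F \<sigma>]]
  show "map_poly \<sigma> [:c:] = [:\<sigma> c:]"
    by (rule poly_eqI) (auto simp: c coeff_pCons hom_on_0[OF F \<sigma>] split: nat.splits)
  have "\<sigma> 1 = 1" using \<sigma> by (simp add: hom_on_def)
  then show "map_poly \<sigma> 1 = 1"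
    by (intro poly_eqI) (auto simp: c one_pCons coeff_pCons hom_on_0[OF F \<sigma>] split: nat.splits)
  assume p: "poly_over F p"
  show "degree (map_poly \<sigma> p) = degree p"
  proof (cases "p = 0")
    case False
    then have "\<sigma> (lead_coeff p) \<noteq> 0"
      using hom_on_inj[OF F \<sigma>, of "lead_coeff p"] p by (auto simp: poly_over_def)
    then show ?thesis by (simp add: map_poly_degree_eq)
  qed auto
  have nat: "\<sigma> (of_nat n) = of_nat n" for n
  proof (induction n)
    case (Suc n)
    have "\<sigma> (1 + of_nat n) = \<sigma> 1 + \<sigma> (of_nat n)"
      using \<sigma> subfield_set_of_nat[OF F, of n] subfield_setD(2)[OF F] unfolding hom_on_def by blast
    then show ?case using Suc \<open>\<sigma> 1 = 1\<close> by simp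
  qed (simp add: hom_on_0[OF F \<sigma>])
  show "map_poly \<sigma> (pderiv p) = pderiv (map_poly \<sigma> p)"
  proof (rule poly_eqI)
    fix n
    have "\<sigma> (of_nat (Suc n) * coeff p (Suc n)) = \<sigma> (of_nat (Suc n)) * \<sigma> (coeff p (Suc n))"
      using \<sigma> subfield_set_of_nat[OF F, of "Suc n"] p unfolding hom_on_def poly_over_def by blast
    then show "coeff (map_poly \<sigma> (pderiv p)) n = coeff (pderiv (map_poly \<sigma> p)) n"
      by (simp only: c coeff_pderiv nat)
  qed
qed

lemma card_roots_rsquarefree:
  fixes p :: "complex poly"
  assumes "\<And>a. \<not> (poly p a = 0 \<and> poly (pderiv p) a = 0)"
  shows "card {z. poly p z = 0} = degree p"
proof -
  have sq: "rsquarefree p" using assms by (simp add: rsquarefree_roots)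
  then have p0: "p \<noteq> 0" by (auto simp: rsquarefree_def)
  then have fin: "finite {z. poly p z = 0}" by (rule poly_roots_finite)
  have "degree p = degree (smult (lead_coeff p) (\<Prod>z|poly p z = 0. [:-z, 1:]))"
    using complex_poly_decompose_rsquarefree[OF sq] by simp
  also have "\<dots> = degree (\<Prod>z|poly p z = 0. [:-z, 1:])"
    using p0 by simp
  also have "\<dots> = (\<Sum>z|poly p z = 0. degree [:-z, 1:])"
    by (rule degree_prod_eq_sum_degree) auto
  also have "\<dots> = card {z. poly p z = 0}" by simp
  finally show ?thesis by simp
qed

text \<open>Expresses that \<open>F\<close> has at least as many complex embeddings as its degree
  over the rationals. The size of a spanning set stands in for the degree, so no basis of
  \<open>F\<close> has to be maintained along the tower. The last clause makes the members of
  \<open>\<Sigma>\<close> differ already on \<open>F\<close>.\<close>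

definition enough_homs :: "'a::field_char_0 set \<Rightarrow> bool" where
  "enough_homs F \<longleftrightarrow> (\<exists>B \<Sigma>. finite B \<and> finite \<Sigma> \<and> F \<subseteq> qvs.span B \<and> card B \<le> card \<Sigma> \<and>
     (\<forall>\<sigma>\<in>\<Sigma>. hom_on F \<sigma>) \<and> (\<forall>\<sigma>\<in>\<Sigma>. \<forall>\<tau>\<in>\<Sigma>. (\<forall>x\<in>F. \<sigma> x = \<tau> x) \<longrightarrow> \<sigma> = \<tau>))"

definition adjoin :: "'a::field set \<Rightarrow> 'a \<Rightarrow> 'a set" where
  "adjoin F \<alpha> = (\<lambda>h. poly h \<alpha>) ` {h. poly_over F h}"

lemma enough_homs_Rats: "subfield_set (range of_rat :: 'a::field_char_0 set)" "enough_homs (range of_rat :: 'a set)"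
proof -
  have inv: "- of_rat x \<in> range (of_rat :: rat \<Rightarrow> 'a)" "inverse (of_rat x) \<in> range (of_rat :: rat \<Rightarrow> 'a)"
    "of_rat x + of_rat y \<in> range (of_rat :: rat \<Rightarrow> 'a)" "of_rat x * of_rat y \<in> range (of_rat :: rat \<Rightarrow> 'a)" for x y
    by (metis of_rat_minus rangeI, metis of_rat_inverse rangeI, metis of_rat_add rangeI, metis of_rat_mult rangeI)
  then show "subfield_set (range of_rat :: 'a set)"
    by (auto simp: subfield_set_def image_iff intro: exI[of _ 0] exI[of _ 1])
  \<comment> \<open>Off the rationals the description gives an arbitrary value, which
    \<open>hom_on\<close> ignores.\<close>
  define r where "r = (\<lambda>x::'a. THE q. x = of_rat q)"
  have r: "r (of_rat q) = q" for q by (simp add: r_def)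
  have "hom_on (range of_rat :: 'a set) (\<lambda>x. of_rat (r x))"
  proof -
    have "r 1 = 1" using r[of 1] by simp
    moreover have "r (of_rat x + of_rat y) = x + y" "r (of_rat x * of_rat y) = x * y" for x y
      using r[of "x + y"] r[of "x * y"] by (simp_all add: of_rat_add of_rat_mult)
    ultimately show ?thesis by (auto simp: hom_on_def r of_rat_add of_rat_mult)
  qed
  moreover have "(range of_rat :: 'a set) \<subseteq> qvs.span {1}"
    using qvs.span_scale[OF qvs.span_base[of 1 "{1}"]] by auto
  ultimately show "enough_homs (range of_rat :: 'a set)"
    unfolding enough_homs_def by (intro exI[of _ "{1}"] exI[of _ "{\<lambda>x. of_rat (r x)}"]) auto
qed

section \<open>Extension of homomorphisms from F to the field obtained by adjoining a root of a
  minimal polynomial g\<close>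

context
  fixes F :: "'a::field_char_0 set" and \<alpha> :: 'a and g :: "'a poly"
  assumes F: "subfield_set F" and g: "poly_over F g" "g \<noteq> 0" "poly g \<alpha> = 0"
    and g_min: "\<And>p. poly_over F p \<Longrightarrow> p \<noteq> 0 \<Longrightarrow> poly p \<alpha> = 0 \<Longrightarrow> degree g \<le> degree p"
begin

lemma adjoin_superset: "F \<subseteq> adjoin F \<alpha>" "\<alpha> \<in> adjoin F \<alpha>"
proof -
  show "F \<subseteq> adjoin F \<alpha>"
  proof
    fix x assume "x \<in> F"
    then have "poly_over F [:x:]" by (rule poly_over_const(3)[OF F])
    then show "x \<in> adjoin F \<alpha>" unfolding adjoin_def by (intro image_eqI[of _ _ "[:x:]"]) auto
  qed
  have "poly_over F (monom 1 1)" using subfield_setD(2)[OF F] by (rule poly_over_const(4)[OF F])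
  then show "\<alpha> \<in> adjoin F \<alpha>" unfolding adjoin_def by (intro image_eqI[of _ _ "monom 1 1"]) (auto simp: poly_monom)
qed

lemma subfield_set_adjoin: "subfield_set (adjoin F \<alpha>)"
proof -
  have "x + y \<in> adjoin F \<alpha> \<and> x * y \<in> adjoin F \<alpha>" if xy: "x \<in> adjoin F \<alpha>" "y \<in> adjoin F \<alpha>" for x y
  proof -
    obtain p where p1: "poly_over F p" "x = poly p \<alpha>"
      using xy(1) unfolding adjoin_def by blast
    obtain q where q1: "poly_over F q" "y = poly q \<alpha>"
      using xy(2) unfolding adjoin_def by blast
    note p = p1(1) q1(1) p1(2) q1(2)
    have "x + y = poly (p + q) \<alpha>" "x * y = poly (p * q) \<alpha>" using p by auto
    then show ?thesis using poly_over_arith[OF F p(1,2)] unfolding adjoin_def by blast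
  qed
  moreover have "- x \<in> adjoin F \<alpha>" "inverse x \<in> adjoin F \<alpha>" if x: "x \<in> adjoin F \<alpha>" for x
  proof -
    obtain p where p: "poly_over F p" "x = poly p \<alpha>" using x unfolding adjoin_def by blast
    have "- x = poly (0 - p) \<alpha>" using p by simp
    then show "- x \<in> adjoin F \<alpha>"
      using poly_over_arith(2)[OF F poly_over_const(1)[OF F] p(1)] unfolding adjoin_def by blast
    show "inverse x \<in> adjoin F \<alpha>"
    proof (cases "x = 0")
      case True
      then show ?thesis using adjoin_superset subfield_setD(1)[OF F] by auto
    next
      case False
      then obtain a b where ab: "poly_over F a" "poly_over F b" "a * p + b * g = 1"
        using poly_over_bezout[OF F g g_min] p by blast
      then have "poly (a * p + b * g) \<alpha> = 1" by simp
      then have "poly a \<alpha> * x = 1" using p g by simp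
      then have "inverse x = poly a \<alpha>" by (metis inverse_unique mult.commute)
      then show ?thesis using ab unfolding adjoin_def by blast
    qed
  qed
  ultimately show ?thesis
    using adjoin_superset subfield_setD(1,2)[OF F] unfolding subfield_set_def by blast
qed

lemma adjoin_span:
  assumes "F \<subseteq> qvs.span B"
  shows "adjoin F \<alpha> \<subseteq> qvs.span ((\<lambda>(b, i). b * \<alpha> ^ i) ` (B \<times> {..<degree g}))" (is "_ \<subseteq> qvs.span ?B")
proof
  fix x assume "x \<in> adjoin F \<alpha>"
  then obtain h where h: "poly_over F h" "x = poly h \<alpha>" by (auto simp: adjoin_def)
  obtain q r where q: "poly_over F q" "poly_over F r" "h = q * g + r" "r = 0 \<or> degree r < degree g"
    using poly_over_division[OF F h(1) g(1,2)] by blast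
  have "x = poly r \<alpha>" using h q g by simp
  also have "\<dots> = (\<Sum>i\<le>degree r. coeff r i * \<alpha> ^ i)" by (simp add: poly_altdef)
  also have "\<dots> \<in> qvs.span ?B"
  proof (cases "r = 0")
    case True
    then show ?thesis by (simp add: qvs.span_zero)
  next
    case False
    have "c * \<alpha> ^ i \<in> qvs.span ?B" if "c \<in> qvs.span B" "i < degree g" for c i
      using that(1)
    proof (induction rule: qvs.span_induct_alt)
      case base
      then show ?case by (simp add: qvs.span_zero)
    next
      case (step k a b)
      have "(of_rat k * a + b) * \<alpha> ^ i = of_rat k * (a * \<alpha> ^ i) + b * \<alpha> ^ i"
        by (simp add: algebra_simps)
      moreover have "a * \<alpha> ^ i \<in> qvs.span ?B"
        by (rule qvs.span_base) (use step that(2) in auto)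
      ultimately show ?case using step.IH by (simp add: qvs.span_add qvs.span_scale)
    qed
    moreover have "coeff r i \<in> qvs.span B" for i using q(2) assms by (auto simp: poly_over_def)
    ultimately show ?thesis using q(4) False by (intro qvs.span_sum) auto
  qed
  finally show "x \<in> qvs.span ?B" .
qed

definition ext_hom :: "('a \<Rightarrow> complex) \<Rightarrow> complex \<Rightarrow> 'a \<Rightarrow> complex" where
  "ext_hom \<sigma> z x = poly (map_poly \<sigma> (SOME h. poly_over F h \<and> poly h \<alpha> = x)) z"

text \<open>Independence of the chosen representative: two polynomials over \<open>F\<close> with
  the same value at \<open>\<alpha>\<close> differ by a multiple of \<open>g\<close>, whose image
  under \<open>\<sigma>\<close> vanishes at \<open>z\<close>.\<close>

lemma ext_hom_poly:
  assumes \<sigma>: "hom_on F \<sigma>" and z: "poly (map_poly \<sigma> g) z = 0" and h: "poly_over F h"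
  shows "ext_hom \<sigma> z (poly h \<alpha>) = poly (map_poly \<sigma> h) z"
proof -
  define h' where "h' = (SOME p. poly_over F p \<and> poly p \<alpha> = poly h \<alpha>)"
  have h': "poly_over F h' \<and> poly h' \<alpha> = poly h \<alpha>"
    unfolding h'_def by (rule someI[of _ h]) (use h in auto)
  have d: "poly_over F (h' - h)" using h h' by (intro poly_over_arith[OF F]) auto
  obtain q r where q: "poly_over F q" "poly_over F r" "h' - h = q * g + r" "r = 0 \<or> degree r < degree g"
    using poly_over_division[OF F d g(1,2)] by blast
  have "poly (h' - h) \<alpha> = poly (q * g + r) \<alpha>" using q(3) by simp
  then have "poly r \<alpha> = 0" using h' g by simp
  then have "r = 0" using g_min[of r] q by force
  then have "h' = q * g + h" using q(3) by (simp add: diff_eq_eq)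
  then have "map_poly \<sigma> h' = map_poly \<sigma> q * map_poly \<sigma> g + map_poly \<sigma> h"
    using map_poly_hom_on[OF F \<sigma>] q(1) g(1) h poly_over_arith[OF F] by metis
  then show ?thesis using z by (simp add: ext_hom_def h'_def[symmetric])
qed

lemma ext_hom:
  assumes \<sigma>: "hom_on F \<sigma>" and z: "poly (map_poly \<sigma> g) z = 0"
  shows "hom_on (adjoin F \<alpha>) (ext_hom \<sigma> z)" "x \<in> F \<Longrightarrow> ext_hom \<sigma> z x = \<sigma> x" "ext_hom \<sigma> z \<alpha> = z"
proof -
  note e = ext_hom_poly[OF \<sigma> z]
  show x: "ext_hom \<sigma> z x = \<sigma> x" if "x \<in> F" for x
    using e[OF poly_over_const(3)[OF F that]] by (simp add: map_poly_hom_on_basic[OF F \<sigma>])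
  have "\<sigma> 1 = 1" using \<sigma> by (simp add: hom_on_def)
  have "poly_over F [:0, 1:]" using subfield_setD(1,2)[OF F] by (auto simp: poly_over_def coeff_pCons split: nat.splits)
  moreover have "map_poly \<sigma> [:0, 1:] = [:0, 1:]"
    by (simp add: map_poly_pCons hom_on_0[OF F \<sigma>] \<open>\<sigma> 1 = 1\<close>)
  ultimately show "ext_hom \<sigma> z \<alpha> = z" using e[of "[:0, 1:]"] by simp
  show "hom_on (adjoin F \<alpha>) (ext_hom \<sigma> z)"
    unfolding hom_on_def
  proof (intro conjI ballI)
    show "ext_hom \<sigma> z 1 = 1" using x subfield_setD(2)[OF F] \<open>\<sigma> 1 = 1\<close> by simp
    fix x y assume "x \<in> adjoin F \<alpha>" "y \<in> adjoin F \<alpha>"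
    then obtain p q where p: "poly_over F p" "poly_over F q" and xy: "x = poly p \<alpha>" "y = poly q \<alpha>"
      unfolding adjoin_def by blast
    have "x + y = poly (p + q) \<alpha>" "x * y = poly (p * q) \<alpha>" by (simp_all add: xy)
    then have "ext_hom \<sigma> z (x + y) = poly (map_poly \<sigma> (p + q)) z"
        "ext_hom \<sigma> z (x * y) = poly (map_poly \<sigma> (p * q)) z"
      using e poly_over_arith[OF F p] by metis+
    moreover have "ext_hom \<sigma> z x = poly (map_poly \<sigma> p) z" "ext_hom \<sigma> z y = poly (map_poly \<sigma> q) z"
      using e p xy by auto
    ultimately show "ext_hom \<sigma> z (x + y) = ext_hom \<sigma> z x + ext_hom \<sigma> z y"
      "ext_hom \<sigma> z (x * y) = ext_hom \<sigma> z x * ext_hom \<sigma> z y"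
      using map_poly_hom_on[OF F \<sigma> p] by auto
  qed
qed

text \<open>Separability in characteristic 0: the derivative of \<open>g\<close> has smaller degree
  and is nonzero, so it does not vanish at \<open>\<alpha>\<close>. The resulting Bezout identity
  between \<open>g\<close> and its derivative is carried over by \<open>\<sigma>\<close> and
  excludes multiple roots of the image.\<close>

lemma card_roots_map_poly:
  assumes \<sigma>: "hom_on F \<sigma>"
  shows "card {z. poly (map_poly \<sigma> g) z = 0} = degree g"
proof -
  have "degree g \<noteq> 0"
  proof
    assume "degree g = 0"
    then obtain c where "g = [:c:]" by (rule degree_eq_zeroE)
    with g show False by simp
  qed
  have g': "poly_over F (pderiv g)" by (rule poly_over_pderiv[OF F g(1)])
  have "pderiv g \<noteq> 0" using \<open>degree g \<noteq> 0\<close> by (simp add: pderiv_eq_0_iff)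
  moreover have "degree (pderiv g) < degree g" using \<open>degree g \<noteq> 0\<close> by (simp add: degree_pderiv)
  ultimately have "poly (pderiv g) \<alpha> \<noteq> 0" using g_min[OF g'] by force
  then obtain a b where ab: "poly_over F a" "poly_over F b" "a * pderiv g + b * g = 1"
    using poly_over_bezout[OF F g g_min g'] by blast
  have "map_poly \<sigma> (a * pderiv g + b * g) = 1"
    using ab map_poly_hom_on_basic(1)[OF F \<sigma>] by simp
  moreover have "map_poly \<sigma> (a * pderiv g + b * g) =
      map_poly \<sigma> a * pderiv (map_poly \<sigma> g) + map_poly \<sigma> b * map_poly \<sigma> g"
    using map_poly_hom_on[OF F \<sigma>] map_poly_hom_on_basic(4)[OF F \<sigma> g(1)] ab(1,2) g' g(1) poly_over_arith[OF F]
    by metis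
  ultimately have eq: "map_poly \<sigma> a * pderiv (map_poly \<sigma> g) + map_poly \<sigma> b * map_poly \<sigma> g = 1"
    by simp
  have "\<not> (poly (map_poly \<sigma> g) z = 0 \<and> poly (pderiv (map_poly \<sigma> g)) z = 0)" for z
    using arg_cong[OF eq, of "\<lambda>p. poly p z"] by auto
  then show ?thesis
    using card_roots_rsquarefree map_poly_hom_on_basic(3)[OF F \<sigma> g(1)] by simp
qed

text \<open>Each \<sigma> has exactly degree g roots to which \<open>\<alpha>\<close> can be sent,
  and a pair (\<sigma>, z) is recovered from the extension: \<sigma> by restriction to
  \<open>F\<close>, z as the value at \<open>\<alpha>\<close>. Both sides of the cardinality bound
  are therefore multiplied by degree g.\<close>

lemma enough_homs_adjoin_aux:
  assumes "enough_homs F"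
  shows "enough_homs (adjoin F \<alpha>)"
proof -
  obtain B \<Sigma> where B: "finite B" "finite \<Sigma>" "F \<subseteq> qvs.span B" "card B \<le> card \<Sigma>"
    and hom': "\<forall>\<sigma>\<in>\<Sigma>. hom_on F \<sigma>"
    and sep': "\<forall>\<sigma>\<in>\<Sigma>. \<forall>\<tau>\<in>\<Sigma>. (\<forall>x\<in>F. \<sigma> x = \<tau> x) \<longrightarrow> \<sigma> = \<tau>"
    using assms unfolding enough_homs_def by (elim exE conjE)
  have hom: "hom_on F \<sigma>" if "\<sigma> \<in> \<Sigma>" for \<sigma> using hom' that by blast
  have sep: "\<sigma> = \<tau>" if "\<sigma> \<in> \<Sigma>" "\<tau> \<in> \<Sigma>" "\<And>x. x \<in> F \<Longrightarrow> \<sigma> x = \<tau> x" for \<sigma> \<tau>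
    using sep' that by simp
  define D where "D = Sigma \<Sigma> (\<lambda>\<sigma>. {z. poly (map_poly \<sigma> g) z = 0})"
  define \<Sigma>' where "\<Sigma>' = (\<lambda>(\<sigma>, z). ext_hom \<sigma> z) ` D"
  define B' where "B' = (\<lambda>(b, i). b * \<alpha> ^ i) ` (B \<times> {..<degree g})"
  have finr: "finite {z. poly (map_poly \<sigma> g) z = 0}" if "\<sigma> \<in> \<Sigma>" for \<sigma>
  proof (rule poly_roots_finite)
    show "map_poly \<sigma> g \<noteq> 0"
    proof
      assume "map_poly \<sigma> g = 0"
      moreover have "coeff (map_poly \<sigma> g) (degree g) = \<sigma> (lead_coeff g)"
        by (rule coeff_map_poly) (rule hom_on_0[OF F hom[OF that]])
      ultimately have "\<sigma> (lead_coeff g) = 0" by simp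
      then show False using hom_on_inj[OF F hom[OF that], of "lead_coeff g"] g by (auto simp: poly_over_def)
    qed
  qed
  have finD: "finite D" unfolding D_def using B(2) finr by auto
  have cardD: "card D = card \<Sigma> * degree g"
    unfolding D_def using B(2) finr card_roots_map_poly[OF hom] by (subst card_SigmaI) auto
  have eq: "p = q" if p: "p \<in> D" and q: "q \<in> D"
    and e: "\<And>x. x \<in> adjoin F \<alpha> \<Longrightarrow> ext_hom (fst p) (snd p) x = ext_hom (fst q) (snd q) x" for p q
  proof -
    obtain \<sigma> z \<tau> w where pq: "p = (\<sigma>, z)" "q = (\<tau>, w)" by (cases p, cases q)
    have h: "hom_on F \<sigma>" "poly (map_poly \<sigma> g) z = 0" "hom_on F \<tau>" "poly (map_poly \<tau> g) w = 0"
      and st: "\<sigma> \<in> \<Sigma>" "\<tau> \<in> \<Sigma>"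
      using p q hom unfolding D_def pq by blast+
    have "z = w" using e[OF adjoin_superset(2)] unfolding pq fst_conv snd_conv
        ext_hom(3)[OF h(1,2)] ext_hom(3)[OF h(3,4)] .
    moreover have "\<sigma> x = \<tau> x" if "x \<in> F" for x
      using e[OF subsetD[OF adjoin_superset(1) that]] unfolding pq fst_conv snd_conv
        ext_hom(2)[OF h(1,2) that] ext_hom(2)[OF h(3,4) that] .
    then have "\<sigma> = \<tau>" by (rule sep[OF st])
    ultimately show ?thesis by (simp add: pq)
  qed
  have "inj_on (\<lambda>(\<sigma>, z). ext_hom \<sigma> z) D"
  proof (rule inj_onI)
    fix p q assume "p \<in> D" "q \<in> D" "(case p of (\<sigma>, z) \<Rightarrow> ext_hom \<sigma> z) = (case q of (\<sigma>, z) \<Rightarrow> ext_hom \<sigma> z)"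
    then show "p = q" by (intro eq) (simp_all add: case_prod_beta)
  qed
  then have "card \<Sigma>' = card \<Sigma> * degree g" unfolding \<Sigma>'_def by (simp add: card_image cardD)
  moreover have "card B' \<le> card B * degree g"
    unfolding B'_def using card_image_le[of "B \<times> {..<degree g}"] B(1) by (simp add: card_cartesian_product)
  moreover have "card B * degree g \<le> card \<Sigma> * degree g" using B(4) by (rule mult_le_mono1)
  ultimately have "card B' \<le> card \<Sigma>'" by linarith
  moreover have "\<forall>\<sigma>\<in>\<Sigma>'. hom_on (adjoin F \<alpha>) \<sigma>"
    unfolding \<Sigma>'_def D_def using ext_hom(1)[OF hom] by (auto simp del: split_paired_All)
  moreover have "\<forall>\<sigma>\<in>\<Sigma>'. \<forall>\<tau>\<in>\<Sigma>'. (\<forall>x\<in>adjoin F \<alpha>. \<sigma> x = \<tau> x) \<longrightarrow> \<sigma> = \<tau>"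
  proof (intro ballI impI)
    fix \<sigma> \<tau> assume "\<sigma> \<in> \<Sigma>'" "\<tau> \<in> \<Sigma>'" and e: "\<forall>x\<in>adjoin F \<alpha>. \<sigma> x = \<tau> x"
    then obtain p q where p: "p \<in> D" "q \<in> D" "\<sigma> = ext_hom (fst p) (snd p)" "\<tau> = ext_hom (fst q) (snd q)"
      unfolding \<Sigma>'_def case_prod_beta by blast
    have "p = q" by (rule eq[OF p(1,2)]) (use e p in blast)
    then show "\<sigma> = \<tau>" using p by simp
  qed
  moreover have "adjoin F \<alpha> \<subseteq> qvs.span B'" unfolding B'_def by (rule adjoin_span[OF B(3)])
  moreover have "finite B'" "finite \<Sigma>'" using B(1) finD by (auto simp: B'_def \<Sigma>'_def)
  ultimately show ?thesis unfolding enough_homs_def by blast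
qed

end

lemma enough_homs_adjoin:
  fixes F :: "'a::field_char_0 set"
  assumes F: "subfield_set F" "enough_homs F" and "algebraic \<alpha>"
  obtains G where "subfield_set G" "enough_homs G" "F \<subseteq> G" "\<alpha> \<in> G"
proof -
  obtain p where p: "\<forall>i. coeff p i \<in> \<int>" "p \<noteq> 0" "poly p \<alpha> = 0"
    using assms(3) by (auto simp: algebraic_def)
  define P where "P = (\<lambda>h. poly_over F h \<and> h \<noteq> 0 \<and> poly h \<alpha> = 0)"
  have "coeff p i \<in> F" for i
  proof -
    obtain k where "coeff p i = of_int k" using p(1) by (meson Ints_cases)
    then have "coeff p i = of_rat (of_int k)" by simp
    then show ?thesis using subfield_set_of_rat[OF F(1)] by metis
  qed
  then have "P p" using p by (auto simp: P_def poly_over_def)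
  then obtain g where g: "P g" "\<And>h. P h \<Longrightarrow> degree g \<le> degree h"
    using ex_has_least_nat[of P p degree] by blast
  have g': "poly_over F g" "g \<noteq> 0" "poly g \<alpha> = 0" using g(1) by (auto simp: P_def)
  have min: "\<And>h. poly_over F h \<Longrightarrow> h \<noteq> 0 \<Longrightarrow> poly h \<alpha> = 0 \<Longrightarrow> degree g \<le> degree h"
    using g(2) by (auto simp: P_def)
  show ?thesis
    by (rule that[OF subfield_set_adjoin[OF F(1) g' min] enough_homs_adjoin_aux[OF F(1) g' min F(2)]
        adjoin_superset[OF F(1) g' min]])
qed

text \<open>The members of a finite spanning set are adjoined to the rationals one by one; a
  subfield containing them all is everything.\<close>

lemma enough_homs_UNIV:
  fixes B :: "'a::field_char_0 set"
  assumes "finite B" "qvs.span B = UNIV" "\<And>x::'a. algebraic x"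
  shows "enough_homs (UNIV :: 'a set)"
proof -
  have "\<exists>F. subfield_set F \<and> enough_homs F \<and> A \<subseteq> F" if "finite A" for A :: "'a set"
    using that
  proof induction
    case empty
    then show ?case using enough_homs_Rats by blast
  next
    case (insert x A)
    then obtain F where "subfield_set F" "enough_homs F" "A \<subseteq> F" by blast
    then show ?case using enough_homs_adjoin[OF _ _ assms(3), of F x] by (metis insert_subset order_trans)
  qed
  then obtain F where F: "subfield_set F" "enough_homs F" "B \<subseteq> F" using assms(1) by blast
  have "qvs.span B \<subseteq> F"
    by (rule qvs.span_minimal[OF F(3)])
      (auto simp: qvs.subspace_def subfield_setD[OF F(1)] subfield_set_of_rat[OF F(1)])
  then show ?thesis using F(2) assms(2) by (metis top.extremum_uniqueI)
qed

lemma number_field_finite_span: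
  assumes "number_field TYPE('a::field_char_0)"
  obtains B :: "'a::field_char_0 set" where "finite B" "qvs.span B = UNIV"
proof -
  obtain B :: "'a set" where "finite_dimensional_vector_space (\<lambda>(q::rat) x. of_rat q * x) B"
    using assms by (auto simp: number_field_def)
  then interpret fd: finite_dimensional_vector_space "\<lambda>(q::rat) (x::'a). of_rat q * x" B .
  show ?thesis using that[OF fd.finite_Basis fd.span_Basis] .
qed

lemma number_field_algebraic:
  fixes x :: "'a::field_char_0"
  assumes "number_field TYPE('a)"
  shows "algebraic x"
proof -
  obtain B :: "'a set" where B: "finite B" "qvs.span B = UNIV"
    using number_field_finite_span[OF assms] .
  have "\<exists>p::rat poly. p \<noteq> 0 \<and> poly (map_poly of_rat p) x = 0"
  \<comment> \<open>If two powers coincide, the set of powers is too small for the dimension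
    argument, but X^i - X^j is already a polynomial with root \<open>x\<close>.\<close>
  proof (cases "inj_on (\<lambda>i. x ^ i) {..card B}")
    case False
    then obtain i j where ij: "i \<noteq> j" "x ^ i = x ^ j" by (auto simp: inj_on_def)
    have "coeff (monom 1 i - monom 1 j :: rat poly) i = 1" using ij by simp
    then have "monom 1 i - monom 1 j \<noteq> (0 :: rat poly)" by (metis coeff_0 zero_neq_one)
    moreover have "map_poly of_rat (monom 1 i - monom 1 j :: rat poly) = monom (1::'a) i - monom 1 j"
      by (rule poly_eqI) (auto simp: coeff_map_poly of_rat_diff)
    ultimately show ?thesis using ij by (intro exI[of _ "monom 1 i - monom 1 j"]) (simp add: poly_monom)
  next
    case True
    define S where "S = (\<lambda>i. x ^ i) ` {..card B}"
    have "card S = Suc (card B)" using True by (simp add: S_def card_image)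
    then have "qvs.dependent S"
      using qvs.independent_span_bound[OF B(1), of S] B(2) by fastforce
    then obtain u where u: "\<exists>v\<in>S. u v \<noteq> 0" "(\<Sum>v\<in>S. of_rat (u v) * v) = 0"
      using qvs.dependent_finite[of S] by (auto simp: S_def)
    define p where "p = (\<Sum>i\<le>card B. monom (u (x ^ i)) i)"
    have c: "coeff p i = (if i \<le> card B then u (x ^ i) else 0)" for i
      by (simp add: p_def coeff_sum sum.delta)
    have "p \<noteq> 0"
    proof
      assume p0: "p = 0"
      obtain i where "i \<le> card B" "u (x ^ i) \<noteq> 0" using u(1) by (auto simp: S_def)
      then show False using c[of i] p0 by simp
    qed
    moreover have "degree p \<le> card B" by (rule degree_le) (simp add: c)
    then have "poly (map_poly of_rat p) x = (\<Sum>i\<le>card B. of_rat (coeff p i) * x ^ i)"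
      by (subst poly_altdef, intro sum.mono_neutral_cong_left)
        (auto simp: degree_map_poly coeff_map_poly not_le coeff_eq_0)
    then have "poly (map_poly of_rat p) x = (\<Sum>i\<le>card B. of_rat (u (x ^ i)) * x ^ i)"
      by (simp add: c)
    then have "poly (map_poly of_rat p) x = 0"
      using u(2) True unfolding S_def by (simp add: sum.reindex)
    ultimately show ?thesis by blast
  qed
  then obtain p :: "rat poly" where p: "p \<noteq> 0" "poly (map_poly of_rat p) x = 0" by blast
  have "coeff (map_poly of_rat p :: 'a poly) (degree p) \<noteq> 0" using p(1) by (simp add: coeff_map_poly)
  then have "map_poly of_rat p \<noteq> (0 :: 'a poly)" by auto
  then show ?thesis
    unfolding algebraic_altdef using p(2)
    by (intro exI[of _ "map_poly of_rat p"]) (auto simp: coeff_map_poly)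
qed

text \<open>
  The embeddings are made into a finite type so that \<open>real ^ 'a emb\<close> and the matrices over it are
  available. A type definition has to be nonempty unconditionally, hence the junk case.
\<close>

typedef (overloaded) 'a emb = "{\<sigma> :: 'a::field_char_0 \<Rightarrow> complex.
    if finite (embeddings :: ('a \<Rightarrow> complex) set) \<and> (embeddings :: ('a \<Rightarrow> complex) set) \<noteq> {}
    then \<sigma> \<in> embeddings else \<sigma> = (\<lambda>_. 0)}"
  morphisms emb Abs_emb
  by (cases "finite (embeddings :: ('a \<Rightarrow> complex) set) \<and> (embeddings :: ('a \<Rightarrow> complex) set) \<noteq> {}") auto

instance emb :: (field_char_0) finite
proof
  have "finite (range (emb :: 'a emb \<Rightarrow> 'a \<Rightarrow> complex))"
    unfolding type_definition.Rep_range[OF type_definition_emb]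
    by (cases "finite (embeddings :: ('a \<Rightarrow> complex) set) \<and> (embeddings :: ('a \<Rightarrow> complex) set) \<noteq> {}") auto
  then show "finite (UNIV :: 'a emb set)"
    using finite_imageD[of emb UNIV] emb_inject by (auto simp: inj_on_def)
qed

text \<open>The change of variables theorems for \<open>real ^ 'n\<close> ask for a well-ordered index type.\<close>

instantiation emb :: (field_char_0) wellorder
begin

definition less_eq_emb :: "'a emb \<Rightarrow> 'a emb \<Rightarrow> bool" where
  "less_eq_emb x y \<longleftrightarrow> to_nat x \<le> to_nat y"

definition less_emb :: "'a emb \<Rightarrow> 'a emb \<Rightarrow> bool" where
  "less_emb x y \<longleftrightarrow> to_nat x < to_nat y"

instance
proof
  fix P :: "'a emb \<Rightarrow> bool" and x
  assume "\<And>x. (\<And>y. y < x \<Longrightarrow> P y) \<Longrightarrow> P x"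
  then show "P x" by (rule measure_induct_rule[of to_nat]) (simp add: less_emb_def)
qed (auto simp: less_eq_emb_def less_emb_def)

end

text \<open>Connects the list-indexed matrix of the definition of the discriminant with matrices
  indexed by a finite type. Rows and columns are enumerated by the same \<open>e\<close>, so
  transporting permutations along \<open>e\<close> preserves signs and no correction
  appears.\<close>

lemma det_mat_eq_det_vec:
  fixes f :: "'i::finite \<Rightarrow> 'i \<Rightarrow> 'b::comm_ring_1"
  assumes e: "bij_betw e {0..<n} (UNIV :: 'i set)"
  shows "Determinant.det (Matrix.mat n n (\<lambda>(i, j). f (e i) (e j))) = det (\<chi> i j. f i j)"
proof -
  have inj: "inj_on e {0..<n}" using e by (simp add: bij_betw_def)
  have "Determinant.det (Matrix.mat n n (\<lambda>(i, j). f (e i) (e j)))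
      = (\<Sum>p | p permutes {0..<n}. of_int (sign p) * (\<Prod>i = 0..<n. f (e i) (e (p i))))"
    unfolding Determinant.det_def
    by (auto intro!: sum.cong arg_cong2[where f = "(*)"] prod.cong simp: permutes_in_image[where S = "{0..<n}", simplified])
  also have "\<dots> = (\<Sum>p | p permutes {0..<n}. of_int (sign (map_permutation {0..<n} e p)) *
                    (\<Prod>i\<in>UNIV. f i (map_permutation {0..<n} e p i)))"
  proof (rule sum.cong, rule refl)
    fix p assume "p \<in> {p. p permutes {0..<n}}"
    then have p: "p permutes {0..<n}" by simp
    have "(\<Prod>i\<in>UNIV. f i (map_permutation {0..<n} e p i))
        = (\<Prod>i\<in>{0..<n}. f (e i) (map_permutation {0..<n} e p (e i)))"
      using prod.reindex_bij_betw[OF e, of "\<lambda>i. f i (map_permutation {0..<n} e p i)"] by simp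
    also have "\<dots> = (\<Prod>i\<in>{0..<n}. f (e i) (e (p i)))"
      by (rule prod.cong) (auto simp: map_permutation_apply[OF inj])
    finally show "of_int (sign p) * (\<Prod>i = 0..<n. f (e i) (e (p i))) =
        of_int (sign (map_permutation {0..<n} e p)) * (\<Prod>i\<in>UNIV. f i (map_permutation {0..<n} e p i))"
      by (simp add: sign_map_permutation[OF inj p])
  qed
  also have "\<dots> = (\<Sum>p | p permutes (UNIV :: 'i set). of_int (sign p) * (\<Prod>i\<in>UNIV. f i (p i)))"
  proof -
    have "bij_betw (map_permutation {0..<n} e) {p. p permutes {0..<n}} {p. p permutes UNIV}"
    proof (rule bij_betw_byWitness[where f' = "map_permutation UNIV (inv_into {0..<n} e)"])
      have e': "bij_betw (inv_into {0..<n} e) UNIV {0..<n}" by (rule bij_betw_inv_into[OF e])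
      show "\<forall>p\<in>{p. p permutes {0..<n}}. map_permutation UNIV (inv_into {0..<n} e) (map_permutation {0..<n} e p) = p"
        using map_permutation_compose_inv[OF e] inj by (simp add: inv_into_f_f)
      show "\<forall>p\<in>{p. p permutes UNIV}. map_permutation {0..<n} e (map_permutation UNIV (inv_into {0..<n} e) p) = p"
        using map_permutation_compose_inv[OF e', where g = e] e
        by (simp add: bij_betw_def f_inv_into_f)
      show "map_permutation {0..<n} e ` {p. p permutes {0..<n}} \<subseteq> {p. p permutes UNIV}"
        using map_permutation_permutes[OF e] by blast
      show "map_permutation UNIV (inv_into {0..<n} e) ` {p. p permutes UNIV} \<subseteq> {p. p permutes {0..<n}}"
        using map_permutation_permutes[OF e'] by blast
    qed
    then show ?thesis by (rule sum.reindex_bij_betw)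
  qed
  also have "\<dots> = det (\<chi> i j. f i j)" by (simp add: Determinants.det_def)
  finally show ?thesis .
qed

lemma Rats_sum: "(\<And>i. i \<in> A \<Longrightarrow> f i \<in> \<rat>) \<Longrightarrow> (sum f A :: 'b::field_char_0) \<in> \<rat>"
  by (induction A rule: infinite_finite_induct) auto

lemma Rats_prod: "(\<And>i. i \<in> A \<Longrightarrow> f i \<in> \<rat>) \<Longrightarrow> (prod f A :: 'b::field_char_0) \<in> \<rat>"
  by (induction A rule: infinite_finite_induct) auto

lemma det_Rats:
  fixes A :: "'b::field_char_0 ^ 'n ^ 'n"
  assumes "\<And>i j. A $ i $ j \<in> \<rat>"
  shows "det A \<in> \<rat>"
  unfolding Determinants.det_def using assms by (intro Rats_sum Rats_mult Rats_prod) auto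

lemma det_Ints:
  fixes A :: "'b::field_char_0 ^ 'n ^ 'n"
  assumes "\<And>i j. A $ i $ j \<in> \<int>"
  shows "det A \<in> \<int>"
  unfolding Determinants.det_def using assms by (intro Ints_sum Ints_mult Ints_prod) auto

lemma field_hom_of_int:
  assumes "field_hom \<sigma>"
  shows "\<sigma> (of_int k) = of_int k"
proof -
  interpret field_hom \<sigma> by fact
  have "\<sigma> (of_nat n) = of_nat n" for n
    by (induction n) (auto simp: hom_add)
  then show ?thesis by (cases k rule: int_cases2) (auto simp: hom_uminus)
qed

lemma field_hom_of_rat:
  fixes \<sigma> :: "'b::field_char_0 \<Rightarrow> 'c::field_char_0"
  assumes "field_hom \<sigma>"
  shows "\<sigma> (of_rat q) = of_rat q"
proof -
  interpret field_hom \<sigma> by fact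
  obtain a b where q: "q = Rat.Fract a b" "b > 0" by (cases q) auto
  then show ?thesis
    by (simp add: of_rat_rat divide_inverse hom_mult hom_inverse field_hom_of_int[OF assms])
qed

section \<open>Embeddings of a number field, trace and norm\<close>

locale numfield =
  fixes K :: "'a::field_char_0 itself"
  assumes number_field: "number_field K"
begin

lemma number_field': "number_field TYPE('a)"
  using number_field by (simp add: number_field_def)

lemma algebraic: "algebraic (x :: 'a)"
  by (rule number_field_algebraic[OF number_field'])

text \<open>An embedding is determined by its values on a finite spanning set, and each value is a
  root of a fixed integer polynomial; this gives finiteness. The lower bound on the number comes
  from \<open>enough_homs_UNIV\<close>, and it excludes emptiness, because an empty set would have
  to span K.\<close>

lemma embeddings_finite_nonempty:
  shows "finite (embeddings :: ('a \<Rightarrow> complex) set)" "(embeddings :: ('a \<Rightarrow> complex) set) \<noteq> {}"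
    and embeddings_span: "\<exists>B::'a set. finite B \<and> qvs.span B = UNIV \<and> card B \<le> card (embeddings :: ('a \<Rightarrow> complex) set)"
proof -
  obtain B0 :: "'a set" where B0: "finite B0" "qvs.span B0 = UNIV"
    using number_field_finite_span[OF number_field'] .
  have "\<exists>p. (\<forall>i. coeff p i \<in> \<int>) \<and> p \<noteq> 0 \<and> poly p x = 0" for x :: 'a
    using algebraic[of x] unfolding algebraic_def .
  then obtain p where p: "\<And>x::'a. \<forall>i. coeff (p x) i \<in> \<int>" "\<And>x. p x \<noteq> 0" "\<And>x. poly (p x) x = 0"
    by metis
  define R where "R = (\<lambda>x. {z::complex. \<exists>\<sigma>. field_hom \<sigma> \<and> poly (map_poly \<sigma> (p x)) z = 0})"
  have finR: "finite (R x)" for x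
  proof -
    obtain c where c: "\<And>i. coeff (p x) i = of_int (c i)"
    proof -
      have "\<exists>c. \<forall>i. coeff (p x) i = of_int (c i)"
        using p(1)[of x] unfolding Ints_def image_iff by (intro choice) auto
      then show ?thesis using that by auto
    qed
    \<comment> \<open>The common image of \<open>p x\<close> under all embeddings: its coefficients
      are integers and hence fixed, so that \<open>R x\<close> lies in the root set of one
      polynomial.\<close>
    define q where "q = Poly (map (\<lambda>i. of_int (c i) :: complex) [0..<Suc (degree (p x))])"
    have cq: "coeff q i = of_int (c i)" for i
    proof (cases "i \<le> degree (p x)")
      case True
      then show ?thesis by (simp add: q_def nth_default_def del: upt_Suc)
    next
      case False
      then have "(of_int (c i) :: 'a) = 0" using c coeff_eq_0[of "p x" i] by simp
      then show ?thesis using False by (simp add: q_def nth_default_def del: upt_Suc)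
    qed
    have "map_poly \<sigma> (p x) = q" if "field_hom \<sigma>" for \<sigma> :: "'a \<Rightarrow> complex"
    proof -
      interpret field_hom \<sigma> by fact
      show ?thesis by (rule poly_eqI) (simp add: c cq coeff_map_poly field_hom_of_int[OF that])
    qed
    then have "R x \<subseteq> {z. poly q z = 0}" unfolding R_def by auto
    moreover have "q \<noteq> 0"
    proof
      assume "q = 0"
      then have "c i = 0" for i using cq[of i] by simp
      then have "coeff (p x) i = 0" for i using c by simp
      then show False using p(2)[of x] by (auto simp: poly_eq_iff)
    qed
    ultimately show ?thesis using poly_roots_finite finite_subset by blast
  qed
  have inR: "\<sigma> x \<in> R x" if "field_hom \<sigma>" for \<sigma> x
  proof -
    interpret field_hom \<sigma> by fact
    have "poly (map_poly \<sigma> (p x)) (\<sigma> x) = \<sigma> (poly (p x) x)" by simp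
    then show ?thesis using p(3)[of x] that unfolding R_def by auto
  qed
  have inj: "inj_on (\<lambda>\<sigma>. restrict \<sigma> B0) (embeddings :: ('a \<Rightarrow> complex) set)"
  proof (rule inj_onI)
    fix \<sigma> \<tau> :: "'a \<Rightarrow> complex"
    assume h: "\<sigma> \<in> embeddings" "\<tau> \<in> embeddings" and eq: "restrict \<sigma> B0 = restrict \<tau> B0"
    interpret s: field_hom \<sigma> using h by (simp add: embeddings_def)
    interpret t: field_hom \<tau> using h by (simp add: embeddings_def)
    have rat: "\<sigma> (of_rat q) = of_rat q" "\<tau> (of_rat q) = of_rat q" for q
      using h by (auto simp: embeddings_def field_hom_of_rat)
    have "\<sigma> x = \<tau> x" for x
    proof -
      have "x \<in> qvs.span B0" using B0 by simp
      then show ?thesis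
      proof (induction rule: qvs.span_induct_alt)
        case (step c b y)
        have "\<sigma> b = \<tau> b" using fun_cong[OF eq, of b] step by simp
        then show ?case using step by (simp add: s.hom_add t.hom_add s.hom_mult t.hom_mult rat)
      qed simp
    qed
    then show "\<sigma> = \<tau>" by auto
  qed
  have "(\<lambda>\<sigma>. restrict \<sigma> B0) ` embeddings \<subseteq> PiE B0 R"
    using inR by (auto simp: embeddings_def)
  then have "finite ((\<lambda>\<sigma>. restrict \<sigma> B0) ` (embeddings :: ('a \<Rightarrow> complex) set))"
    using finite_PiE[OF B0(1)] finR finite_subset by blast
  then show fin: "finite (embeddings :: ('a \<Rightarrow> complex) set)"
    using finite_imageD[OF _ inj] by blast
  have "enough_homs (UNIV :: 'a set)"
    by (rule enough_homs_UNIV[OF B0]) (rule algebraic)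
  then obtain B and \<Sigma> :: "('a \<Rightarrow> complex) set" where B: "finite B" "finite \<Sigma>" "(UNIV::'a set) \<subseteq> qvs.span B" "card B \<le> card \<Sigma>"
    "\<forall>\<sigma>\<in>\<Sigma>. hom_on UNIV \<sigma>"
    unfolding enough_homs_def by (elim exE conjE)
  have "\<Sigma> \<subseteq> embeddings"
  proof
    fix \<sigma> assume "\<sigma> \<in> \<Sigma>"
    then have h: "hom_on UNIV \<sigma>" using B(5) by blast
    moreover have "subfield_set (UNIV :: 'a set)" by (simp add: subfield_set_def)
    ultimately have "\<sigma> 0 = 0" using hom_on_0 by blast
    then have "field_hom \<sigma>" using h by unfold_locales (auto simp: hom_on_def)
    then show "\<sigma> \<in> embeddings" by (simp add: embeddings_def)
  qed
  then have "card \<Sigma> \<le> card (embeddings :: ('a \<Rightarrow> complex) set)" using fin by (rule card_mono[rotated])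
  then show ex: "\<exists>B::'a set. finite B \<and> qvs.span B = UNIV \<and> card B \<le> card (embeddings :: ('a \<Rightarrow> complex) set)"
    using B by (intro exI[of _ B]) auto
  show "(embeddings :: ('a \<Rightarrow> complex) set) \<noteq> {}"
  proof
    assume "(embeddings :: ('a \<Rightarrow> complex) set) = {}"
    then obtain B :: "'a set" where "finite B" "qvs.span B = UNIV" "card B = 0" using ex by auto
    then have "(UNIV :: 'a set) = {0}" by simp
    then show False by (metis UNIV_I singletonD zero_neq_one)
  qed
qed

lemma range_emb: "range (emb :: 'a emb \<Rightarrow> _) = embeddings"
  using embeddings_finite_nonempty by (simp add: type_definition.Rep_range[OF type_definition_emb])

lemma card_emb: "CARD('a emb) = card (embeddings :: ('a \<Rightarrow> complex) set)"
  using card_image[of emb "UNIV :: 'a emb set"] by (simp add: range_emb inj_on_def emb_inject)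

lemma field_hom_emb: "field_hom (emb (\<sigma> :: 'a emb))"
  using range_emb by (auto simp: embeddings_def)

sublocale emb: field_hom "emb (\<sigma> :: 'a emb)" for \<sigma>
  by (rule field_hom_emb)

lemma emb_of_rat [simp]: "emb (\<sigma> :: 'a emb) (of_rat q) = of_rat q"
  by (rule field_hom_of_rat[OF field_hom_emb])

lemma emb_of_int [simp]: "emb (\<sigma> :: 'a emb) (of_int k) = of_int k"
  by (rule field_hom_of_int[OF field_hom_emb])

lemma emb_sum: "emb (\<sigma> :: 'a emb) (sum f A) = (\<Sum>i\<in>A. emb \<sigma> (f i))"
  by (induction A rule: infinite_finite_induct) (auto simp: emb.hom_add)

lemma algebraic_int_emb:
  assumes "algebraic_int x"
  shows "algebraic_int (emb (\<sigma> :: 'a emb) x)"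
proof -
  obtain p where p: "poly (map_poly of_int p) x = 0" "lead_coeff p = 1"
    using assms by (auto simp: algebraic_int_altdef_ipoly)
  have "poly (map_poly of_int p) (emb \<sigma> x) = poly (map_poly (emb \<sigma>) (map_poly of_int p)) (emb \<sigma> x)"
    by (simp add: map_poly_map_poly o_def)
  also have "\<dots> = emb \<sigma> (poly (map_poly of_int p) x)" by simp
  finally show ?thesis using p by (auto simp: algebraic_int_altdef_ipoly)
qed

text \<open>Dedekind's argument: a relation is shortened until it is empty, using that distinct
  embeddings differ at some element.\<close>

lemma dedekind_independence:
  fixes c :: "'a emb \<Rightarrow> complex"
  assumes "\<And>x. (\<Sum>\<sigma>\<in>UNIV. c \<sigma> * emb \<sigma> x) = 0"
  shows "c \<sigma> = 0"
proof -
  have "(\<forall>x. (\<Sum>\<sigma>\<in>A. c \<sigma> * emb \<sigma> x) = 0) \<longrightarrow> (\<forall>\<sigma>\<in>A. c \<sigma> = 0)"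
    if "finite A" for A and c :: "'a emb \<Rightarrow> complex"
    using that
  proof (induction A arbitrary: c)
    case (insert \<tau> A)
    show ?case
    proof
      assume h: "\<forall>x. (\<Sum>\<sigma>\<in>insert \<tau> A. c \<sigma> * emb \<sigma> x) = 0"
      \<comment> \<open>The relation at y x minus \<open>emb \<tau> y\<close> times the relation at
        x no longer involves \<open>\<tau>\<close>.\<close>
      have zero: "c \<sigma> * (emb \<sigma> y - emb \<tau> y) = 0" if "\<sigma> \<in> A" for \<sigma> y
      proof -
        have "(\<Sum>\<sigma>\<in>A. (c \<sigma> * (emb \<sigma> y - emb \<tau> y)) * emb \<sigma> x) = 0" for x
        proof -
          have "(\<Sum>\<sigma>\<in>A. (c \<sigma> * (emb \<sigma> y - emb \<tau> y)) * emb \<sigma> x) =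
              (\<Sum>\<sigma>\<in>insert \<tau> A. (c \<sigma> * (emb \<sigma> y - emb \<tau> y)) * emb \<sigma> x)"
            using insert by simp
          also have "\<dots> = (\<Sum>\<sigma>\<in>insert \<tau> A. c \<sigma> * emb \<sigma> (y * x)) - emb \<tau> y * (\<Sum>\<sigma>\<in>insert \<tau> A. c \<sigma> * emb \<sigma> x)"
            by (simp only: sum_distrib_left sum_subtractf[symmetric] emb.hom_mult) (simp add: algebra_simps)
          finally show ?thesis using h by simp
        qed
        then show ?thesis using insert.IH[of "\<lambda>\<sigma>. c \<sigma> * (emb \<sigma> y - emb \<tau> y)"] that by blast
      qed
      have A0: "c \<sigma> = 0" if s: "\<sigma> \<in> A" for \<sigma>
      proof -
        have "\<sigma> \<noteq> \<tau>" using s insert by auto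
        then obtain y where "emb \<sigma> y \<noteq> emb \<tau> y" by (meson emb_inject ext)
        then show ?thesis using zero[OF s, of y] by simp
      qed
      moreover have "c \<tau> = 0" using h[rule_format, of 1] insert A0 by simp
      ultimately show "\<forall>\<sigma>\<in>insert \<tau> A. c \<sigma> = 0" by blast
    qed
  qed simp
  then show ?thesis using assms by (metis UNIV_I finite_class.finite_UNIV)
qed

definition emb_mat :: "('a emb \<Rightarrow> 'a) \<Rightarrow> complex ^ 'a emb ^ 'a emb" where
  "emb_mat \<omega> = (\<chi> \<sigma> j. emb \<sigma> (\<omega> j))"

text \<open>A linear relation between the rows is a relation between the embeddings on a spanning
  family, hence on all of K, against \<open>dedekind_independence\<close>.\<close>

lemma det_emb_mat_nonzero:
  assumes "qvs.span (range \<omega>) = UNIV"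
  shows "det (emb_mat \<omega>) \<noteq> 0"
proof -
  have "\<exists>B. emb_mat \<omega> ** B = mat 1"
    unfolding matrix_right_invertible_independent_rows
  proof (intro allI impI)
    fix c \<sigma> assume c: "(\<Sum>i\<in>UNIV. c i *s Finite_Cartesian_Product.row i (emb_mat \<omega>)) = 0"
    have conj_emb: "(\<Sum>\<sigma>\<in>UNIV. c \<sigma> * emb \<sigma> (\<omega> j)) = 0" for j
      using arg_cong[OF c, of "\<lambda>v. v $ j"] by (simp add: Finite_Cartesian_Product.row_def emb_mat_def sum_component)
    have "(\<Sum>\<sigma>\<in>UNIV. c \<sigma> * emb \<sigma> x) = 0" for x
    proof -
      have "x \<in> qvs.span (range \<omega>)" using assms by simp
      then show ?thesis
      proof (induction rule: qvs.span_induct_alt)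
        case (step q b y)
        then obtain j where "b = \<omega> j" by auto
        have "(\<Sum>\<sigma>\<in>UNIV. c \<sigma> * emb \<sigma> (of_rat q * b + y)) =
          of_rat q * (\<Sum>\<sigma>\<in>UNIV. c \<sigma> * emb \<sigma> b) + (\<Sum>\<sigma>\<in>UNIV. c \<sigma> * emb \<sigma> y)"
          by (simp add: emb.hom_add emb.hom_mult sum_distrib_left sum.distrib algebra_simps)
        then show ?case using conj_emb[of j] step by (simp add: \<open>b = \<omega> j\<close>)
      qed simp
    qed
    then show "c \<sigma> = 0" by (rule dedekind_independence)
  qed
  then have "invertible (emb_mat \<omega>)" by (simp add: invertible_right_inverse)
  then show ?thesis by (simp add: invertible_det_nz)
qed

lemma inj_basis:
  fixes \<omega> :: "'a emb \<Rightarrow> 'a"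
  assumes "qvs.span (range \<omega>) = UNIV"
  shows "inj \<omega>"
proof (rule injI, rule ccontr)
  fix i j assume "\<omega> i = \<omega> j" "i \<noteq> j"
  then have "Finite_Cartesian_Product.column i (emb_mat \<omega>) = Finite_Cartesian_Product.column j (emb_mat \<omega>)"
    by (simp add: Finite_Cartesian_Product.column_def emb_mat_def)
  then have "det (emb_mat \<omega>) = 0" by (rule det_identical_columns[OF \<open>i \<noteq> j\<close>])
  then show False using det_emb_mat_nonzero[OF assms] by simp
qed

lemma rat_coords:
  fixes \<omega> :: "'a emb \<Rightarrow> 'a"
  assumes "qvs.span (range \<omega>) = UNIV"
  obtains q where "x = (\<Sum>j\<in>UNIV. of_rat (q j) * \<omega> (j :: 'a emb))"
proof -
  have "x \<in> qvs.span (range \<omega>)" using assms by simp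
  then obtain u where "x = (\<Sum>v\<in>range \<omega>. of_rat (u v) * v)"
    using qvs.span_finite[of "range \<omega>"] by auto
  also have "\<dots> = (\<Sum>j\<in>UNIV. of_rat (u (\<omega> j)) * \<omega> j)"
    using inj_basis[OF assms] by (simp add: sum.reindex)
  finally show ?thesis by (rule that)
qed


lemma integral_rat_basis_exists:
  obtains \<omega> :: "'a emb \<Rightarrow> 'a" where "qvs.span (range \<omega>) = UNIV" "\<And>j. algebraic_int (\<omega> j)"
proof -
  obtain B :: "'a set" where B: "finite B" "qvs.span B = UNIV" "card B \<le> CARD('a emb)"
    using embeddings_span card_emb by auto
  obtain f where f: "inj_on f B" "f ` B \<subseteq> (UNIV :: 'a emb set)"
    using card_le_inj[OF B(1) finite_class.finite_UNIV B(3)] by blast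
  \<comment> \<open>Indices beyond the size of \<open>B\<close> receive 0. Only spanning is claimed;
    that the family is a basis follows afterwards from \<open>det_emb_mat_nonzero\<close>.\<close>
  define \<omega>0 where "\<omega>0 = (\<lambda>j. if j \<in> f ` B then inv_into B f j else 0)"
  have "\<exists>k::int. k > 0 \<and> algebraic_int (of_int k * x)" for x :: 'a
    using algebraic_scaled_algebraic_int[OF algebraic[of x]] by blast
  then obtain k :: "'a \<Rightarrow> int" where k: "\<And>x. k x > 0" "\<And>x. algebraic_int (of_int (k x) * x)"
    by metis
  define \<omega> where "\<omega> = (\<lambda>j. of_int (k (\<omega>0 j)) * \<omega>0 j)"
  have "B \<subseteq> qvs.span (range \<omega>)"
  proof
    fix b assume b: "b \<in> B"
    then have "\<omega>0 (f b) = b" using f by (simp add: \<omega>0_def)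
    then have "b = of_rat (inverse (of_int (k b))) * \<omega> (f b)"
      using k(1)[of b] by (simp add: \<omega>_def of_rat_inverse)
    moreover have "of_rat (inverse (of_int (k b))) * \<omega> (f b) \<in> qvs.span (range \<omega>)"
      by (intro qvs.span_scale qvs.span_base) auto
    ultimately show "b \<in> qvs.span (range \<omega>)" by simp
  qed
  then have "qvs.span (range \<omega>) = UNIV"
    using qvs.span_minimal[OF _ qvs.subspace_span] B(2) by blast
  moreover have "algebraic_int (\<omega> j)" for j unfolding \<omega>_def by (rule k)
  ultimately show ?thesis using that by blast
qed

definition Tr :: "'a \<Rightarrow> complex" where "Tr x = (\<Sum>\<sigma>\<in>UNIV. emb \<sigma> x)"

definition Nm :: "'a \<Rightarrow> complex" where "Nm x = (\<Prod>\<sigma>\<in>UNIV. emb \<sigma> x)"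

text \<open>Multiplication by \<open>x\<close> has a rational matrix \<open>A\<close> with respect
  to \<omega>, and \<open>emb_mat \<omega>\<close> conjugates it to the diagonal matrix of the
  conjugates of \<open>x\<close>. So \<open>Tr x\<close> and \<open>Nm x\<close> are the trace and
  the determinant of \<open>A\<close>.\<close>

lemma trace_norm_rational: "Tr x \<in> \<rat>" "Nm x \<in> \<rat>"
proof -
  obtain \<omega> :: "'a emb \<Rightarrow> 'a" where \<omega>: "qvs.span (range \<omega>) = UNIV" using integral_rat_basis_exists .
  have "\<exists>q. \<forall>j. x * \<omega> j = (\<Sum>k\<in>UNIV. of_rat (q j k) * \<omega> k)"
    by (intro choice allI) (rule rat_coords[OF \<omega>], rule exI)
  then obtain q where q: "\<And>j. x * \<omega> j = (\<Sum>k\<in>UNIV. of_rat (q j k) * \<omega> k)" by blast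
  define A :: "complex ^ 'a emb ^ 'a emb" where "A = (\<chi> k j. of_rat (q j k))"
  define D :: "complex ^ 'a emb ^ 'a emb" where "D = (\<chi> i j. if i = j then emb i x else 0)"
  have eq: "D ** emb_mat \<omega> = emb_mat \<omega> ** A"
  proof -
    have "(D ** emb_mat \<omega>) $ \<sigma> $ j = (emb_mat \<omega> ** A) $ \<sigma> $ j" for \<sigma> j
    proof -
      have "(D ** emb_mat \<omega>) $ \<sigma> $ j = (\<Sum>k\<in>UNIV. (if \<sigma> = k then emb \<sigma> x else 0) * emb k (\<omega> j))"
        by (simp add: matrix_matrix_mult_def D_def emb_mat_def)
      also have "\<dots> = (\<Sum>k\<in>UNIV. if k = \<sigma> then emb \<sigma> x * emb \<sigma> (\<omega> j) else 0)"
        by (intro sum.cong) auto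
      also have "\<dots> = emb \<sigma> (x * \<omega> j)" by (simp add: emb.hom_mult)
      also have "\<dots> = (\<Sum>k\<in>UNIV. of_rat (q j k) * emb \<sigma> (\<omega> k))"
        by (simp add: q emb_sum emb.hom_mult)
      also have "\<dots> = (emb_mat \<omega> ** A) $ \<sigma> $ j"
        by (simp add: matrix_matrix_mult_def A_def emb_mat_def mult.commute)
      finally show ?thesis .
    qed
    then show ?thesis by (simp add: vec_eq_iff)
  qed
  have nz: "det (emb_mat \<omega>) \<noteq> 0" by (rule det_emb_mat_nonzero[OF \<omega>])
  have "det D * det (emb_mat \<omega>) = det (emb_mat \<omega>) * det A"
    using arg_cong[OF eq, of det] by (simp add: Determinants.det_mul)
  then have "det D = det A" using nz by simp
  moreover have "det D = Nm x"
    by (subst Determinants.det_diagonal) (auto simp: D_def Nm_def)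
  ultimately show "Nm x \<in> \<rat>" using det_Rats[of A] by (simp add: A_def)
  obtain V where V: "emb_mat \<omega> ** V = mat 1" "V ** emb_mat \<omega> = mat 1"
    using nz invertible_det_nz[of "emb_mat \<omega>"] unfolding invertible_def by blast
  have "D = (D ** emb_mat \<omega>) ** V" by (simp add: V matrix_mul_assoc[symmetric])
  also have "\<dots> = emb_mat \<omega> ** (A ** V)" by (simp add: eq matrix_mul_assoc)
  finally have "trace D = trace ((A ** V) ** emb_mat \<omega>)" by (simp add: trace_mul_sym[of "emb_mat \<omega>"])
  also have "\<dots> = trace A" by (simp add: matrix_mul_assoc[symmetric] V)
  finally have "trace D = trace A" .
  moreover have "trace D = Tr x" by (simp add: Determinants.trace_def D_def Tr_def)
  moreover have "trace A \<in> \<rat>" unfolding Determinants.trace_def by (intro Rats_sum) (simp add: A_def)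
  ultimately show "Tr x \<in> \<rat>" by simp
qed

lemma trace_norm_Ints:
  assumes "algebraic_int x"
  shows "Tr x \<in> \<int>" "Nm x \<in> \<int>"
proof -
  have "algebraic_int (Tr x)" "algebraic_int (Nm x)"
    unfolding Tr_def Nm_def by (intro algebraic_int_sum algebraic_int_prod algebraic_int_emb assms)+
  then show "Tr x \<in> \<int>" "Nm x \<in> \<int>"
    using rational_algebraic_int_is_int trace_norm_rational by auto
qed

lemma Nm_nonzero: "x \<noteq> 0 \<Longrightarrow> Nm x \<noteq> 0"
  by (simp add: Nm_def)

lemma Nm_ge_1:
  assumes "algebraic_int x" "x \<noteq> 0"
  shows "cmod (Nm x) \<ge> 1"
proof -
  obtain k where k: "Nm x = of_int k" using trace_norm_Ints(2)[OF assms(1)] by (auto elim: Ints_cases)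
  then have "k \<noteq> 0" using Nm_nonzero[OF assms(2)] by auto
  then have "\<bar>real_of_int k\<bar> \<ge> 1" by simp
  then show ?thesis by (simp add: k)
qed

text \<open>The square is the determinant of the Gram matrix of the trace form, with entries
  Tr(\<omega>_i \<omega>_j).\<close>

lemma det_emb_mat_square_Ints:
  assumes "\<And>j. algebraic_int (\<omega> j)"
  shows "(det (emb_mat \<omega>))\<^sup>2 \<in> \<int>"
proof -
  have "(det (emb_mat \<omega>))\<^sup>2 = det (Finite_Cartesian_Product.transpose (emb_mat \<omega>) ** emb_mat \<omega>)"
    by (simp add: Determinants.det_mul Determinants.det_transpose power2_eq_square)
  also have "\<dots> \<in> \<int>"
  proof (rule det_Ints)
    fix i j
    have "(Finite_Cartesian_Product.transpose (emb_mat \<omega>) ** emb_mat \<omega>) $ i $ j = Tr (\<omega> i * \<omega> j)"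
      by (simp add: matrix_matrix_mult_def Finite_Cartesian_Product.transpose_def emb_mat_def Tr_def emb.hom_mult)
    then show "(Finite_Cartesian_Product.transpose (emb_mat \<omega>) ** emb_mat \<omega>) $ i $ j \<in> \<int>"
      using trace_norm_Ints(1) algebraic_int_times[OF assms assms] by simp
  qed
  finally show ?thesis .
qed

text \<open>The family has one member for each embedding, so that spanning already forces linear
  independence (\<open>zbasis_inj_Z\<close>).\<close>

definition zbasis :: "('a emb \<Rightarrow> 'a) \<Rightarrow> bool" where
  "zbasis \<omega> \<longleftrightarrow> qvs.span (range \<omega>) = UNIV \<and> (\<forall>j. algebraic_int (\<omega> j)) \<and>
     (\<forall>x. algebraic_int x \<longrightarrow> (\<exists>c. x = (\<Sum>j\<in>UNIV. of_int (c j) * \<omega> j)))"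

lemma det_emb_mat_exchange:
  assumes "x = (\<Sum>j\<in>UNIV. of_rat (q j) * \<omega> j)"
  shows "det (emb_mat (fun_upd \<omega> k x)) = of_rat (q k) * det (emb_mat \<omega>)"
proof -
  define c :: "complex ^ 'a emb" where "c = (\<chi> j. of_rat (q j))"
  have "emb_mat (fun_upd \<omega> k x) = (\<chi> i j. if j = k then (emb_mat \<omega> *v c) $ i else emb_mat \<omega> $ i $ j)"
    by (auto simp: vec_eq_iff emb_mat_def c_def matrix_vector_mult_def assms emb_sum emb.hom_mult mult.commute)
  then show ?thesis by (simp add: cramer_lemma c_def)
qed

text \<open>Among all spanning families of integers, one with least absolute squared determinant is
  an integral basis: if an integer had a nonintegral coordinate, its fractional part could replace a
  basis element and multiply that square by r^2 < 1.\<close>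

lemma zbasis_exists: "\<exists>\<omega>. zbasis \<omega>"
proof -
  define P where "P = (\<lambda>\<omega> :: 'a emb \<Rightarrow> 'a. qvs.span (range \<omega>) = UNIV \<and> (\<forall>j. algebraic_int (\<omega> j)))"
  define D where "D = (\<lambda>\<omega>. SOME d. (det (emb_mat \<omega>))\<^sup>2 = of_int d)"
  have D: "(det (emb_mat \<omega>))\<^sup>2 = of_int (D \<omega>)" if "P \<omega>" for \<omega>
  proof -
    have "(det (emb_mat \<omega>))\<^sup>2 \<in> \<int>" using that det_emb_mat_square_Ints by (simp add: P_def)
    then have "\<exists>d. (det (emb_mat \<omega>))\<^sup>2 = of_int d" by (auto elim: Ints_cases)
    then show ?thesis unfolding D_def by (rule someI_ex)
  qed
  obtain \<omega>0 :: "'a emb \<Rightarrow> 'a" where "P \<omega>0" using integral_rat_basis_exists unfolding P_def by (metis (no_types, lifting))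
  then obtain \<omega> where \<omega>: "P \<omega>" and min: "\<And>\<omega>'. P \<omega>' \<Longrightarrow> nat \<bar>D \<omega>\<bar> \<le> nat \<bar>D \<omega>'\<bar>"
    using ex_has_least_nat[of P \<omega>0 "\<lambda>\<omega>. nat \<bar>D \<omega>\<bar>"] by blast
  have span: "qvs.span (range \<omega>) = UNIV" and int: "\<And>j. algebraic_int (\<omega> j)" using \<omega> by (auto simp: P_def)
  have nz: "det (emb_mat \<omega>) \<noteq> 0" by (rule det_emb_mat_nonzero[OF span])
  have "\<exists>c. x = (\<Sum>j\<in>UNIV. of_int (c j) * \<omega> j)" if x: "algebraic_int x" for x
  proof -
    obtain q where q: "x = (\<Sum>j\<in>UNIV. of_rat (q j) * \<omega> j)" by (rule rat_coords[OF span])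
    define r where "r = (\<lambda>j. frac (q j))"
    \<comment> \<open>Still an integer, but with all coordinates in [0,1).\<close>
    define y where "y = x - (\<Sum>j\<in>UNIV. of_int \<lfloor>q j\<rfloor> * \<omega> j)"
    have "of_rat (r j) = of_rat (q j) - (of_int \<lfloor>q j\<rfloor> :: 'a)" for j
      by (simp add: r_def frac_def of_rat_diff)
    then have y: "y = (\<Sum>j\<in>UNIV. of_rat (r j) * \<omega> j)"
      by (simp add: y_def q sum_subtractf[symmetric] left_diff_distrib)
    have yint: "algebraic_int y"
      unfolding y_def using x int by (intro algebraic_int_diff algebraic_int_sum algebraic_int_times) auto
    have "r k = 0" for k
    proof (rule ccontr)
      assume rk: "r k \<noteq> 0"
      define \<omega>' where "\<omega>' = fun_upd \<omega> k y"
      have "range \<omega> \<subseteq> qvs.span (range \<omega>')"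
      proof
        fix b assume "b \<in> range \<omega>"
        then obtain j where j: "b = \<omega> j" by auto
        have base: "\<omega> i \<in> qvs.span (range \<omega>')" if "i \<noteq> k" for i
          by (rule qvs.span_base) (use that in \<open>auto simp: \<omega>'_def intro!: image_eqI[of _ _ i]\<close>)
        have ybase: "y \<in> qvs.span (range \<omega>')"
          by (rule qvs.span_base) (auto simp: \<omega>'_def intro!: image_eqI[of _ _ k])
        show "b \<in> qvs.span (range \<omega>')"
        proof (cases "j = k")
          case False
          then show ?thesis using base j by simp
        next
          case True
          have "y = of_rat (r k) * \<omega> k + (\<Sum>i\<in>UNIV - {k}. of_rat (r i) * \<omega> i)"
            unfolding y by (rule sum.remove) auto
          then have "\<omega> k = of_rat (inverse (r k)) * (y - (\<Sum>i\<in>UNIV - {k}. of_rat (r i) * \<omega> i))"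
            using rk by (simp add: of_rat_inverse)
          also have "\<dots> \<in> qvs.span (range \<omega>')"
            by (intro qvs.span_scale qvs.span_diff qvs.span_sum ybase base) auto
          finally show ?thesis using True j by simp
        qed
      qed
      then have "qvs.span (range \<omega>') = UNIV"
        using qvs.span_minimal[OF _ qvs.subspace_span] span by blast
      then have P': "P \<omega>'" using int yint by (auto simp: P_def \<omega>'_def)
      have "det (emb_mat \<omega>') = of_rat (r k) * det (emb_mat \<omega>)"
        unfolding \<omega>'_def by (rule det_emb_mat_exchange[OF y])
      then have "of_int (D \<omega>') = ((of_rat (r k))\<^sup>2 * of_int (D \<omega>) :: complex)"
        using D[OF P'] D[OF \<omega>] by (simp add: power_mult_distrib)
      also have "\<dots> = of_rat ((r k)\<^sup>2 * of_int (D \<omega>))" by (simp add: of_rat_mult of_rat_power)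
      finally have "of_rat (of_int (D \<omega>')) = (of_rat ((r k)\<^sup>2 * of_int (D \<omega>)) :: complex)" by simp
      then have e: "(of_int (D \<omega>') :: rat) = (r k)\<^sup>2 * of_int (D \<omega>)" using of_rat_eq_iff by blast
      have "D \<omega> \<noteq> 0" using D[OF \<omega>] nz by auto
      moreover have "0 \<le> r k" "r k < 1" by (auto simp: r_def frac_lt_1)
      then have "(r k)\<^sup>2 < 1" using rk by (simp add: abs_square_less_1)
      ultimately have "\<bar>of_int (D \<omega>') :: rat\<bar> < \<bar>of_int (D \<omega>)\<bar>" by (simp add: e abs_mult)
      then have "\<bar>D \<omega>'\<bar> < \<bar>D \<omega>\<bar>" by linarith
      then show False using min[OF P'] by linarith
    qed
    then have "y = 0" using y by simp
    then show ?thesis unfolding y_def by (intro exI[of _ "\<lambda>j. \<lfloor>q j\<rfloor>"]) simp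
  qed
  then show ?thesis using span int unfolding zbasis_def by blast
qed

text \<open>The transition matrices in both directions are integral, so their determinants k and l
  satisfy k l = 1 and k^2 = 1.\<close>

lemma zbasis_det_square_eq:
  assumes "zbasis \<omega>" "zbasis \<omega>'"
  shows "(det (emb_mat \<omega>))\<^sup>2 = (det (emb_mat \<omega>'))\<^sup>2"
proof -
  have *: "\<exists>k::int. det (emb_mat \<omega>') = det (emb_mat \<omega>) * of_int k"
    if b: "zbasis \<omega>" "zbasis \<omega>'" for \<omega> \<omega>'
  proof -
    have "\<exists>c. \<forall>j. \<omega>' j = (\<Sum>i\<in>UNIV. of_int (c j i) * \<omega> i)"
      using b unfolding zbasis_def by (intro choice allI) blast
    then obtain c where c: "\<And>j. \<omega>' j = (\<Sum>i\<in>UNIV. of_int (c j i) * \<omega> i)" by blast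
    define U :: "complex ^ 'a emb ^ 'a emb" where "U = (\<chi> i j. of_int (c j i))"
    have "emb_mat \<omega>' = emb_mat \<omega> ** U"
      by (simp add: vec_eq_iff matrix_matrix_mult_def emb_mat_def U_def c emb_sum emb.hom_mult mult.commute)
    moreover have "det U \<in> \<int>" by (rule det_Ints) (simp add: U_def)
    ultimately show ?thesis by (metis Determinants.det_mul Ints_cases)
  qed
  obtain k l :: int where k: "det (emb_mat \<omega>') = det (emb_mat \<omega>) * of_int k"
    "det (emb_mat \<omega>) = det (emb_mat \<omega>') * of_int l"
    using *[OF assms] *[OF assms(2,1)] by blast
  have "det (emb_mat \<omega>) \<noteq> 0" using det_emb_mat_nonzero assms by (auto simp: zbasis_def)
  moreover have "det (emb_mat \<omega>) = det (emb_mat \<omega>) * of_int (k * l)"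
    by (metis k mult.assoc of_int_mult)
  ultimately have "of_int (k * l) = (1::complex)" by simp
  then have "k * l = 1" using of_int_eq_1_iff by blast
  then have "k\<^sup>2 = 1" by (auto simp: zmult_eq_1_iff)
  then have "(of_int k)\<^sup>2 = (1::complex)" by (metis of_int_1 of_int_power)
  then show ?thesis by (simp add: k(1) power_mult_distrib)
qed

text \<open>By Cramer's rule, exchanging the k-th basis element for 0, which has coordinates
  \<open>c\<close>, multiplies the determinant by \<open>c k\<close>; but a zero column makes it
  0.\<close>

lemma zbasis_inj_Z:
  assumes "zbasis \<omega>" "(\<Sum>j\<in>UNIV. of_rat (c j) * \<omega> j) = 0"
  shows "c k = 0"
proof -
  have "det (emb_mat (fun_upd \<omega> k 0)) = of_rat (c k) * det (emb_mat \<omega>)"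
    by (rule det_emb_mat_exchange) (simp add: assms(2))
  moreover have "Finite_Cartesian_Product.column k (emb_mat (fun_upd \<omega> k 0)) = 0"
    by (simp add: Finite_Cartesian_Product.column_def emb_mat_def vec_eq_iff)
  then have "det (emb_mat (fun_upd \<omega> k 0)) = 0" by (rule Determinants.det_zero_column)
  ultimately show ?thesis using det_emb_mat_nonzero assms(1) by (auto simp: zbasis_def)
qed

lemma integral_basis_range:
  assumes "zbasis \<omega>"
  shows "integral_basis (range \<omega>)"
proof -
  have inj: "inj \<omega>" using inj_basis assms by (simp add: zbasis_def)
  have "\<not> zmod.dependent (range \<omega>)"
  proof
    assume "zmod.dependent (range \<omega>)"
    then obtain u where u: "\<exists>v\<in>range \<omega>. u v \<noteq> 0" "(\<Sum>v\<in>range \<omega>. of_int (u v) * v) = 0"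
      using zmod.dependent_finite[of "range \<omega>"] by auto
    have "(\<Sum>j\<in>UNIV. of_rat (of_int (u (\<omega> j))) * \<omega> j) = 0"
      using u(2) inj by (simp add: sum.reindex)
    then have "of_int (u (\<omega> k)) = (0::rat)" for k
      using zbasis_inj_Z[OF assms, of "\<lambda>j. of_int (u (\<omega> j))"] by blast
    then show False using u(1) by auto
  qed
  moreover have "zmod.span (range \<omega>) = {x. algebraic_int x}"
  proof (intro equalityI subsetI)
    fix x assume "x \<in> zmod.span (range \<omega>)"
    then have "algebraic_int x"
    proof (induction rule: zmod.span_induct_alt)
      case (step c b y)
      then show ?case using assms by (auto simp: zbasis_def intro!: algebraic_int_plus algebraic_int_times)
    qed simp
    then show "x \<in> {x. algebraic_int x}" by simp
  next
    fix x :: 'a assume "x \<in> {x. algebraic_int x}"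
    then obtain c where "x = (\<Sum>j\<in>UNIV. of_int (c j) * \<omega> j)" using assms unfolding zbasis_def by blast
    moreover have "(\<Sum>j\<in>UNIV. of_int (c j) * \<omega> j) \<in> zmod.span (range \<omega>)"
      by (intro zmod.span_sum zmod.span_scale zmod.span_base) auto
    ultimately show "x \<in> zmod.span (range \<omega>)" by simp
  qed
  ultimately show ?thesis by (simp add: integral_basis_def integer_ring_def)
qed

text \<open>Needed because the discriminant is defined with an arbitrary integral basis, whose size
  must match the number of embeddings. Independence over Z becomes independence over Q by clearing
  denominators, after which the size is compared with that of a \<open>zbasis\<close>.\<close>

lemma integral_basis_card:
  assumes "integral_basis (B :: 'a set)"
  shows "qvs.span B = UNIV" "finite B" "card B = CARD('a emb)"
proof -
  have ind: "\<not> zmod.dependent B" and span: "zmod.span B = {x. algebraic_int x}"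
    using assms by (auto simp: integral_basis_def integer_ring_def)
  have sub: "zmod.span B \<subseteq> qvs.span B"
  proof
    fix x assume "x \<in> zmod.span B"
    then show "x \<in> qvs.span B"
    proof (induction rule: zmod.span_induct_alt)
      case (step c b y)
      have "of_rat (of_int c) * b + y \<in> qvs.span B"
        by (intro qvs.span_add qvs.span_scale qvs.span_base step)
      then show ?case by simp
    qed (rule qvs.span_zero)
  qed
  show qspan: "qvs.span B = UNIV"
  proof -
    have "x \<in> qvs.span B" for x
    proof -
      obtain k :: int where k: "k > 0" "algebraic_int (of_int k * x)"
        using algebraic_scaled_algebraic_int[OF algebraic] .
      then have "of_int k * x \<in> qvs.span B" using span sub by auto
      then have "of_rat (inverse (of_int k)) * (of_int k * x) \<in> qvs.span B" by (rule qvs.span_scale)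
      then show ?thesis using k by (simp add: of_rat_inverse mult.assoc[symmetric])
    qed
    then show ?thesis by auto
  qed
  have qind: "\<not> qvs.dependent B"
  proof
    assume "qvs.dependent B"
    then obtain t u where t: "finite t" "t \<subseteq> B" "(\<Sum>v\<in>t. of_rat (u v) * v) = 0" "\<exists>v\<in>t. u v \<noteq> 0"
      unfolding qvs.dependent_explicit by blast
    define den where "den = (\<lambda>v. snd (quotient_of (u v)))"
    define m where "m = (\<Prod>v\<in>t. den v)"
    have den: "den v > 0" for v by (simp add: den_def quotient_of_denom_pos')
    have "\<exists>k. \<forall>v\<in>t. of_int m * u v = of_int (k v :: int)"
    proof (rule bchoice, rule ballI)
      fix v assume v: "v \<in> t"
      define a R where "a = fst (quotient_of (u v))" and "R = (\<Prod>w\<in>t - {v}. den w)"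
      have "quotient_of (u v) = (a, den v)" by (simp add: den_def a_def)
      then have uv: "of_int (den v) * u v = of_int a"
        using quotient_of_div[of "u v" a "den v"] den[of v] by simp
      have "m = R * den v"
        unfolding m_def R_def by (simp add: prod.remove[OF t(1) v])
      then have "of_int m * u v = of_int R * (of_int (den v) * u v)" by simp
      then have "of_int m * u v = of_int (R * a)" by (simp only: uv of_int_mult)
      then show "\<exists>k::int. of_int m * u v = of_int k" by blast
    qed
    then obtain k where k: "\<And>v. v \<in> t \<Longrightarrow> of_int m * u v = of_int (k v :: int)" by blast
    have "(\<Sum>v\<in>t. of_int (k v) * v) = of_int m * (\<Sum>v\<in>t. of_rat (u v) * v)"
      unfolding sum_distrib_left
    proof (rule sum.cong)
      fix v assume "v \<in> t"
      have "(of_int (k v) :: 'a) = of_rat (of_int m * u v)" using k[OF \<open>v \<in> t\<close>] by simp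
      then show "of_int (k v) * v = of_int m * (of_rat (u v) * v)" by (simp add: of_rat_mult)
    qed simp
    then have "(\<Sum>v\<in>t. of_int (k v) * v) = 0" using t(3) by simp
    then have "k v = 0" if "v \<in> t" for v
      using zmod.independentD[OF ind t(1,2)] that by blast
    moreover have "m > 0" unfolding m_def using den by (simp add: prod_pos)
    ultimately show False using t(4) k by fastforce
  qed
  obtain \<omega> where \<omega>: "zbasis \<omega>" using zbasis_exists by blast
  have wspan: "qvs.span (range \<omega>) = UNIV" and inj: "inj \<omega>"
    using \<omega> inj_basis by (auto simp: zbasis_def)
  have wind: "\<not> qvs.dependent (range \<omega>)"
  proof
    assume "qvs.dependent (range \<omega>)"
    then obtain u where u: "\<exists>v\<in>range \<omega>. u v \<noteq> 0" "(\<Sum>v\<in>range \<omega>. of_rat (u v) * v) = 0"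
      using qvs.dependent_finite[of "range \<omega>"] by auto
    have "(\<Sum>j\<in>UNIV. of_rat (u (\<omega> j)) * \<omega> j) = 0"
      using u(2) inj by (simp add: sum.reindex)
    then have "u (\<omega> k) = 0" for k using zbasis_inj_Z[OF \<omega>, of "\<lambda>j. u (\<omega> j)"] by blast
    then show False using u(1) by auto
  qed
  have 1: "finite B \<and> card B \<le> card (range \<omega>)"
    by (rule qvs.independent_span_bound) (use qind wspan in auto)
  then show "finite B" by blast
  have "finite (range \<omega>) \<and> card (range \<omega>) \<le> card B"
    by (rule qvs.independent_span_bound) (use 1 wind qspan in auto)
  then show "card B = CARD('a emb)" using 1 inj card_image by force
qed

lemma integral_basis_zbasis:
  assumes "integral_basis (range \<omega>)" "inj (\<omega> :: 'a emb \<Rightarrow> 'a)"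
  shows "zbasis \<omega>"
proof -
  have span: "zmod.span (range \<omega>) = {x. algebraic_int x}"
    using assms(1) by (auto simp: integral_basis_def integer_ring_def)
  have "\<exists>c. x = (\<Sum>j\<in>UNIV. of_int (c j) * \<omega> j)" if "algebraic_int x" for x
  proof -
    have "x \<in> zmod.span (range \<omega>)" using that span by simp
    then obtain u where "x = (\<Sum>v\<in>range \<omega>. of_int (u v) * v)"
      using zmod.span_finite[of "range \<omega>"] by auto
    then show ?thesis using assms(2) by (intro exI[of _ "\<lambda>j. u (\<omega> j)"]) (simp add: sum.reindex)
  qed
  moreover have "algebraic_int (\<omega> j)" for j using span zmod.span_base[of "\<omega> j" "range \<omega>"] by auto
  ultimately show ?thesis using integral_basis_card(1)[OF assms(1)] unfolding zbasis_def by blast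
qed

text \<open>Resolves the definite description: every admissible pair of lists yields the same
  square. The list of embeddings is an enumeration of the index type, the other list is a
  \<open>zbasis\<close> indexed through it, and \<open>zbasis_det_square_eq\<close> compares
  bases.\<close>

lemma discriminant_eq:
  assumes "zbasis \<omega>"
  shows "complex_of_int (discriminant TYPE('a)) = (det (emb_mat \<omega>))\<^sup>2"
proof -
  define Q where "Q = (\<lambda>D. \<exists>\<omega> \<sigma>.
     distinct \<omega> \<and> integral_basis (set \<omega> :: 'a set) \<and>
     distinct \<sigma> \<and> set \<sigma> = (embeddings :: ('a \<Rightarrow> complex) set) \<and>
     of_int D = (Determinant.det (Matrix.mat (length \<sigma>) (length \<omega>) (\<lambda>(i, j). (\<sigma> ! i) (\<omega> ! j))))\<^sup>2)"
  have *: "(Determinant.det (Matrix.mat (length s) (length w) (\<lambda>(i, j). (s ! i) (w ! j))))\<^sup>2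
      = (det (emb_mat \<omega>))\<^sup>2"
    if w: "distinct w" "integral_basis (set w :: 'a set)"
      and s: "distinct s" "set s = (embeddings :: ('a \<Rightarrow> complex) set)" for w s
  proof -
    define n where "n = length s"
    have n: "n = CARD('a emb)" unfolding n_def distinct_card[OF s(1), symmetric] s(2) card_emb ..
    have lw: "length w = n" using integral_basis_card(3)[OF w(2)] distinct_card[OF w(1)] n by simp
    define e where "e = (\<lambda>i. inv_into UNIV emb (s ! i) :: 'a emb)"
    have emb_e: "emb (e i) = s ! i" if "i < n" for i
    proof -
      have "s ! i \<in> range emb" using that s(2) nth_mem[of i s] unfolding range_emb n_def by blast
      then show ?thesis unfolding e_def by (rule f_inv_into_f)
    qed
    have inje: "inj_on e {0..<n}"
    proof (rule inj_onI)
      fix i j assume ij: "i \<in> {0..<n}" "j \<in> {0..<n}" "e i = e j"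
      then have "s ! i = s ! j" using emb_e[of i] emb_e[of j] by simp
      then show "i = j" using ij s(1) nth_eq_iff_index_eq[of s i j] by (simp add: n_def)
    qed
    then have "card (e ` {0..<n}) = CARD('a emb)" by (simp add: card_image n)
    then have "e ` {0..<n} = UNIV" by (intro card_subset_eq) auto
    then have e: "bij_betw e {0..<n} UNIV" using inje by (simp add: bij_betw_def)
    \<comment> \<open>The list basis is indexed by embeddings along the same enumeration
      \<open>e\<close>, which turns the list matrix into \<open>emb_mat \<omega>'\<close>
      exactly.\<close>
    define \<omega>' where "\<omega>' = (\<lambda>\<sigma>. w ! (inv_into {0..<n} e \<sigma>))"
    have we: "\<omega>' (e i) = w ! i" if "i < n" for i
      using inje that by (simp add: \<omega>'_def inv_into_f_f)
    have b: "bij_betw (inv_into {0..<n} e) UNIV {0..<n}" by (rule bij_betw_inv_into[OF e])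
    have "bij_betw ((!) w) {0..<n} (set w)"
      using w(1) lw by (intro bij_betw_nth) auto
    then have "bij_betw \<omega>' UNIV (set w)"
      using bij_betw_trans[OF b] by (simp add: \<omega>'_def o_def)
    then have "zbasis \<omega>'"
      using integral_basis_zbasis[of \<omega>'] w(2) by (simp add: bij_betw_def)
    moreover have "Determinant.det (Matrix.mat (length s) (length w) (\<lambda>(i, j). (s ! i) (w ! j)))
        = Determinant.det (Matrix.mat n n (\<lambda>(i, j). emb (e i) (\<omega>' (e j))))"
      by (rule arg_cong[of _ _ Determinant.det], rule eq_matI) (auto simp: lw n_def[symmetric] emb_e we)
    moreover have "\<dots> = det (emb_mat \<omega>')"
      unfolding emb_mat_def by (rule det_mat_eq_det_vec[OF e])
    ultimately show ?thesis using zbasis_det_square_eq[OF assms] by simp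
  qed
  have ex: "\<exists>D. Q D"
  proof -
    obtain s where s: "distinct s" "set s = (embeddings :: ('a \<Rightarrow> complex) set)"
      using finite_distinct_list embeddings_finite_nonempty(1) by metis
    obtain w where w: "distinct w" "set w = range \<omega>"
      using finite_distinct_list[of "range \<omega>"] by auto
    have iw: "integral_basis (set w)" using integral_basis_range[OF assms] w by simp
    have "(det (emb_mat \<omega>))\<^sup>2 \<in> \<int>" using assms det_emb_mat_square_Ints by (simp add: zbasis_def)
    then obtain D where "(det (emb_mat \<omega>))\<^sup>2 = of_int D" by (auto elim: Ints_cases)
    then show ?thesis unfolding Q_def
      using *[OF w(1) iw s] w(1) iw s by (intro exI[of _ D] exI[of _ w] exI[of _ s]) simp
  qed
  have uniq: "of_int D = (det (emb_mat \<omega>))\<^sup>2" if "Q D" for D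
  proof -
    obtain w s where "distinct w" "integral_basis (set w :: 'a set)"
      "distinct s" "set s = (embeddings :: ('a \<Rightarrow> complex) set)"
      "of_int D = (Determinant.det (Matrix.mat (length s) (length w) (\<lambda>(i, j). (s ! i) (w ! j))))\<^sup>2"
      using \<open>Q D\<close> unfolding Q_def by (elim exE conjE)
    then show ?thesis using *[of w s] by simp
  qed
  have "\<exists>!D. Q D"
    using ex uniq by (metis of_int_eq_iff)
  then have "Q (THE D. Q D)" by (rule theI')
  then have "Q (discriminant TYPE('a))" by (simp add: discriminant_def Q_def)
  then show ?thesis by (rule uniq)
qed

end

section \<open>Volumes and integer points\<close>

text \<open>The area of a disc, as the iterated integral that Fubini leaves for a pair of conjugate
  coordinates in \<open>nn_integral_polydisc\<close>.\<close>

lemma nn_integral_disc: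
  assumes "r \<ge> 0"
  shows "(\<integral>\<^sup>+z. \<integral>\<^sup>+y. (if y\<^sup>2 + z\<^sup>2 \<le> r\<^sup>2 then 1 else 0) \<partial>lborel \<partial>lborel) = ennreal (pi * r\<^sup>2)"
proof -
  have mem: "(z, y) \<in> cball 0 r \<longleftrightarrow> y\<^sup>2 + z\<^sup>2 \<le> r\<^sup>2" for y z :: real
  proof -
    have "(z, y) \<in> cball 0 r \<longleftrightarrow> sqrt (y\<^sup>2 + z\<^sup>2) \<le> r"
      by (simp add: norm_Pair add.commute)
    also have "\<dots> \<longleftrightarrow> y\<^sup>2 + z\<^sup>2 \<le> r\<^sup>2"
      using assms sqrt_le_D real_le_lsqrt by blast
    finally show ?thesis .
  qed
  have "(\<integral>\<^sup>+z. \<integral>\<^sup>+y. (if y\<^sup>2 + z\<^sup>2 \<le> r\<^sup>2 then 1 else 0) \<partial>lborel \<partial>lborel)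
      = (\<integral>\<^sup>+z. \<integral>\<^sup>+y. indicator (cball (0 :: real \<times> real) r) (z, y) \<partial>lborel \<partial>lborel)"
    by (intro nn_integral_cong) (simp add: indicator_def mem del: mem_cball mem_cball_0)
  also have "\<dots> = (\<integral>\<^sup>+p. indicator (cball (0 :: real \<times> real) r) p \<partial>(lborel \<Otimes>\<^sub>M lborel))"
    by (rule lborel.nn_integral_fst) (auto simp: lborel_prod intro!: borel_measurable_indicator)
  also have "\<dots> = emeasure lborel (cball (0 :: real \<times> real) r)"
    by (simp add: lborel_prod)
  also have "\<dots> = ennreal (pi * r\<^sup>2)"
    using assms by (simp add: emeasure_cball unit_ball_vol_2 power2_eq_square)
  finally show ?thesis .
qed

lemma nn_integral_interval:
  assumes "r \<ge> 0"
  shows "(\<integral>\<^sup>+y. (if y\<^sup>2 \<le> r\<^sup>2 then 1 else 0) \<partial>lborel) = ennreal (2 * r)"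
proof -
  have "(\<integral>\<^sup>+y. (if y\<^sup>2 \<le> r\<^sup>2 then 1 else 0) \<partial>lborel) = (\<integral>\<^sup>+y. indicator {-r..r} y \<partial>lborel)"
    using assms by (intro nn_integral_cong) (auto simp: indicator_def abs_le_square_iff[symmetric])
  also have "\<dots> = ennreal (2 * r)" using assms by simp
  finally show ?thesis .
qed

text \<open>Fubini, one orbit of the involution \<open>c\<close> at a time. A fixed point gives an
  interval of length 2 t. A two-cycle gives a disc of radius sqrt 2 t, with area 2 pi t^2, which is
  shared as sqrt (2 pi) t by its two coordinates. In this way the volume is a product over
  coordinates without a choice of orbit representatives.\<close>

lemma nn_integral_polydisc:
  fixes c :: "'i \<Rightarrow> 'i" and t :: "'i \<Rightarrow> real"
  assumes "finite A" and "\<And>i. i \<in> A \<Longrightarrow> c i \<in> A" and "\<And>i. i \<in> A \<Longrightarrow> c (c i) = i"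
    and "\<And>i. i \<in> A \<Longrightarrow> t (c i) = t i" and "\<And>i. i \<in> A \<Longrightarrow> t i > 0"
  shows "(\<integral>\<^sup>+x. (\<Prod>i\<in>A. if (x i)\<^sup>2 + (x (c i))\<^sup>2 \<le> 2 * (t i)\<^sup>2 then 1 else 0) \<partial>(PiM A (\<lambda>_. lborel)))
    = ennreal (\<Prod>i\<in>A. (if c i = i then 2 else sqrt (2 * pi)) * t i)"
  using assms
proof (induction "card A" arbitrary: A rule: less_induct)
  case less
  interpret product_sigma_finite "\<lambda>_::'i. lborel :: real measure" by standard
  let ?q = "\<lambda>i x. if (x i)\<^sup>2 + (x (c i))\<^sup>2 \<le> 2 * (t i)\<^sup>2 then 1 else 0 :: ennreal"
  let ?g = "\<lambda>i. (if c i = i then 2 else sqrt (2 * pi)) * t i"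
  have meas: "(\<lambda>x. \<Prod>i\<in>B. ?q i x) \<in> borel_measurable (PiM B' (\<lambda>_. lborel))"
    if "B \<subseteq> B'" "\<And>i. i \<in> B \<Longrightarrow> c i \<in> B'" for B B'
  proof (rule borel_measurable_prod_ennreal)
    fix i assume "i \<in> B"
    then have [measurable]: "(\<lambda>x. x i) \<in> borel_measurable (PiM B' (\<lambda>_. lborel))"
      "(\<lambda>x. x (c i)) \<in> borel_measurable (PiM B' (\<lambda>_. lborel))"
      using that measurable_component_singleton[of _ B' "\<lambda>_. lborel :: real measure"] by auto
    show "?q i \<in> borel_measurable (PiM B' (\<lambda>_. lborel))" by measurable
  qed
  show ?case
  proof (cases "A = {}")
    case True
    then show ?thesis by (simp add: PiM_empty nn_integral_count_space_finite)
  next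
    case False
    then obtain i where i: "i \<in> A" by blast
    note ti = less.prems(5)[OF i]
    \<comment> \<open>Removes the whole orbit of \<open>i\<close>, so that \<open>B\<close> is again
      stable under \<open>c\<close>.\<close>
    define B where "B = A - {i, c i}"
    have B: "finite B" "card B < card A" "i \<notin> B" "c i \<notin> B"
      using less.prems(1) i unfolding B_def by (auto intro!: psubset_card_mono)
    have cB: "c j \<in> B" if "j \<in> B" for j
    proof -
      have "c j \<in> A" "c (c j) = j" using less.prems that by (auto simp: B_def)
      moreover have "c (c i) = i" using less.prems i by simp
      ultimately show ?thesis using that unfolding B_def by auto
    qed
    have IH: "(\<integral>\<^sup>+x. (\<Prod>j\<in>B. ?q j x) \<partial>(PiM B (\<lambda>_. lborel))) = ennreal (\<Prod>j\<in>B. ?g j)"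
      by (rule less.hyps[OF B(2) B(1) cB]) (use less.prems in \<open>auto simp: B_def\<close>)
    have pos: "(\<Prod>j\<in>B. ?g j) \<ge> 0"
      using less.prems(5) by (intro prod_nonneg) (auto simp: B_def intro: less_imp_le)
    have upd: "(\<Prod>j\<in>B. ?q j (fun_upd x k y)) = (\<Prod>j\<in>B. ?q j x)" if "k = i \<or> k = c i" for x k y
    proof (rule prod.cong)
      fix j assume "j \<in> B"
      then have "j \<noteq> k" "c j \<noteq> k" using cB[of j] B(3,4) that by auto
      then show "?q j (fun_upd x k y) = ?q j x" by simp
    qed simp
    have measB: "(\<lambda>x. \<Prod>j\<in>B. ?q j x) \<in> borel_measurable (PiM B (\<lambda>_. lborel))"
      by (rule meas) (use cB in auto)
    show ?thesis
    proof (cases "c i = i")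
      case True
      then have A: "A = insert i B" using i by (auto simp: B_def)
      have "(\<integral>\<^sup>+x. (\<Prod>j\<in>A. ?q j x) \<partial>(PiM A (\<lambda>_. lborel)))
          = (\<integral>\<^sup>+x. \<integral>\<^sup>+y. (\<Prod>j\<in>insert i B. ?q j (fun_upd x i y)) \<partial>lborel \<partial>(PiM B (\<lambda>_. lborel)))"
        unfolding A by (rule product_nn_integral_insert[OF B(1,3)])
          (rule meas, use cB True in auto)
      also have "\<dots> = (\<integral>\<^sup>+x. \<integral>\<^sup>+y. (if y\<^sup>2 \<le> (t i)\<^sup>2 then 1 else 0) * (\<Prod>j\<in>B. ?q j x) \<partial>lborel \<partial>(PiM B (\<lambda>_. lborel)))"
        using B(1,3) True by (simp add: upd del: fun_upd_apply) (simp add: True)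
      also have "\<dots> = (\<integral>\<^sup>+x. (\<integral>\<^sup>+y. (if y\<^sup>2 \<le> (t i)\<^sup>2 then 1 else 0) \<partial>lborel) * (\<Prod>j\<in>B. ?q j x) \<partial>(PiM B (\<lambda>_. lborel)))"
        by (intro nn_integral_cong nn_integral_multc) measurable
      also have "\<dots> = ennreal (2 * t i) * ennreal (\<Prod>j\<in>B. ?g j)"
        using ti measB by (simp add: nn_integral_interval nn_integral_cmult IH)
      also have "\<dots> = ennreal ((2 * t i) * (\<Prod>j\<in>B. ?g j))"
        using pos ti by (subst ennreal_mult) auto
      also have "(2 * t i) * (\<Prod>j\<in>B. ?g j) = (\<Prod>j\<in>A. ?g j)"
        unfolding A using B(1,3) True by simp
      finally show ?thesis .
    next
      case False
      define j where "j = c i"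
      have j: "j \<noteq> i" "c j = i" "t j = t i" "j \<in> A" using False less.prems i by (auto simp: j_def)
      have A: "A = insert i (insert j B)" using i j by (auto simp: B_def j_def)
      have iB: "i \<notin> insert j B" "j \<notin> B" using B(3,4) j by (auto simp: j_def)
      have "(\<integral>\<^sup>+x. (\<Prod>k\<in>A. ?q k x) \<partial>(PiM A (\<lambda>_. lborel)))
          = (\<integral>\<^sup>+x. \<integral>\<^sup>+y. (\<Prod>k\<in>insert i (insert j B). ?q k (fun_upd x i y)) \<partial>lborel \<partial>(PiM (insert j B) (\<lambda>_. lborel)))"
        unfolding A
      proof (rule product_nn_integral_insert[OF _ iB(1)])
        have "c k \<in> insert i (insert j B)" if "k \<in> insert i (insert j B)" for k
          using that cB j(2) j_def by (metis insert_iff)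
        then show "(\<lambda>x. \<Prod>k\<in>insert i (insert j B). ?q k x) \<in> borel_measurable (PiM (insert i (insert j B)) (\<lambda>_. lborel))"
          by (intro meas) auto
      qed (use B(1) in simp)
      also have "\<dots> = (\<integral>\<^sup>+x. \<integral>\<^sup>+y. (if y\<^sup>2 + (x j)\<^sup>2 \<le> 2 * (t i)\<^sup>2 then 1 else 0) * (\<Prod>k\<in>B. ?q k x) \<partial>lborel \<partial>(PiM (insert j B) (\<lambda>_. lborel)))"
      proof (intro nn_integral_cong)
        fix x y
        have "(\<Prod>k\<in>insert i (insert j B). ?q k (fun_upd x i y))
            = ?q i (fun_upd x i y) * (?q j (fun_upd x i y) * (\<Prod>k\<in>B. ?q k (fun_upd x i y)))"
          using B(1) iB by (simp del: fun_upd_apply)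
        also have "\<dots> = (if y\<^sup>2 + (x j)\<^sup>2 \<le> 2 * (t i)\<^sup>2 then 1 else 0) * (\<Prod>k\<in>B. ?q k x)"
          using upd[of i x y] j by (simp add: j_def[symmetric] add.commute del: prod.cong)
        finally show "(\<Prod>k\<in>insert i (insert j B). ?q k (fun_upd x i y))
            = (if y\<^sup>2 + (x j)\<^sup>2 \<le> 2 * (t i)\<^sup>2 then 1 else 0) * (\<Prod>k\<in>B. ?q k x)" .
      qed
      also have "\<dots> = (\<integral>\<^sup>+x. (\<integral>\<^sup>+y. (if y\<^sup>2 + (x j)\<^sup>2 \<le> 2 * (t i)\<^sup>2 then 1 else 0) \<partial>lborel) * (\<Prod>k\<in>B. ?q k x) \<partial>(PiM (insert j B) (\<lambda>_. lborel)))"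
        by (intro nn_integral_cong nn_integral_multc) measurable
      also have "\<dots> = (\<integral>\<^sup>+x. \<integral>\<^sup>+z. (\<integral>\<^sup>+y. (if y\<^sup>2 + (fun_upd x j z j)\<^sup>2 \<le> 2 * (t i)\<^sup>2 then 1 else 0) \<partial>lborel) * (\<Prod>k\<in>B. ?q k (fun_upd x j z)) \<partial>lborel \<partial>(PiM B (\<lambda>_. lborel)))"
      proof (rule product_nn_integral_insert[OF B(1) iB(2)])
        have [measurable]: "(\<lambda>x. x j) \<in> borel_measurable (PiM (insert j B) (\<lambda>_. lborel :: real measure))"
          using measurable_component_singleton[of j "insert j B" "\<lambda>_. lborel :: real measure"] by simp
        have [measurable]: "(\<lambda>x. \<Prod>k\<in>B. ?q k x) \<in> borel_measurable (PiM (insert j B) (\<lambda>_. lborel))"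
          by (rule meas) (use cB in auto)
        show "(\<lambda>x. (\<integral>\<^sup>+y. (if y\<^sup>2 + (x j)\<^sup>2 \<le> 2 * (t i)\<^sup>2 then 1 else 0) \<partial>lborel) * (\<Prod>k\<in>B. ?q k x))
            \<in> borel_measurable (PiM (insert j B) (\<lambda>_. lborel))"
          by measurable
      qed
      also have "\<dots> = (\<integral>\<^sup>+x. \<integral>\<^sup>+z. (\<integral>\<^sup>+y. (if y\<^sup>2 + z\<^sup>2 \<le> (sqrt 2 * t i)\<^sup>2 then 1 else 0) \<partial>lborel) * (\<Prod>k\<in>B. ?q k x) \<partial>lborel \<partial>(PiM B (\<lambda>_. lborel)))"
        using upd[of j] by (simp add: j_def[symmetric] power_mult_distrib del: prod.cong)
      also have "\<dots> = (\<integral>\<^sup>+x. (\<integral>\<^sup>+z. \<integral>\<^sup>+y. (if y\<^sup>2 + z\<^sup>2 \<le> (sqrt 2 * t i)\<^sup>2 then 1 else 0) \<partial>lborel \<partial>lborel) * (\<Prod>k\<in>B. ?q k x) \<partial>(PiM B (\<lambda>_. lborel)))"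
        by (intro nn_integral_cong nn_integral_multc) measurable
      also have "\<dots> = (\<integral>\<^sup>+x. ennreal (pi * (sqrt 2 * t i)\<^sup>2) * (\<Prod>k\<in>B. ?q k x) \<partial>(PiM B (\<lambda>_. lborel)))"
        using ti by (subst nn_integral_disc) auto
      also have "\<dots> = ennreal (pi * (sqrt 2 * t i)\<^sup>2) * ennreal (\<Prod>j\<in>B. ?g j)"
        using measB by (subst nn_integral_cmult) (auto simp only: IH)
      also have "\<dots> = ennreal ((pi * (sqrt 2 * t i)\<^sup>2) * (\<Prod>j\<in>B. ?g j))"
        using pos by (subst ennreal_mult) auto
      also have "(pi * (sqrt 2 * t i)\<^sup>2) = ?g i * ?g j"
        using j False by (simp add: power2_eq_square j_def[symmetric])
      also have "?g i * ?g j * (\<Prod>j\<in>B. ?g j) = (\<Prod>j\<in>A. ?g j)"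
        unfolding A using B(1) iB by simp
      finally show ?thesis .
    qed
  qed
qed

text \<open>With x_i = Re z_i + Im z_i and z_(c i) the conjugate of z_i, the left side is 2 |z_i|^2,
  so that the conditions say |z_i| \<le> t_i; \<open>c\<close> is complex conjugation of
  embeddings.\<close>

definition polydisc :: "('n \<Rightarrow> 'n) \<Rightarrow> ('n \<Rightarrow> real) \<Rightarrow> (real ^ 'n) set" where
  "polydisc c t = {x. \<forall>i. (x $ i)\<^sup>2 + (x $ c i)\<^sup>2 \<le> 2 * (t i)\<^sup>2}"

lemma closed_polydisc: "closed (polydisc c t)"
  unfolding polydisc_def
  by (intro closed_Collect_all closed_Collect_le continuous_intros)

lemma bounded_polydisc: "bounded (polydisc c (t :: 'n::finite \<Rightarrow> real))"
proof -
  have "norm x \<le> (\<Sum>i\<in>UNIV. sqrt (2 * (t i)\<^sup>2))" if x: "x \<in> polydisc c t" for x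
  proof -
    have "norm x \<le> (\<Sum>i\<in>UNIV. \<bar>x $ i\<bar>)" by (rule norm_le_l1_cart)
    also have "\<dots> \<le> (\<Sum>i\<in>UNIV. sqrt (2 * (t i)\<^sup>2))"
    proof (rule sum_mono)
      fix i
      have "(x $ i)\<^sup>2 + (x $ c i)\<^sup>2 \<le> 2 * (t i)\<^sup>2" using x by (simp add: polydisc_def)
      then have "(x $ i)\<^sup>2 \<le> 2 * (t i)\<^sup>2" using zero_le_power2[of "x $ c i"] by linarith
      then show "\<bar>x $ i\<bar> \<le> sqrt (2 * (t i)\<^sup>2)" by (simp add: real_le_rsqrt)
    qed
    finally show ?thesis .
  qed
  then show ?thesis by (auto simp: bounded_iff)
qed

lemma lmeasurable_polydisc: "polydisc c (t :: 'n::finite \<Rightarrow> real) \<in> lmeasurable"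
  using bounded_polydisc closed_polydisc compact_eq_bounded_closed lmeasurable_compact by blast

lemma measure_polydisc:
  fixes c :: "'n::finite \<Rightarrow> 'n"
  assumes "\<And>i. c (c i) = i" "\<And>i. t (c i) = t i" "\<And>i. t i > 0"
  shows "measure lebesgue (polydisc c t) = (\<Prod>i\<in>UNIV. (if c i = i then 2 else sqrt (2 * pi)) * t i)"
proof -
  define P where "P = polydisc c t"
  have Pb: "P \<in> sets borel" unfolding P_def by (rule borel_closed[OF closed_polydisc])
  define ix where "ix = (axis_index :: real ^ 'n \<Rightarrow> 'n)"
  \<comment> \<open>Lebesgue measure on \<open>real ^ 'n\<close> is available as a product over
    standard basis vectors, so the involution is carried over to these.\<close>
  define c' where "c' = (\<lambda>b. axis (c (ix b)) 1 :: real ^ 'n)"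
  have ix: "ix (axis i 1) = i" for i by (simp add: ix_def)
  have Basis: "(Basis :: (real ^ 'n) set) = (\<lambda>i. axis i 1) ` UNIV"
    by (auto simp: Basis_vec_def)
  have inj: "inj (\<lambda>i. axis i 1 :: real ^ 'n)" by (metis injI ix)
  have comp: "(\<Sum>b\<in>Basis. f b *\<^sub>R b) $ i = f (axis i 1)" for f and i :: 'n
    unfolding Basis using inj
    by (simp add: sum.reindex axis_def if_distrib cong: if_cong)
  have sum_m: "(\<lambda>f. \<Sum>b\<in>Basis. f b *\<^sub>R b :: real ^ 'n) \<in> measurable (PiM Basis (\<lambda>_. lborel)) borel"
    by measurable
  have "emeasure lborel P = emeasure (distr (PiM Basis (\<lambda>_. lborel)) borel (\<lambda>f. \<Sum>b\<in>Basis. f b *\<^sub>R b)) P"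
    by (subst lborel_eq) simp
  also have "\<dots> = emeasure (PiM Basis (\<lambda>_. lborel)) ((\<lambda>f. \<Sum>b\<in>Basis. f b *\<^sub>R b) -` P \<inter> space (PiM Basis (\<lambda>_. lborel)))"
    by (rule emeasure_distr) (use Pb in auto)
  also have "\<dots> = (\<integral>\<^sup>+f. indicator ((\<lambda>f. \<Sum>b\<in>Basis. f b *\<^sub>R b) -` P \<inter> space (PiM Basis (\<lambda>_. lborel))) f \<partial>(PiM Basis (\<lambda>_. lborel)))"
    by (rule nn_integral_indicator[symmetric]) (rule measurable_sets[OF sum_m Pb])
  also have "\<dots> = (\<integral>\<^sup>+f. (\<Prod>b\<in>Basis. if (f b)\<^sup>2 + (f (c' b))\<^sup>2 \<le> 2 * (t (ix b))\<^sup>2 then 1 else 0) \<partial>(PiM Basis (\<lambda>_. lborel)))"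
  proof (rule nn_integral_cong)
    fix f assume f: "f \<in> space (PiM (Basis :: (real ^ 'n) set) (\<lambda>_. lborel :: real measure))"
    have "(\<Sum>b\<in>Basis. f b *\<^sub>R b) \<in> P \<longleftrightarrow> (\<forall>b\<in>Basis. (f b)\<^sup>2 + (f (c' b))\<^sup>2 \<le> 2 * (t (ix b))\<^sup>2)"
      unfolding P_def polydisc_def mem_Collect_eq comp by (auto simp: Basis c'_def ix)
    then show "indicator ((\<lambda>f. \<Sum>b\<in>Basis. f b *\<^sub>R b) -` P \<inter> space (PiM Basis (\<lambda>_. lborel))) f
        = (\<Prod>b\<in>Basis. if (f b)\<^sup>2 + (f (c' b))\<^sup>2 \<le> 2 * (t (ix b))\<^sup>2 then 1 else 0 :: ennreal)"
      using f by (auto simp: indicator_def prod_zero_iff)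
  qed
  also have "\<dots> = ennreal (\<Prod>b\<in>Basis. (if c' b = b then 2 else sqrt (2 * pi)) * t (ix b))"
    by (rule nn_integral_polydisc) (auto simp: c'_def Basis ix assms)
  also have "(\<Prod>b\<in>Basis. (if c' b = b then 2 else sqrt (2 * pi)) * t (ix b))
      = (\<Prod>i\<in>UNIV. (if c i = i then 2 else sqrt (2 * pi)) * t i)"
  proof -
    have "axis (c i) 1 = (axis i 1 :: real ^ 'n) \<longleftrightarrow> c i = i" for i by (metis ix)
    then show ?thesis unfolding Basis using inj by (simp add: prod.reindex ix c'_def)
  qed
  finally have "emeasure lborel P = ennreal (\<Prod>i\<in>UNIV. (if c i = i then 2 else sqrt (2 * pi)) * t i)" .
  moreover have "emeasure lebesgue P = emeasure lborel P" using Pb by simp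
  moreover have "(\<Prod>i\<in>UNIV. (if c i = i then 2 else sqrt (2 * pi)) * t i) \<ge> 0"
    by (intro prod_nonneg) (auto simp: less_imp_le[OF assms(3)])
  ultimately show ?thesis unfolding P_def by (simp add: measure_def)
qed

definition int_vecs :: "(real ^ 'n) set" where
  "int_vecs = {x. \<forall>i. x $ i \<in> \<int>}"

text \<open>The pieces of \<open>S\<close> in the unit cells are translated into one unit cube.
  Their total volume exceeds N, so some point of the cube is covered more than N times. The
  multiplicity is kept because the points are later distributed over the classes of an
  ideal.\<close>

lemma blichfeldt:
  fixes S :: "(real ^ 'n) set"
  assumes S: "S \<in> lmeasurable" "bounded S" and N: "measure lebesgue S > real N"
  shows "\<exists>T\<subseteq>S. finite T \<and> card T = Suc N \<and> (\<forall>x\<in>T. \<forall>y\<in>T. x - y \<in> int_vecs)"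
proof -
  define fl where "fl = (\<lambda>x :: real ^ 'n. (\<chi> i. of_int \<lfloor>x $ i\<rfloor>) :: real ^ 'n)"
  obtain b where b: "\<And>x. x \<in> S \<Longrightarrow> norm x \<le> b" using S(2) by (auto simp: bounded_iff)
  define Z where "Z = fl ` S"
  have "Z \<subseteq> (\<lambda>h. \<chi> i. of_int (h i)) ` (PiE UNIV (\<lambda>_. {\<lfloor>-b\<rfloor>..\<lfloor>b\<rfloor>}))"
  proof
    fix z assume "z \<in> Z"
    then obtain x where x: "x \<in> S" "z = fl x" by (auto simp: Z_def)
    have "\<bar>x $ i\<bar> \<le> b" for i using component_le_norm_cart[of x i] b[OF x(1)] by linarith
    then have "-b \<le> x $ i" "x $ i \<le> b" for i by (simp_all add: abs_le_iff minus_le_iff)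
    then have "(\<lambda>i. \<lfloor>x $ i\<rfloor>) \<in> PiE UNIV (\<lambda>_. {\<lfloor>-b\<rfloor>..\<lfloor>b\<rfloor>})" by (auto intro!: floor_mono)
    then show "z \<in> (\<lambda>h. \<chi> i. of_int (h i)) ` (PiE UNIV (\<lambda>_. {\<lfloor>-b\<rfloor>..\<lfloor>b\<rfloor>}))"
      unfolding x(2) fl_def by (rule image_eqI[rotated]) simp
  qed
  moreover have "finite (PiE (UNIV :: 'n set) (\<lambda>_. {\<lfloor>-b\<rfloor>..\<lfloor>b\<rfloor>}))" by (rule finite_PiE) auto
  ultimately have finZ: "finite Z" using finite_surj by blast
  define C where "C = (\<lambda>z. S \<inter> fl -` {z})"
  have cell: "fl -` {z} \<in> sets lebesgue" if "z \<in> Z" for z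
  proof -
    have zi: "of_int \<lfloor>z $ i\<rfloor> = z $ i" for i using that by (auto simp: Z_def fl_def)
    have "fl x = z \<longleftrightarrow> (\<forall>i. z $ i \<le> x $ i \<and> x $ i < z $ i + 1)" for x
    proof -
      have "of_int \<lfloor>x $ i\<rfloor> = z $ i \<longleftrightarrow> z $ i \<le> x $ i \<and> x $ i < z $ i + 1" for i
        by (metis zi floor_unique of_int_floor_le real_of_int_floor_add_one_gt)
      then show ?thesis by (simp add: fl_def vec_eq_iff)
    qed
    then have "fl -` {z} = (\<Inter>i\<in>UNIV. {x. z $ i \<le> x $ i} \<inter> {x. x $ i < z $ i + 1})" by auto
    also have "\<dots> \<in> sets borel"
      by (intro sets.finite_INT sets.Int borel_closed borel_open closed_Collect_le open_Collect_less
          continuous_intros) auto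
    finally show ?thesis by (intro sets_completionI_sets) simp
  qed
  have Cm: "C z \<in> lmeasurable" if "z \<in> Z" for z
    unfolding C_def using S(1) cell[OF that] by (rule fmeasurable_Int_fmeasurable)
  \<comment> \<open>The piece with integral part \<open>z\<close>, moved into the unit cube.\<close>
  define C' where "C' = (\<lambda>z. (\<lambda>x. - z + x) ` C z)"
  have C'm: "C' z \<in> lmeasurable" "measure lebesgue (C' z) = measure lebesgue (C z)" if "z \<in> Z" for z
    unfolding C'_def using measurable_translation[OF Cm[OF that], of "-z"] measure_translation[of "-z" "C z"] by auto
  have flx: "0 \<le> (x - fl x) $ i" "(x - fl x) $ i \<le> 1" for x i
    unfolding fl_def vector_minus_component vec_lambda_beta by linarith+
  have C'_sub: "C' z \<subseteq> cbox 0 1" for z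
    using flx by (auto simp: C'_def C_def mem_box_cart)
  have meas1: "measure lebesgue (cbox 0 (1 :: real ^ 'n)) = 1"
    by (subst measure_completion) (auto simp: content_cbox_cart interval_ne_empty_cart)
  have S_eq: "S = (\<Union>z\<in>Z. C z)" by (auto simp: Z_def C_def)
  have ind: "integrable lebesgue (indicator A :: real ^ 'n \<Rightarrow> real)" if "A \<in> lmeasurable" for A
    using that unfolding fmeasurable_def by (intro integrable_real_indicator) blast+
  have int: "integrable lebesgue (indicator (C' z) :: real ^ 'n \<Rightarrow> real)" if "z \<in> Z" for z
    using ind C'm(1)[OF that] .
  have "measure lebesgue S = (\<Sum>z\<in>Z. measure lebesgue (C z))"
    unfolding S_eq
  proof (rule measure_UNION')
    show "pairwise (\<lambda>z w. disjnt (C z) (C w)) Z" by (auto simp: pairwise_def disjnt_def C_def)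
  qed (use finZ Cm in auto)
  also have "\<dots> = (\<Sum>z\<in>Z. measure lebesgue (C' z))" using C'm by simp
  also have "\<dots> = (\<integral>x. (\<Sum>z\<in>Z. indicator (C' z) x) \<partial>lebesgue)"
    using int by (subst Bochner_Integration.integral_sum) auto
  finally have meas: "measure lebesgue S = (\<integral>x. (\<Sum>z\<in>Z. indicator (C' z) x) \<partial>lebesgue)" .
  \<comment> \<open>The covering number integrates to the measure of \<open>S\<close>; if it never
    exceeded N, the integral over a cube of volume 1 would be at most N.\<close>
  have "\<exists>x. card {z \<in> Z. x \<in> C' z} > N"
  proof (rule ccontr)
    assume "\<not> ?thesis"
    then have le: "card {z \<in> Z. x \<in> C' z} \<le> N" for x by (simp add: not_less)
    have "(\<integral>x. (\<Sum>z\<in>Z. indicator (C' z) x) \<partial>lebesgue) \<le> (\<integral>x. real N * indicator (cbox 0 (1 :: real ^ 'n)) x \<partial>lebesgue)"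
    proof (rule integral_mono)
      show "integrable lebesgue (\<lambda>x. \<Sum>z\<in>Z. indicator (C' z) x :: real)"
        using int by (intro Bochner_Integration.integrable_sum) auto
      show "integrable lebesgue (\<lambda>x. real N * indicator (cbox 0 (1 :: real ^ 'n)) x)"
        by (intro integrable_mult_right ind lmeasurable_cbox)
      fix x :: "real ^ 'n"
      have "(\<Sum>z\<in>Z. indicator (C' z) x :: real) = real (card {z \<in> Z. x \<in> C' z})"
        using finZ by (simp add: indicator_def sum.If_cases Int_def Collect_conj_eq[symmetric])
      also have "\<dots> \<le> real N * indicator (cbox 0 1) x"
      proof (cases "x \<in> cbox 0 1")
        case True
        then show ?thesis using le by simp
      next
        case False
        then have "{z \<in> Z. x \<in> C' z} = {}" using C'_sub by blast
        then show ?thesis by (simp only: card.empty) simp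
      qed
      finally show "(\<Sum>z\<in>Z. indicator (C' z) x :: real) \<le> real N * indicator (cbox 0 1) x" .
    qed
    then show False using N meas meas1 by simp
  qed
  then obtain x where x: "card {z \<in> Z. x \<in> C' z} > N" by blast
  define T where "T = (\<lambda>z. x + z) ` {z \<in> Z. x \<in> C' z}"
  have "T \<subseteq> S" by (auto simp: T_def C'_def C_def)
  moreover have "card T = card {z \<in> Z. x \<in> C' z}" unfolding T_def by (rule card_image) (auto simp: inj_on_def)
  moreover have "z \<in> int_vecs" if "z \<in> Z" for z using that by (auto simp: Z_def fl_def int_vecs_def)
  then have "\<forall>x\<in>T. \<forall>y\<in>T. x - y \<in> int_vecs" by (auto simp: T_def int_vecs_def)
  moreover obtain T' where "T' \<subseteq> T" "card T' = Suc N" "finite T'"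
    using x \<open>card T = _\<close> obtain_subset_with_card_n[of "Suc N" T] by (metis Suc_leI)
  ultimately show ?thesis by (intro exI[of _ T']) blast
qed

section \<open>Indices of additive subgroups\<close>

definition add_subgroup :: "'b::ab_group_add set \<Rightarrow> bool" where
  "add_subgroup A \<longleftrightarrow> 0 \<in> A \<and> (\<forall>x\<in>A. \<forall>y\<in>A. x - y \<in> A)"

definition cosets :: "'b::ab_group_add set \<Rightarrow> 'b set \<Rightarrow> 'b set set" where
  "cosets B A = (\<lambda>b. (+) b ` A) ` B"

text \<open>An infinite index counts as 0, so finiteness of \<open>cosets B A\<close> is carried
  along as a separate fact.\<close>

definition idx :: "'b::ab_group_add set \<Rightarrow> 'b set \<Rightarrow> nat" where
  "idx B A = card (cosets B A)"

lemma add_subgroupD: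
  assumes "add_subgroup A"
  shows "0 \<in> A" "x \<in> A \<Longrightarrow> y \<in> A \<Longrightarrow> x - y \<in> A" "x \<in> A \<Longrightarrow> - x \<in> A" "x \<in> A \<Longrightarrow> y \<in> A \<Longrightarrow> x + y \<in> A"
proof -
  show 0: "0 \<in> A" using assms by (simp add: add_subgroup_def)
  have d: "x - y \<in> A" if "x \<in> A" "y \<in> A" for x y using assms that by (simp add: add_subgroup_def)
  show "x \<in> A \<Longrightarrow> y \<in> A \<Longrightarrow> x - y \<in> A" by (rule d)
  have m: "- y \<in> A" if "y \<in> A" for y using d[OF 0 that] by simp
  show "x \<in> A \<Longrightarrow> - x \<in> A" by (rule m)
  show "x + y \<in> A" if "x \<in> A" "y \<in> A" using d[OF that(1) m[OF that(2)]] by simp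
qed

lemma coset_eq_iff:
  assumes "add_subgroup A"
  shows "(+) x ` A = (+) y ` A \<longleftrightarrow> x - y \<in> A"
proof
  assume "(+) x ` A = (+) y ` A"
  moreover have "x \<in> (+) x ` A" using add_subgroupD(1)[OF assms] by (intro image_eqI[of _ _ 0]) auto
  ultimately have "x \<in> (+) y ` A" by simp
  then show "x - y \<in> A" by auto
next
  have *: "(+) x ` A \<subseteq> (+) y ` A" if "x - y \<in> A" for x y
  proof
    fix z assume "z \<in> (+) x ` A"
    then obtain a where "a \<in> A" "z = x + a" by auto
    then have "z = y + ((x - y) + a)" "(x - y) + a \<in> A" using add_subgroupD(4)[OF assms that] by auto
    then show "z \<in> (+) y ` A" by blast
  qed
  assume "x - y \<in> A"
  moreover from this have "y - x \<in> A" using add_subgroupD(3)[OF assms, of "x - y"] by simp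
  ultimately show "(+) x ` A = (+) y ` A" using * by blast
qed

lemma idx_pigeonhole:
  assumes "add_subgroup A" "finite (cosets B A)" "T \<subseteq> B" "card T > idx B A"
  obtains x y where "x \<in> T" "y \<in> T" "x \<noteq> y" "x - y \<in> A"
proof -
  have "(\<lambda>b. (+) b ` A) ` T \<subseteq> cosets B A" using assms(3) by (auto simp: cosets_def)
  then have "card ((\<lambda>b. (+) b ` A) ` T) \<le> idx B A" unfolding idx_def by (rule card_mono[OF assms(2)])
  then have "\<not> inj_on (\<lambda>b. (+) b ` A) T" using assms(4) by (intro pigeonhole) linarith
  then obtain x y where "x \<in> T" "y \<in> T" "(+) x ` A = (+) y ` A" "x \<noteq> y" by (auto simp: inj_on_def)
  then show ?thesis using that coset_eq_iff[OF assms(1)] by blast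
qed

text \<open>Turns a bound on incongruent families into finiteness as well: infinitely many classes
  would supply an incongruent family of size n + 1. Hence index estimates can start without prior
  knowledge of finiteness.\<close>

lemma idx_le:
  assumes "add_subgroup A"
    and "\<And>T. finite T \<Longrightarrow> T \<subseteq> B \<Longrightarrow> (\<And>x y. x \<in> T \<Longrightarrow> y \<in> T \<Longrightarrow> x - y \<in> A \<Longrightarrow> x = y) \<Longrightarrow> card T \<le> n"
  shows "finite (cosets B A)" "idx B A \<le> n"
proof -
  have le: "card U \<le> n" if U: "finite U" "U \<subseteq> cosets B A" for U
  proof -
    have "\<exists>T\<subseteq>B. inj_on (\<lambda>b. (+) b ` A) T \<and> U = (\<lambda>b. (+) b ` A) ` T"
      using U(2) unfolding cosets_def subset_image_inj by blast
    then obtain T where T: "T \<subseteq> B" "inj_on (\<lambda>b. (+) b ` A) T" "U = (\<lambda>b. (+) b ` A) ` T" by blast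
    have "finite T" using finite_imageD T(2,3) U(1) by blast
    moreover have "x = y" if "x \<in> T" "y \<in> T" "x - y \<in> A" for x y
      using T(2) that coset_eq_iff[OF assms(1), of x y] by (auto simp: inj_on_def)
    ultimately have "card T \<le> n" using assms(2) T(1) by blast
    then show ?thesis using T by (simp add: card_image)
  qed
  show "finite (cosets B A)"
  proof (rule ccontr)
    assume "infinite (cosets B A)"
    then obtain U where "finite U" "U \<subseteq> cosets B A" "card U = Suc n" using infinite_arbitrarily_large by blast
    then show False using le[of U] by simp
  qed
  then show "idx B A \<le> n" using le unfolding idx_def by blast
qed

lemma idx_pos:
  assumes "finite (cosets B A)" "B \<noteq> {}"
  shows "idx B A > 0"
  using assms by (auto simp: idx_def cosets_def card_gt_0_iff)

section \<open>The lattice of integers\<close>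

context numfield
begin

definition conj_emb :: "'a emb \<Rightarrow> 'a emb" where
  "conj_emb \<sigma> = (SOME \<tau>. emb \<tau> = cnj \<circ> emb \<sigma>)"

lemma emb_conj_emb: "emb (conj_emb \<sigma>) = cnj \<circ> emb \<sigma>"
proof -
  have "field_hom (cnj \<circ> emb \<sigma>)"
    by unfold_locales (auto simp: emb.hom_add emb.hom_mult)
  then have "cnj \<circ> emb \<sigma> \<in> range (emb :: 'a emb \<Rightarrow> _)" by (simp add: range_emb embeddings_def)
  then have "\<exists>\<tau>. emb \<tau> = cnj \<circ> emb \<sigma>" by (metis imageE)
  then show ?thesis unfolding conj_emb_def by (rule someI_ex)
qed

lemma conj_emb_conj_emb [simp]: "conj_emb (conj_emb \<sigma>) = \<sigma>"
proof -
  have "emb (conj_emb (conj_emb \<sigma>)) = emb \<sigma>" by (rule ext) (simp add: emb_conj_emb)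
  then show ?thesis by (simp add: emb_inject)
qed

lemma cmod_emb_conj_emb [simp]: "cmod (emb (conj_emb \<sigma>) x) = cmod (emb \<sigma> x)"
  by (simp add: emb_conj_emb)

definition int_basis :: "'a emb \<Rightarrow> 'a" where "int_basis = (SOME \<omega>. zbasis \<omega>)"

lemma zbasis_int_basis: "zbasis int_basis"
  unfolding int_basis_def by (rule someI_ex[OF zbasis_exists])

lemma algebraic_int_basis: "algebraic_int (int_basis j)"
  using zbasis_int_basis by (simp add: zbasis_def)

text \<open>On \<open>int_vecs\<close> this is the coordinate isomorphism from Z^n to the ring of
  integers; the floor only makes it total.\<close>

definition elem :: "real ^ 'a emb \<Rightarrow> 'a" where
  "elem v = (\<Sum>j\<in>UNIV. of_int \<lfloor>v $ j\<rfloor> * int_basis j)"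

definition coord :: "'a \<Rightarrow> real ^ 'a emb" where
  "coord x = (SOME v. v \<in> int_vecs \<and> elem v = x)"

text \<open>The real-linear extension of the embedding \<sigma> to the tensor product of K with the
  reals, in the coordinates of \<open>int_basis\<close>.\<close>

definition emb_lin :: "'a emb \<Rightarrow> real ^ 'a emb \<Rightarrow> complex" where
  "emb_lin \<sigma> v = (\<Sum>j\<in>UNIV. emb \<sigma> (int_basis j) * of_real (v $ j))"

lemma algebraic_int_elem: "algebraic_int (elem v)"
  unfolding elem_def by (intro algebraic_int_sum algebraic_int_times algebraic_int_basis) auto

lemma coord:
  assumes "algebraic_int x"
  shows "coord x \<in> int_vecs" "elem (coord x) = x"
proof -
  obtain c where c: "x = (\<Sum>j\<in>UNIV. of_int (c j) * int_basis j)"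
    using zbasis_int_basis assms unfolding zbasis_def by blast
  have "(\<chi> j. of_int (c j)) \<in> int_vecs \<and> elem (\<chi> j. of_int (c j)) = x"
    by (simp add: int_vecs_def elem_def c)
  then have "coord x \<in> int_vecs \<and> elem (coord x) = x" unfolding coord_def by (rule someI)
  then show "coord x \<in> int_vecs" "elem (coord x) = x" by auto
qed

lemma emb_lin_int:
  assumes "v \<in> int_vecs"
  shows "emb_lin \<sigma> v = emb \<sigma> (elem v)"
proof -
  have "of_int \<lfloor>v $ j\<rfloor> = v $ j" for j using assms by (simp add: int_vecs_def)
  then have "(of_real (v $ j) :: complex) = of_int \<lfloor>v $ j\<rfloor>" for j by (metis of_real_of_int_eq)
  then show ?thesis by (simp add: emb_lin_def elem_def emb_sum emb.hom_mult mult.commute)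
qed

lemma emb_lin_diff: "emb_lin \<sigma> (v - w) = emb_lin \<sigma> v - emb_lin \<sigma> w"
  by (simp add: emb_lin_def sum_subtractf algebra_simps)

lemma emb_lin_conj: "emb_lin (conj_emb \<sigma>) v = cnj (emb_lin \<sigma> v)"
  by (simp add: emb_lin_def emb_conj_emb)

lemma emb_lin_eq_0D:
  assumes "\<And>\<sigma>. emb_lin \<sigma> v = 0"
  shows "v = 0"
proof -
  define c :: "complex ^ 'a emb" where "c = (\<chi> j. of_real (v $ j))"
  have "emb_mat int_basis *v c = 0"
    using assms by (simp add: vec_eq_iff matrix_vector_mult_def emb_mat_def c_def emb_lin_def)
  moreover have "det (emb_mat int_basis) \<noteq> 0"
    using det_emb_mat_nonzero zbasis_int_basis by (simp add: zbasis_def)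
  then obtain V where "V ** emb_mat int_basis = mat 1" using invertible_det_nz[of "emb_mat int_basis"] unfolding invertible_def by blast
  ultimately have "c = 0"
    by (metis matrix_vector_mul_assoc matrix_vector_mul_lid matrix_vector_mult_0_right)
  then show ?thesis by (simp add: c_def vec_eq_iff)
qed

lemma int_vecs_diff: "v \<in> int_vecs \<Longrightarrow> w \<in> int_vecs \<Longrightarrow> v - w \<in> int_vecs"
  by (simp add: int_vecs_def)

lemma emb_eqI: "(\<And>\<sigma>. emb (\<sigma> :: 'a emb) x = emb \<sigma> y) \<Longrightarrow> x = y"
  using emb.hom_minus[of undefined x y] by (metis emb.eq_iff)

lemma elem_diff:
  assumes "v \<in> int_vecs" "w \<in> int_vecs"
  shows "elem (v - w) = elem v - elem w"
proof (rule emb_eqI)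
  fix \<sigma>
  have "emb \<sigma> (elem (v - w)) = emb_lin \<sigma> v - emb_lin \<sigma> w" by (simp add: emb_lin_int[OF int_vecs_diff[OF assms], symmetric] emb_lin_diff)
  then show "emb \<sigma> (elem (v - w)) = emb \<sigma> (elem v - elem w)"
    by (simp add: emb_lin_int assms emb.hom_minus)
qed

lemma elem_eq_0D:
  assumes "v \<in> int_vecs" "elem v = 0"
  shows "v = 0"
  by (rule emb_lin_eq_0D) (simp add: emb_lin_int assms)

definition lattice_mat :: "real ^ 'a emb ^ 'a emb" where
  "lattice_mat = (\<chi> \<sigma> j. Re (emb \<sigma> (int_basis j)) + Im (emb \<sigma> (int_basis j)))"

lemma lattice_mat_emb_lin: "(lattice_mat *v v) $ \<sigma> = Re (emb_lin \<sigma> v) + Im (emb_lin \<sigma> v)"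
  by (simp add: lattice_mat_def matrix_vector_mult_def emb_lin_def sum.distrib algebra_simps)

lemma det_of_real: "det (\<chi> i j. (of_real (A $ i $ j) :: complex)) = of_real (det A)"
  by (simp add: Determinants.det_def)

text \<open>
  The coordinates \<open>Re \<sigma>(a) + Im \<sigma>(a)\<close> arise from the \<open>\<sigma>(a)\<close> by a unitary matrix, so no power of
  \<open>2\<close> enters here.
\<close>

lemma abs_det_lattice_mat: "\<bar>det lattice_mat\<bar> = sqrt \<bar>real_of_int (discriminant TYPE('a))\<bar>"
proof -
  define T :: "complex \<Rightarrow> complex ^ 'a emb ^ 'a emb" where
    "T = (\<lambda>z. \<chi> \<sigma> \<rho>. (if \<sigma> = \<rho> then z else 0) + (if \<rho> = conj_emb \<sigma> then cnj z else 0))"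
  \<comment> \<open>For this value, z (a + b) + cnj z (a - b) = a + \<i> b, so \<open>T z\<close>
    recovers a number from the Re + Im coordinates of it and of its conjugate. The inverse of
    \<open>T z\<close> is \<open>T (cnj z)\<close>, whose determinant is the complex conjugate;
    hence \<open>det (T z)\<close> has modulus 1.\<close>
  define z where "z = (1 + \<i>) / 2"
  have Tmul: "(T z ** A) $ \<sigma> $ j = z * A $ \<sigma> $ j + cnj z * A $ (conj_emb \<sigma>) $ j" for A :: "complex ^ 'a emb ^ 'a emb" and \<sigma> j z
  proof -
    have "(T z ** A) $ \<sigma> $ j = (\<Sum>k\<in>UNIV. (if k = \<sigma> then z * A $ \<sigma> $ j else 0) + (if k = conj_emb \<sigma> then cnj z * A $ (conj_emb \<sigma>) $ j else 0))"
      unfolding matrix_matrix_mult_def T_def vec_lambda_beta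
      by (rule sum.cong) (auto simp: distrib_right)
    also have "\<dots> = z * A $ \<sigma> $ j + cnj z * A $ (conj_emb \<sigma>) $ j"
      unfolding sum.distrib by simp
    finally show ?thesis .
  qed
  have "T z ** T (cnj z) = mat 1"
  proof -
    have "(T z ** T (cnj z)) $ \<sigma> $ j = (mat 1 :: complex ^ 'a emb ^ 'a emb) $ \<sigma> $ j" for \<sigma> j
      unfolding Tmul by (auto simp: T_def z_def Finite_Cartesian_Product.mat_def complex_eq_iff)
    then show ?thesis by (simp add: vec_eq_iff)
  qed
  then have "det (T z) * det (T (cnj z)) = 1"
    by (metis Determinants.det_mul Determinants.det_I)
  moreover have "det (T (cnj z)) = cnj (det (T z))"
  proof -
    have "T (cnj z) $ i $ j = cnj (T z $ i $ j)" for i j by (simp add: T_def)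
    then show ?thesis by (simp add: Determinants.det_def)
  qed
  ultimately have "cmod (det (T z)) * cmod (det (T z)) = 1"
    by (metis complex_mod_cnj norm_mult norm_one)
  then have T1: "cmod (det (T z)) = 1"
    by (metis abs_norm_cancel mult_cancel_left2 power2_eq_square real_sqrt_abs real_sqrt_one norm_ge_zero)
  have "emb_mat int_basis = T z ** (\<chi> i j. of_real (lattice_mat $ i $ j))"
  proof -
    have "emb_mat int_basis $ \<sigma> $ j = (T z ** (\<chi> i j. of_real (lattice_mat $ i $ j))) $ \<sigma> $ j" for \<sigma> j
      unfolding Tmul by (simp add: emb_mat_def lattice_mat_def z_def complex_eq_iff emb_conj_emb field_simps)
    then show ?thesis by (simp add: vec_eq_iff)
  qed
  then have "det (emb_mat int_basis) = det (T z) * of_real (det lattice_mat)"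
    by (simp add: Determinants.det_mul det_of_real)
  then have "cmod (det (emb_mat int_basis)) = \<bar>det lattice_mat\<bar>" by (simp add: norm_mult T1)
  moreover have "(cmod (det (emb_mat int_basis)))\<^sup>2 = \<bar>real_of_int (discriminant TYPE('a))\<bar>"
    by (metis discriminant_eq[OF zbasis_int_basis] norm_of_int norm_power)
  ultimately show ?thesis by (metis abs_ge_zero real_sqrt_abs abs_abs)
qed

lemma det_lattice_mat_nonzero: "det lattice_mat \<noteq> 0"
proof -
  have "complex_of_int (discriminant TYPE('a)) \<noteq> 0"
    using discriminant_eq[OF zbasis_int_basis] det_emb_mat_nonzero zbasis_int_basis by (simp add: zbasis_def)
  then show ?thesis using abs_det_lattice_mat by auto
qed

definition ball_t :: "('a emb \<Rightarrow> real) \<Rightarrow> (real ^ 'a emb) set" where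
  "ball_t t = {v. \<forall>\<sigma>. cmod (emb_lin \<sigma> v) \<le> t \<sigma>}"

lemma measure_ball_t:
  assumes "\<And>\<sigma>. t \<sigma> > 0" "\<And>\<sigma>. t (conj_emb \<sigma>) = t \<sigma>"
  shows "ball_t t \<in> lmeasurable" "bounded (ball_t t)"
    "measure lebesgue (ball_t t) * \<bar>det lattice_mat\<bar> = (\<Prod>\<sigma>\<in>UNIV. (if conj_emb \<sigma> = \<sigma> then 2 else sqrt (2 * pi)) * t \<sigma>)"
proof -
  obtain V where V: "V ** lattice_mat = mat 1" "lattice_mat ** V = mat 1"
    using invertible_det_nz[of lattice_mat] det_lattice_mat_nonzero unfolding invertible_def by blast
  have mem: "v \<in> ball_t t \<longleftrightarrow> lattice_mat *v v \<in> polydisc conj_emb t" for v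
  proof -
    \<comment> \<open>Since (Re + Im)^2 + (Re - Im)^2 is twice the squared modulus.\<close>
    have "((lattice_mat *v v) $ \<sigma>)\<^sup>2 + ((lattice_mat *v v) $ conj_emb \<sigma>)\<^sup>2 = 2 * (cmod (emb_lin \<sigma> v))\<^sup>2" for \<sigma>
      unfolding lattice_mat_emb_lin emb_lin_conj cmod_power2 by (simp add: power2_eq_square algebra_simps)
    moreover have "2 * (cmod (emb_lin \<sigma> v))\<^sup>2 \<le> 2 * (t \<sigma>)\<^sup>2 \<longleftrightarrow> cmod (emb_lin \<sigma> v) \<le> t \<sigma>" for \<sigma>
      using assms(1)[of \<sigma>] by (simp add: abs_le_square_iff[symmetric])
    ultimately show ?thesis by (simp add: ball_t_def polydisc_def)
  qed
  have eq: "ball_t t = (*v) V ` polydisc conj_emb t"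
  proof (intro equalityI subsetI)
    fix v assume "v \<in> ball_t t"
    then have "lattice_mat *v v \<in> polydisc conj_emb t" by (simp add: mem)
    moreover have "v = V *v (lattice_mat *v v)" by (simp add: matrix_vector_mul_assoc V)
    ultimately show "v \<in> (*v) V ` polydisc conj_emb t" by blast
  next
    fix v assume "v \<in> (*v) V ` polydisc conj_emb t"
    then show "v \<in> ball_t t" by (auto simp: mem matrix_vector_mul_assoc V)
  qed
  have lin: "linear ((*v) V)" by (rule matrix_vector_mul_linear)
  show "ball_t t \<in> lmeasurable"
    unfolding eq by (rule measurable_linear_image[OF lin lmeasurable_polydisc])
  show "bounded (ball_t t)"
    unfolding eq by (rule bounded_linear_image[OF bounded_polydisc linear_linear[THEN iffD2, OF lin]])
  have "measure lebesgue (ball_t t) = \<bar>det V\<bar> * measure lebesgue (polydisc conj_emb t)"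
    unfolding eq by (subst measure_linear_image[OF lin lmeasurable_polydisc]) (simp add: matrix_of_matrix_vector_mul)
  moreover have "\<bar>det V\<bar> * \<bar>det lattice_mat\<bar> = 1"
    by (metis V(1) Determinants.det_mul Determinants.det_I abs_mult abs_one)
  ultimately have "measure lebesgue (ball_t t) * \<bar>det lattice_mat\<bar> = measure lebesgue (polydisc conj_emb t)"
    by (simp add: mult.commute mult.left_commute)
  then show "measure lebesgue (ball_t t) * \<bar>det lattice_mat\<bar> = (\<Prod>\<sigma>\<in>UNIV. (if conj_emb \<sigma> = \<sigma> then 2 else sqrt (2 * pi)) * t \<sigma>)"
    by (simp add: measure_polydisc assms)
qed

lemma finite_bounded_integers:
  "finite {x :: 'a. algebraic_int x \<and> (\<forall>\<sigma>. cmod (emb \<sigma> x) \<le> t \<sigma>)}"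
proof -
  \<comment> \<open>Enlarged to be positive and invariant under conjugation, as
    \<open>measure_ball_t\<close> demands.\<close>
  define t' where "t' = (\<lambda>\<sigma>. max 1 (max (t \<sigma>) (t (conj_emb \<sigma>))))"
  have "bounded (ball_t t')" by (rule measure_ball_t) (auto simp: t'_def max.commute max.left_commute)
  then obtain b where b: "\<And>v. v \<in> ball_t t' \<Longrightarrow> norm v \<le> b" by (auto simp: bounded_iff)
  have "{x :: 'a. algebraic_int x \<and> (\<forall>\<sigma>. cmod (emb \<sigma> x) \<le> t \<sigma>)}
      \<subseteq> (\<lambda>h. elem (\<chi> j. of_int (h j))) ` (PiE UNIV (\<lambda>_. {\<lfloor>-b\<rfloor>..\<lfloor>b\<rfloor>}))"
  proof
    fix x :: 'a assume "x \<in> {x. algebraic_int x \<and> (\<forall>\<sigma>. cmod (emb \<sigma> x) \<le> t \<sigma>)}"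
    then have x: "algebraic_int x" "\<And>\<sigma>. cmod (emb \<sigma> x) \<le> t \<sigma>" by auto
    define v where "v = coord x"
    have v: "v \<in> int_vecs" "elem v = x" using coord[OF x(1)] by (auto simp: v_def)
    have "v \<in> ball_t t'" using x(2) by (simp add: ball_t_def emb_lin_int v t'_def max.coboundedI1 max.coboundedI2)
    then have nv: "norm v \<le> b" by (rule b)
    have "\<bar>v $ j\<bar> \<le> b" for j using component_le_norm_cart[of v j] nv by linarith
    then have "-b \<le> v $ j" "v $ j \<le> b" for j by (simp_all add: abs_le_iff minus_le_iff)
    then have "(\<lambda>j. \<lfloor>v $ j\<rfloor>) \<in> PiE UNIV (\<lambda>_. {\<lfloor>-b\<rfloor>..\<lfloor>b\<rfloor>})" by (auto intro!: floor_mono)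
    moreover have "x = elem (\<chi> j. of_int \<lfloor>v $ j\<rfloor>)" using v by (simp add: elem_def)
    ultimately show "x \<in> (\<lambda>h. elem (\<chi> j. of_int (h j))) ` (PiE UNIV (\<lambda>_. {\<lfloor>-b\<rfloor>..\<lfloor>b\<rfloor>}))"
      using image_eqI[of x "\<lambda>h. elem (\<chi> j. of_int (h j))" "\<lambda>j. \<lfloor>v $ j\<rfloor>"] by simp
  qed
  moreover have "finite (PiE (UNIV :: 'a emb set) (\<lambda>_. {\<lfloor>-b\<rfloor>..\<lfloor>b\<rfloor>}))" by (rule finite_PiE) auto
  ultimately show ?thesis using finite_surj by blast
qed


section \<open>The index of a principal ideal\<close>

abbreviation ZK :: "'a set" where "ZK \<equiv> {x. algebraic_int x}"

lemma add_subgroup_ZK: "add_subgroup ZK"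
  by (auto simp: add_subgroup_def intro: algebraic_int_diff)

definition mulmat :: "'a \<Rightarrow> real ^ 'a emb ^ 'a emb" where
  "mulmat x = (\<chi> k j. coord (x * int_basis j) $ k)"

lemma emb_lin_mulmat:
  assumes "algebraic_int x"
  shows "emb_lin \<sigma> (mulmat x *v v) = emb \<sigma> x * emb_lin \<sigma> v"
proof -
  have "emb_lin \<sigma> (mulmat x *v v) = (\<Sum>k\<in>UNIV. \<Sum>j\<in>UNIV. of_real (v $ j) * (emb \<sigma> (int_basis k) * of_real (coord (x * int_basis j) $ k)))"
    by (simp add: emb_lin_def mulmat_def matrix_vector_mult_def sum_distrib_left mult_ac)
  also have "\<dots> = (\<Sum>j\<in>UNIV. \<Sum>k\<in>UNIV. of_real (v $ j) * (emb \<sigma> (int_basis k) * of_real (coord (x * int_basis j) $ k)))"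
    by (rule sum.swap)
  also have "\<dots> = (\<Sum>j\<in>UNIV. of_real (v $ j) * emb_lin \<sigma> (coord (x * int_basis j)))"
    by (simp add: emb_lin_def sum_distrib_left)
  also have "\<dots> = (\<Sum>j\<in>UNIV. of_real (v $ j) * (emb \<sigma> x * emb \<sigma> (int_basis j)))"
    using coord algebraic_int_times[OF assms algebraic_int_basis]
    by (intro sum.cong refl) (simp add: emb_lin_int emb.hom_mult)
  also have "\<dots> = emb \<sigma> x * emb_lin \<sigma> v" by (simp add: emb_lin_def sum_distrib_left mult_ac)
  finally show ?thesis .
qed

lemma mulmat_int_vecs:
  assumes "algebraic_int x" "v \<in> int_vecs"
  shows "mulmat x *v v \<in> int_vecs"
proof -
  have "coord (x * int_basis j) \<in> int_vecs" for j
    using coord algebraic_int_times[OF assms(1) algebraic_int_basis] by blast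
  then show ?thesis using assms(2)
    by (auto simp: int_vecs_def mulmat_def matrix_vector_mult_def intro!: Ints_sum Ints_mult)
qed

lemma elem_mulmat:
  assumes "algebraic_int x" "v \<in> int_vecs"
  shows "elem (mulmat x *v v) = x * elem v"
  by (rule emb_eqI)
    (simp add: emb_lin_int[symmetric] mulmat_int_vecs assms emb_lin_mulmat emb.hom_mult)

text \<open>\<open>emb_mat int_basis\<close> conjugates the multiplication matrix to the diagonal
  matrix of the conjugates of \<open>x\<close>.\<close>

lemma det_mulmat:
  assumes "algebraic_int x"
  shows "\<bar>det (mulmat x)\<bar> = cmod (Nm x)"
proof -
  define D :: "complex ^ 'a emb ^ 'a emb" where "D = (\<chi> i j. if i = j then emb i x else 0)"
  have "(emb_mat int_basis ** (\<chi> i j. of_real (mulmat x $ i $ j))) $ \<sigma> $ j = (D ** emb_mat int_basis) $ \<sigma> $ j" for \<sigma> j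
  proof -
    have "(emb_mat int_basis ** (\<chi> i j. of_real (mulmat x $ i $ j))) $ \<sigma> $ j = emb_lin \<sigma> (coord (x * int_basis j))"
      by (simp add: matrix_matrix_mult_def emb_mat_def mulmat_def emb_lin_def)
    also have "\<dots> = emb \<sigma> x * emb \<sigma> (int_basis j)"
      using coord algebraic_int_times[OF assms algebraic_int_basis] by (simp add: emb_lin_int emb.hom_mult)
    also have "\<dots> = (\<Sum>k\<in>UNIV. if k = \<sigma> then emb \<sigma> x * emb \<sigma> (int_basis j) else 0)" by simp
    also have "\<dots> = (D ** emb_mat int_basis) $ \<sigma> $ j"
      unfolding matrix_matrix_mult_def D_def emb_mat_def vec_lambda_beta by (intro sum.cong) auto
    finally show ?thesis .
  qed
  then have "emb_mat int_basis ** (\<chi> i j. of_real (mulmat x $ i $ j)) = D ** emb_mat int_basis" by (simp add: vec_eq_iff)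
  then have "det (emb_mat int_basis) * of_real (det (mulmat x)) = det D * det (emb_mat int_basis)"
    by (metis Determinants.det_mul det_of_real)
  moreover have "det (emb_mat int_basis) \<noteq> 0" using det_emb_mat_nonzero zbasis_int_basis by (simp add: zbasis_def)
  ultimately have "of_real (det (mulmat x)) = det D" by simp
  also have "\<dots> = Nm x" by (subst Determinants.det_diagonal) (auto simp: D_def Nm_def)
  finally show ?thesis by (metis norm_of_real)
qed

definition principal :: "'a \<Rightarrow> 'a set" where
  "principal x = (*) x ` ZK"

lemma add_subgroup_principal: "add_subgroup (principal x)"
  unfolding add_subgroup_def
proof (intro conjI ballI)
  show "0 \<in> principal x" unfolding principal_def by (intro image_eqI[of _ _ 0]) auto
  fix y z assume "y \<in> principal x" "z \<in> principal x"
  then obtain a b where "algebraic_int a" "algebraic_int b" "y = x * a" "z = x * b"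
    by (auto simp: principal_def)
  then have "y - z = x * (a - b)" "algebraic_int (a - b)" by (auto simp: algebra_simps intro: algebraic_int_diff)
  then show "y - z \<in> principal x" unfolding principal_def by blast
qed

lemma small_int_vec:
  assumes "u \<in> box 0 1" "w \<in> box 0 (1 :: real ^ 'a emb)" "u - w \<in> int_vecs"
  shows "u = w"
proof -
  have "u $ i = w $ i" for i
  proof -
    have "(u - w) $ i \<in> \<int>" using assms(3) by (simp add: int_vecs_def)
    moreover have "\<bar>(u - w) $ i\<bar> < 1" using assms(1,2) by (auto simp: mem_box_cart abs_less_iff dest!: spec[of _ i])
    ultimately have "(u - w) $ i = 0" by (rule Ints_nonzero_abs_less1)
    then show ?thesis by simp
  qed
  then show ?thesis by (simp add: vec_eq_iff)
qed

lemma measure_unit_box: "box 0 (1 :: real ^ 'a emb) \<in> lmeasurable" "measure lebesgue (box 0 (1 :: real ^ 'a emb)) = 1"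
proof -
  show "box 0 (1 :: real ^ 'a emb) \<in> lmeasurable" by (rule lmeasurable_box)
  have "measure lebesgue (cbox 0 (1 :: real ^ 'a emb)) = 1"
    by (subst measure_completion) (auto simp: content_cbox_cart interval_ne_empty_cart)
  then show "measure lebesgue (box 0 (1 :: real ^ 'a emb)) = 1"
    by (simp add: measure_completion measure_lborel_box_eq measure_lborel_cbox_eq)
qed

text \<open>Unit boxes placed at an incongruent family \<open>T\<close> are disjoint, of total
  volume card T. Their preimage under multiplication by \<open>x\<close> has volume card T / |Nm x|.
  If this exceeded 1, Blichfeldt's theorem would give two points of the preimage that differ by an
  integral vector; the boxes containing their images would have congruent corners, hence be the same
  box, and the points would coincide.\<close>

lemma idx_principal_le:
  assumes x: "algebraic_int x" "x \<noteq> 0"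
  shows "finite (cosets ZK (principal x))" "real (idx ZK (principal x)) \<le> cmod (Nm x)"
proof -
  define A where "A = mulmat x"
  have det: "\<bar>det A\<bar> = cmod (Nm x)" unfolding A_def by (rule det_mulmat[OF x(1)])
  have "det A \<noteq> 0" using det Nm_nonzero[OF x(2)] by auto
  then obtain V where V: "V ** A = mat 1" "A ** V = mat 1"
    using invertible_det_nz[of A] unfolding invertible_def by blast
  have lin: "linear ((*v) V)" by (rule matrix_vector_mul_linear)
  have card: "real (card T) \<le> cmod (Nm x)"
    if T: "finite T" "T \<subseteq> ZK" "\<And>r s. r \<in> T \<Longrightarrow> s \<in> T \<Longrightarrow> r - s \<in> principal x \<Longrightarrow> r = s" for T
  proof (rule ccontr)
    assume gt: "\<not> ?thesis"
    define C where "C = (\<lambda>r. (+) (coord r) ` box 0 (1 :: real ^ 'a emb))"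
    define U where "U = (\<Union>r\<in>T. C r)"
    have Cm: "C r \<in> lmeasurable" "measure lebesgue (C r) = 1" for r
      unfolding C_def using measure_unit_box
        measurable_translation[OF measure_unit_box(1), of "coord r"]
        measure_translation[of "coord r" "box 0 (1 :: real ^ 'a emb)"]
      by simp_all
    have disj: "disjnt (C r) (C s)" if "r \<in> T" "s \<in> T" "r \<noteq> s" for r s
    proof (rule ccontr)
      assume "\<not> disjnt (C r) (C s)"
      then obtain u w where uw: "u \<in> box 0 1" "w \<in> box 0 1" "coord r + u = coord s + w"
        by (auto simp: disjnt_iff C_def)
      have "u - w = coord s - coord r" using uw(3) by (simp add: algebra_simps)
      moreover have "coord s - coord r \<in> int_vecs" using that T(2) coord by (intro int_vecs_diff) auto
      ultimately have "u = w" using small_int_vec[OF uw(1,2)] by simp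
      then have "coord r = coord s" using uw by simp
      then show False using that T(2) coord(2) by (metis mem_Collect_eq subsetD)
    qed
    have Um: "U \<in> lmeasurable" unfolding U_def using T(1) Cm by (intro fmeasurable.finite_UN) auto
    have "measure lebesgue U = (\<Sum>r\<in>T. measure lebesgue (C r))"
      unfolding U_def
    proof (rule measure_UNION')
      show "pairwise (\<lambda>r s. disjnt (C r) (C s)) T" using disj by (auto simp: pairwise_def)
    qed (use T(1) Cm in auto)
    then have mU: "measure lebesgue U = real (card T)" by (simp add: Cm)
    have bU: "bounded U" unfolding U_def C_def using T(1) bounded_translation[OF bounded_box] by (intro bounded_UN) auto
    define S where "S = (*v) V ` U"
    have Sm: "S \<in> lmeasurable" unfolding S_def by (rule measurable_linear_image[OF lin Um])
    have Sb: "bounded S"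
      unfolding S_def by (rule bounded_linear_image[OF bU linear_linear[THEN iffD2, OF lin]])
    have "\<bar>det V\<bar> * \<bar>det A\<bar> = 1"
      by (metis V(1) Determinants.det_mul Determinants.det_I abs_mult abs_one)
    moreover have "measure lebesgue S = \<bar>det V\<bar> * real (card T)"
      unfolding S_def by (subst measure_linear_image[OF lin Um]) (simp add: matrix_of_matrix_vector_mul mU)
    moreover have "\<bar>det V\<bar> > 0" using calculation(1) by (metis abs_ge_zero less_eq_real_def mult_zero_left zero_neq_one)
    ultimately have "measure lebesgue S > real 1"
      using gt det by (metis linorder_not_le mult_less_cancel_left_pos of_nat_1)
    then obtain P where P: "P \<subseteq> S" "card P = Suc 1" "\<forall>p\<in>P. \<forall>q\<in>P. p - q \<in> int_vecs"
      using blichfeldt[OF Sm Sb] by blast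
    have "\<exists>p q. P = {p, q} \<and> p \<noteq> q" using P(2) by (metis One_nat_def card_2_iff numeral_2_eq_2)
    then obtain p q where pq: "p \<in> P" "q \<in> P" "p \<noteq> q" by blast
    obtain r u where r: "r \<in> T" "u \<in> box 0 1" "p = V *v (coord r + u)"
      using pq(1) P(1) unfolding S_def U_def C_def by blast
    obtain s w where s: "s \<in> T" "w \<in> box 0 1" "q = V *v (coord s + w)"
      using pq(2) P(1) unfolding S_def U_def C_def by blast
    have Ap: "A *v p = coord r + u" "A *v q = coord s + w"
      by (simp_all add: r s matrix_vector_mul_assoc V)
    have pqi: "p - q \<in> int_vecs" using P(3) pq by blast
    then have Apq: "A *v (p - q) \<in> int_vecs" unfolding A_def by (rule mulmat_int_vecs[OF x(1)])
    have rs: "coord r \<in> int_vecs" "coord s \<in> int_vecs" "elem (coord r) = r" "elem (coord s) = s"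
      using r(1) s(1) T(2) coord by auto
    have "u - w = A *v (p - q) - (coord r - coord s)"
      by (simp add: matrix_vector_mult_diff_distrib Ap)
    then have "u - w \<in> int_vecs" using Apq rs by (simp add: int_vecs_diff)
    then have "u = w" by (rule small_int_vec[OF r(2) s(2)])
    then have "coord r - coord s = A *v (p - q)" by (simp add: matrix_vector_mult_diff_distrib Ap)
    then have "r - s = x * elem (p - q)"
      using elem_diff[OF rs(1,2)] elem_mulmat[OF x(1) pqi] rs by (simp add: A_def)
    then have "r - s \<in> principal x" unfolding principal_def using algebraic_int_elem by blast
    then have "r = s" by (rule T(3)[OF r(1) s(1)])
    then have "p = q" using r s \<open>u = w\<close> by simp
    then show False using pq by simp
  qed
  have "card T \<le> nat \<lfloor>cmod (Nm x)\<rfloor>"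
    if "finite T" "T \<subseteq> ZK" "\<And>r s. r \<in> T \<Longrightarrow> s \<in> T \<Longrightarrow> r - s \<in> principal x \<Longrightarrow> r = s" for T
    using card[OF that] by (simp add: le_nat_floor)
  note le = idx_le[OF add_subgroup_principal this]
  show "finite (cosets ZK (principal x))" by (rule le(1))
  have "idx ZK (principal x) \<le> nat \<lfloor>cmod (Nm x)\<rfloor>" by (rule le(2))
  then show "real (idx ZK (principal x)) \<le> cmod (Nm x)"
    using of_nat_floor[of "cmod (Nm x)"] by (meson norm_ge_zero of_nat_mono order_trans)
qed

text \<open>This replaces a fundamental domain for \<open>J\<close>: Blichfeldt's theorem yields one
  point more than there are classes modulo \<open>J\<close>, with integral differences, and two of
  these points are congruent modulo \<open>J\<close>.\<close>

lemma blichfeldt_pigeonhole: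
  assumes J: "add_subgroup J" "finite (cosets ZK J)"
    and S: "S \<in> lmeasurable" "bounded S" "measure lebesgue S > real (idx ZK J)"
  obtains p q where "p \<in> S" "q \<in> S" "p \<noteq> q" "p - q \<in> int_vecs" "elem (p - q) \<in> J"
proof -
  obtain T where T: "T \<subseteq> S" "finite T" "card T = Suc (idx ZK J)" "\<forall>p\<in>T. \<forall>q\<in>T. p - q \<in> int_vecs"
    using blichfeldt[OF S] by blast
  then obtain p0 where p0: "p0 \<in> T" by fastforce
  define f where "f = (\<lambda>p. elem (p - p0))"
  have int: "p - p0 \<in> int_vecs" if "p \<in> T" for p using that p0 T(4) by blast
  have fd: "f p - f q = elem (p - q)" if "p \<in> T" "q \<in> T" for p q
    using elem_diff[OF int int, OF that] by (simp add: f_def)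
  have "inj_on f T"
  proof (rule inj_onI)
    fix p q assume pq: "p \<in> T" "q \<in> T" "f p = f q"
    then have "elem (p - q) = 0" using fd by fastforce
    then show "p = q" using elem_eq_0D[of "p - q"] T(4) pq by auto
  qed
  then have "card (f ` T) > idx ZK J" using T(3) by (simp add: card_image)
  moreover have "f ` T \<subseteq> ZK" using algebraic_int_elem by (auto simp: f_def)
  ultimately obtain a b where "a \<in> f ` T" "b \<in> f ` T" "a \<noteq> b" "a - b \<in> J"
    using idx_pigeonhole[OF J] by blast
  then obtain p q where "p \<in> T" "q \<in> T" "f p \<noteq> f q" "f p - f q \<in> J" by blast
  then show ?thesis using that[of p q] fd T(1,4) by auto
qed

text \<open>For the remaining inequality, the image of the unit box under multiplication by
  \<open>x\<close> has volume |Nm x|. Were this more than the index, two of its points would differ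
  by an element of x O; pulled back, two points of the open unit box would differ by an integral
  vector.\<close>

lemma idx_principal:
  assumes x: "algebraic_int x" "x \<noteq> 0"
  shows "real (idx ZK (principal x)) = cmod (Nm x)"
proof (rule antisym)
  show "real (idx ZK (principal x)) \<le> cmod (Nm x)" by (rule idx_principal_le[OF x])
  define A where "A = mulmat x"
  have det: "\<bar>det A\<bar> = cmod (Nm x)" unfolding A_def by (rule det_mulmat[OF x(1)])
  have "det A \<noteq> 0" using det Nm_nonzero[OF x(2)] by auto
  then obtain V where V: "V ** A = mat 1" "A ** V = mat 1"
    using invertible_det_nz[of A] unfolding invertible_def by blast
  have lin: "linear ((*v) A)" by (rule matrix_vector_mul_linear)
  define S where "S = (*v) A ` box 0 (1 :: real ^ 'a emb)"
  have Sm: "S \<in> lmeasurable" unfolding S_def by (rule measurable_linear_image[OF lin measure_unit_box(1)])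
  have Sb: "bounded S"
    unfolding S_def by (rule bounded_linear_image[OF bounded_box linear_linear[THEN iffD2, OF lin]])
  have mS: "measure lebesgue S = cmod (Nm x)"
    unfolding S_def using measure_unit_box
    by (subst measure_linear_image[OF lin measure_unit_box(1)]) (simp add: matrix_of_matrix_vector_mul det)
  show "cmod (Nm x) \<le> real (idx ZK (principal x))"
  proof (rule ccontr)
    assume "\<not> ?thesis"
    then have "measure lebesgue S > real (idx ZK (principal x))" by (simp add: mS)
    then obtain p q where pq: "p \<in> S" "q \<in> S" "p \<noteq> q" "p - q \<in> int_vecs" "elem (p - q) \<in> principal x"
      by (rule blichfeldt_pigeonhole[OF add_subgroup_principal idx_principal_le(1)[OF x] Sm Sb])
    obtain y where y: "algebraic_int y" "elem (p - q) = x * y" using pq(5) by (auto simp: principal_def)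
    obtain u w where uw: "u \<in> box 0 1" "w \<in> box 0 1" "p = A *v u" "q = A *v w" using pq(1,2) by (auto simp: S_def)
    have c: "coord y \<in> int_vecs" "elem (coord y) = y" using coord[OF y(1)] by auto
    have "elem (A *v coord y) = elem (p - q)" using elem_mulmat[OF x(1) c(1)] c y by (simp add: A_def)
    moreover have i: "A *v coord y \<in> int_vecs" unfolding A_def by (rule mulmat_int_vecs[OF x(1) c(1)])
    ultimately have "elem (p - q - A *v coord y) = 0" using elem_diff[OF pq(4) i] by simp
    then have "p - q - A *v coord y = 0" by (rule elem_eq_0D[OF int_vecs_diff[OF pq(4) i]])
    then have "A *v (u - w) = A *v coord y" by (simp add: matrix_vector_mult_diff_distrib uw)
    then have "V *v (A *v (u - w)) = V *v (A *v coord y)" by simp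
    then have "u - w = coord y" by (simp add: matrix_vector_mul_assoc V)
    then have "u = w" using small_int_vec[OF uw(1,2)] c(1) by simp
    then show False using pq(3) uw by simp
  qed
qed

section \<open>Minkowski's theorem with bounds at each embedding\<close>

definition mink_const :: real where
  "mink_const = (2 / pi) ^ card (complex_places :: 'a place set) * sqrt \<bar>real_of_int (discriminant TYPE('a))\<bar>"

lemma card_complex_embeddings:
  "card {\<sigma> :: 'a emb. conj_emb \<sigma> \<noteq> \<sigma>} = 2 * card (complex_places :: 'a place set)"
proof -
  define C where "C = {\<sigma> :: 'a emb. conj_emb \<sigma> \<noteq> \<sigma>}"
  define P where "P = (\<lambda>\<sigma>. {\<sigma>, conj_emb \<sigma>}) ` C"
  have "card P * 2 = card (\<Union>P)"
  proof -
    have "2 * card P = card (\<Union>P)"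
    proof (rule card_partition)
      show "card c = 2" if "c \<in> P" for c using that by (auto simp: P_def C_def card_insert_if)
      show "c1 \<inter> c2 = {}" if "c1 \<in> P" "c2 \<in> P" "c1 \<noteq> c2" for c1 c2
        using that unfolding P_def by (auto dest: arg_cong[of _ _ conj_emb])
    qed (auto simp: P_def)
    then show ?thesis by simp
  qed
  moreover have "\<Union>P = C"
  proof -
    have "conj_emb \<sigma> \<in> C" if "\<sigma> \<in> C" for \<sigma> using that by (auto simp: C_def)
    then show ?thesis by (auto simp: P_def)
  qed
  moreover have "card P = card (complex_places :: 'a place set)"
  proof -
    have inj: "inj_on (\<lambda>E. Arch_place (emb ` E)) P"
    proof (rule inj_onI)
      fix E F assume "Arch_place (emb ` E) = Arch_place (emb ` F)"
      then have "emb ` E = emb ` F" by simp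
      then show "E = F" using emb_inject by (metis inj_image_eq_iff injI)
    qed
    have "cnj \<circ> emb \<sigma> \<noteq> emb \<sigma> \<longleftrightarrow> conj_emb \<sigma> \<noteq> \<sigma>" for \<sigma> by (metis emb_conj_emb emb_inject)
    then have "(complex_places :: 'a place set) = (\<lambda>E. Arch_place (emb ` E)) ` P"
      unfolding complex_places_def P_def C_def range_emb[symmetric] by (auto simp: emb_conj_emb image_iff)
    then show ?thesis using card_image[OF inj] by simp
  qed
  ultimately show ?thesis by (simp add: C_def)
qed

text \<open>\<open>blichfeldt_pigeonhole\<close> is applied to the body with half the bounds; the
  difference of two of its points satisfies the full ones.\<close>

lemma minkowski_eps:
  assumes J: "add_subgroup J" "finite (cosets ZK J)"
    and t: "\<And>\<sigma>. t \<sigma> > 0" "\<And>\<sigma>. t (conj_emb \<sigma>) = t \<sigma>" "(\<Prod>\<sigma>\<in>UNIV. t \<sigma>) > mink_const * real (idx ZK J)"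
  shows "\<exists>x\<in>J. x \<noteq> 0 \<and> algebraic_int x \<and> (\<forall>\<sigma>. cmod (emb \<sigma> x) \<le> t \<sigma>)"
proof -
  define h where "h = (\<lambda>\<sigma>. t \<sigma> / 2)"
  have h: "\<And>\<sigma>. h \<sigma> > 0" "\<And>\<sigma>. h (conj_emb \<sigma>) = h \<sigma>" using t by (auto simp: h_def)
  note m = measure_ball_t[of h, OF h]
  define s where "s = card (complex_places :: 'a place set)"
  have "(\<Prod>\<sigma>\<in>UNIV. (if conj_emb \<sigma> = \<sigma> then 2 else sqrt (2 * pi)) * h \<sigma>)
      = (\<Prod>\<sigma>\<in>UNIV. (if conj_emb \<sigma> \<noteq> \<sigma> then sqrt (pi / 2) else 1) * t \<sigma>)"
  proof (rule prod.cong)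
    fix \<sigma> :: "'a emb"
    \<comment> \<open>The volume factor of a complex embedding after halving its bound. The 2 s
      complex embeddings together contribute (pi / 2)^s, which cancels the factor (2 / pi)^s of
      \<open>mink_const\<close>.\<close>
    have "sqrt (2 * pi) / 2 = sqrt (pi / 2)"
      by (simp add: real_sqrt_mult real_sqrt_divide field_simps)
    then show "(if conj_emb \<sigma> = \<sigma> then 2 else sqrt (2 * pi)) * h \<sigma> = (if conj_emb \<sigma> \<noteq> \<sigma> then sqrt (pi / 2) else 1) * t \<sigma>"
      by (simp add: h_def field_simps)
  qed simp
  also have "\<dots> = (\<Prod>\<sigma>\<in>UNIV. if conj_emb \<sigma> \<noteq> (\<sigma> :: 'a emb) then sqrt (pi / 2) else 1) * (\<Prod>\<sigma>\<in>UNIV. t \<sigma>)"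
    by (rule prod.distrib)
  also have "(\<Prod>\<sigma>\<in>UNIV. if conj_emb \<sigma> \<noteq> (\<sigma> :: 'a emb) then sqrt (pi / 2) else 1) = sqrt (pi / 2) ^ (2 * s)"
  proof -
    have "(\<Prod>\<sigma>\<in>UNIV. if conj_emb \<sigma> \<noteq> (\<sigma> :: 'a emb) then sqrt (pi / 2) else 1) = (\<Prod>\<sigma>\<in>{\<sigma> :: 'a emb. conj_emb \<sigma> \<noteq> \<sigma>}. sqrt (pi / 2))"
      by (rule prod.mono_neutral_cong_right) auto
    then show ?thesis by (simp add: card_complex_embeddings s_def)
  qed
  also have "sqrt (pi / 2) ^ (2 * s) = (pi / 2) ^ s" by (simp add: power_mult)
  finally have mb: "measure lebesgue (ball_t h) * \<bar>det lattice_mat\<bar> = (pi / 2) ^ s * (\<Prod>\<sigma>\<in>UNIV. t \<sigma>)"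
    using m(3) by simp
  have "(pi / 2) ^ s * (\<Prod>\<sigma>\<in>UNIV. t \<sigma>) > (pi / 2) ^ s * (mink_const * real (idx ZK J))"
    using t(3) by (intro mult_strict_left_mono) auto
  also have "(pi / 2) ^ s * (mink_const * real (idx ZK J)) = ((pi / 2) * (2 / pi)) ^ s * \<bar>det lattice_mat\<bar> * real (idx ZK J)"
    unfolding mink_const_def abs_det_lattice_mat s_def power_mult_distrib by simp
  also have "\<dots> = real (idx ZK J) * \<bar>det lattice_mat\<bar>" by simp
  finally have "real (idx ZK J) * \<bar>det lattice_mat\<bar> < measure lebesgue (ball_t h) * \<bar>det lattice_mat\<bar>"
    using mb by simp
  then have "measure lebesgue (ball_t h) > real (idx ZK J)" using det_lattice_mat_nonzero by simp
  then obtain p q where pq: "p \<in> ball_t h" "q \<in> ball_t h" "p \<noteq> q" "p - q \<in> int_vecs" "elem (p - q) \<in> J"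
    by (rule blichfeldt_pigeonhole[OF J m(1,2)])
  have "cmod (emb \<sigma> (elem (p - q))) \<le> t \<sigma>" for \<sigma>
  proof -
    have "emb \<sigma> (elem (p - q)) = emb_lin \<sigma> p - emb_lin \<sigma> q" using emb_lin_int[OF pq(4)] by (simp add: emb_lin_diff)
    also have "cmod \<dots> \<le> cmod (emb_lin \<sigma> p) + cmod (emb_lin \<sigma> q)" by (rule norm_triangle_ineq4)
    also have "\<dots> \<le> h \<sigma> + h \<sigma>" using pq(1,2) by (intro add_mono) (auto simp: ball_t_def)
    finally show ?thesis by (simp add: h_def)
  qed
  moreover have "elem (p - q) \<noteq> 0" using elem_eq_0D[OF pq(4)] pq(3) by auto
  ultimately show ?thesis using pq(5) algebraic_int_elem by blast
qed

lemma mink_const_pos: "mink_const > 0"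
  using det_lattice_mat_nonzero abs_det_lattice_mat unfolding mink_const_def by (metis abs_zero less_eq_real_def mult_pos_pos pi_gt_zero real_sqrt_ge_zero
      abs_ge_zero zero_less_divide_iff zero_less_numeral zero_less_power zero_less_abs_iff)

text \<open>The case of equality, which keeps the constant at \<open>mink_const\<close>. It follows
  from the strict case with bounds enlarged by a factor e > 1, because only finitely many elements
  compete as e tends to 1.\<close>

lemma minkowski:
  assumes J: "add_subgroup J" "finite (cosets ZK J)"
    and t: "\<And>\<sigma>. t \<sigma> > 0" "\<And>\<sigma>. t (conj_emb \<sigma>) = t \<sigma>" "(\<Prod>\<sigma>\<in>UNIV. t \<sigma>) \<ge> mink_const * real (idx ZK J)"
  shows "\<exists>x\<in>J. x \<noteq> 0 \<and> algebraic_int x \<and> (\<forall>\<sigma>. cmod (emb \<sigma> x) \<le> t \<sigma>)"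
proof (rule ccontr)
  assume none: "\<not> ?thesis"
  \<comment> \<open>All candidates for factors e < 2. Each violates one of the original bounds
    strictly, and still does so after enlargement by a factor close enough to 1; finiteness gives a
    common e.\<close>
  define F where "F = {x. algebraic_int x \<and> (\<forall>\<sigma>. cmod (emb \<sigma> x) \<le> 2 * t \<sigma>)} \<inter> (J - {0})"
  have finF: "finite F" unfolding F_def using finite_bounded_integers[of "\<lambda>\<sigma>. 2 * t \<sigma>"] by blast
  have "\<forall>\<^sub>F e in at_right (1::real). \<exists>\<sigma>. cmod (emb \<sigma> x) > e * t \<sigma>" if xF: "x \<in> F" for x
  proof -
    obtain \<sigma> where \<sigma>: "t \<sigma> < cmod (emb \<sigma> x)" using none xF unfolding F_def by (auto simp: not_le)
    have "((\<lambda>e. e * t \<sigma>) \<longlongrightarrow> 1 * t \<sigma>) (at_right (1::real))" by (intro tendsto_intros)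
    then have "\<forall>\<^sub>F e in at_right (1::real). e * t \<sigma> < cmod (emb \<sigma> x)"
      using \<sigma> by (intro order_tendstoD(2)) auto
    then show ?thesis by (rule eventually_mono) blast
  qed
  then have "\<forall>\<^sub>F e in at_right (1::real). \<forall>x\<in>F. \<exists>\<sigma>. cmod (emb \<sigma> x) > e * t \<sigma>"
    using finF by (simp add: eventually_ball_finite)
  moreover have "\<forall>\<^sub>F e in at_right (1::real). e < 2" using eventually_at_right_real[of 1 2] by (auto elim: eventually_mono)
  moreover have "\<forall>\<^sub>F e in at_right (1::real). e > 1" by (simp add: eventually_at_right_less)
  ultimately have "\<forall>\<^sub>F e in at_right (1::real). (\<forall>x\<in>F. \<exists>\<sigma>. cmod (emb \<sigma> x) > e * t \<sigma>) \<and> e < 2 \<and> e > 1"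
    by (intro eventually_conj)
  then obtain e where e: "\<forall>x\<in>F. \<exists>\<sigma>. cmod (emb \<sigma> x) > e * t \<sigma>" "e < 2" "e > 1"
    using eventually_happens'[OF trivial_limit_at_right_real[of 1, unfolded trivial_limit_def[symmetric]]] by blast
  have "(\<Prod>\<sigma>\<in>UNIV. e * t \<sigma>) = e ^ CARD('a emb) * (\<Prod>\<sigma>\<in>UNIV. t \<sigma>)" by (simp add: prod.distrib)
  moreover have "e ^ CARD('a emb) > 1" using e(3) by (simp add: one_less_power)
  moreover have "(\<Prod>\<sigma>\<in>UNIV. t \<sigma>) > 0" using t(1) by (intro prod_pos) auto
  ultimately have gt: "(\<Prod>\<sigma>\<in>UNIV. e * t \<sigma>) > mink_const * real (idx ZK J)"
    using t(3) by (metis less_le_trans mult_less_cancel_right1 not_le order.strict_trans2)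
  have "\<exists>x\<in>J. x \<noteq> 0 \<and> algebraic_int x \<and> (\<forall>\<sigma>. cmod (emb \<sigma> x) \<le> e * t \<sigma>)"
    by (rule minkowski_eps[OF J _ _ gt]) (use t e in auto)
  then obtain x where x: "x \<in> J" "x \<noteq> 0" "algebraic_int x" "\<And>\<sigma>. cmod (emb \<sigma> x) \<le> e * t \<sigma>" by blast
  have "cmod (emb \<sigma> x) \<le> 2 * t \<sigma>" for \<sigma>
    using x(4)[of \<sigma>] e(2) t(1)[of \<sigma>] by (meson less_eq_real_def mult_right_mono order_trans)
  then have "x \<in> F" using x by (auto simp: F_def)
  then show False using e(1) x(4) by (meson not_le)
qed

end

section \<open>Ideals and prime ideals\<close>

lemma cosets_reps:
  assumes "add_subgroup A" "finite (cosets B A)" "C \<subseteq> B"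
  shows "\<exists>F. finite F \<and> F \<subseteq> C \<and> (\<forall>x\<in>C. \<exists>p\<in>F. x - p \<in> A)"
proof -
  have "(\<lambda>b. (+) b ` A) ` C \<subseteq> cosets B A" using assms(3) by (auto simp: cosets_def)
  then have "finite ((\<lambda>b. (+) b ` A) ` C)" using assms(2) finite_subset by blast
  then have "\<exists>F\<subseteq>C. finite F \<and> (\<lambda>b. (+) b ` A) ` C = (\<lambda>b. (+) b ` A) ` F"
    by (rule finite_subset_image) simp
  then obtain F where F: "F \<subseteq> C" "finite F" "(\<lambda>b. (+) b ` A) ` C = (\<lambda>b. (+) b ` A) ` F"
    by (elim exE conjE)
  have "\<exists>p\<in>F. x - p \<in> A" if "x \<in> C" for x
  proof -
    have "(+) x ` A \<in> (\<lambda>b. (+) b ` A) ` F" using F(3) that by blast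
    then show ?thesis using coset_eq_iff[OF assms(1)] by blast
  qed
  then show ?thesis using F(1,2) by blast
qed

lemma idx_reps:
  assumes "add_subgroup A" "finite (cosets B A)"
  shows "\<exists>F. finite F \<and> F \<subseteq> B \<and> card F = idx B A \<and> (\<forall>x\<in>B. \<exists>p\<in>F. x - p \<in> A) \<and>
    (\<forall>x\<in>F. \<forall>y\<in>F. x - y \<in> A \<longrightarrow> x = y)"
proof -
  have "\<exists>F\<subseteq>B. inj_on (\<lambda>b. (+) b ` A) F \<and> cosets B A = (\<lambda>b. (+) b ` A) ` F"
    by (rule iffD1[OF subset_image_inj]) (simp add: cosets_def)
  then obtain F where F: "F \<subseteq> B" "inj_on (\<lambda>b. (+) b ` A) F" "cosets B A = (\<lambda>b. (+) b ` A) ` F"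
    by (elim exE conjE)
  have 1: "card F = idx B A" unfolding idx_def F(3) by (simp add: card_image[OF F(2)])
  have 2: "finite F" using assms(2) finite_imageD[OF _ F(2)] unfolding F(3) by blast
  have 3: "\<exists>p\<in>F. x - p \<in> A" if "x \<in> B" for x
  proof -
    have "(+) x ` A \<in> (\<lambda>b. (+) b ` A) ` F" using F(3) that unfolding cosets_def by blast
    then show ?thesis using coset_eq_iff[OF assms(1)] by blast
  qed
  have 4: "x = y" if "x \<in> F" "y \<in> F" "x - y \<in> A" for x y
    using F(2) that coset_eq_iff[OF assms(1), of x y] by (auto simp: inj_on_def)
  show ?thesis using 2 F(1) 1 3 4 by (intro exI[of _ F]) simp
qed

lemma card_le_idx:
  assumes "add_subgroup A" "finite (cosets B A)" "T \<subseteq> B" "\<And>x y. x \<in> T \<Longrightarrow> y \<in> T \<Longrightarrow> x - y \<in> A \<Longrightarrow> x = y"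
  shows "card T \<le> idx B A"
proof (rule ccontr)
  assume "\<not> ?thesis"
  then have "card T > idx B A" by simp
  from idx_pigeonhole[OF assms(1-3) this] assms(4) show False by blast
qed

text \<open>Incongruent elements have incongruent images because \<open>f\<close> reflects
  congruence. As this is all that is asked of \<open>f\<close>, it may be an inclusion, a
  multiplication or a choice function.\<close>

lemma finite_cosets_hom:
  assumes A: "add_subgroup A" and A': "add_subgroup A'" "finite (cosets B' A')" and f: "\<And>x. x \<in> B \<Longrightarrow> f x \<in> B'"
    and fd: "\<And>x y. x \<in> B \<Longrightarrow> y \<in> B \<Longrightarrow> f x - f y \<in> A' \<Longrightarrow> x - y \<in> A"
  shows "finite (cosets B A)" "idx B A \<le> idx B' A'"
proof -
  have card: "card T \<le> idx B' A'"
    if T: "finite T" "T \<subseteq> B" "\<And>x y. x \<in> T \<Longrightarrow> y \<in> T \<Longrightarrow> x - y \<in> A \<Longrightarrow> x = y" for T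
  proof -
    have eq: "x = y" if "x \<in> T" "y \<in> T" "f x - f y \<in> A'" for x y
      using T(2,3) fd that by blast
    have "inj_on f T" using eq add_subgroupD(1)[OF A'(1)] by (intro inj_onI) simp
    moreover have "card (f ` T) \<le> idx B' A'"
      by (rule card_le_idx[OF A']) (use T(2) f eq in auto)
    ultimately show ?thesis by (simp add: card_image)
  qed
  show "finite (cosets B A)"
  proof (rule idx_le(1)[OF A])
    fix T assume "finite T" "T \<subseteq> B" "\<And>x y. x \<in> T \<Longrightarrow> y \<in> T \<Longrightarrow> x - y \<in> A \<Longrightarrow> x = y"
    then show "card T \<le> idx B' A'" by (rule card)
  qed
  show "idx B A \<le> idx B' A'"
  proof (rule idx_le(2)[OF A])
    fix T assume "finite T" "T \<subseteq> B" "\<And>x y. x \<in> T \<Longrightarrow> y \<in> T \<Longrightarrow> x - y \<in> A \<Longrightarrow> x = y"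
    then show "card T \<le> idx B' A'" by (rule card)
  qed
qed

lemma idx_tower:
  assumes A: "add_subgroup A" "add_subgroup A'" "add_subgroup B" "A \<subseteq> A'" "A' \<subseteq> B" and fin: "finite (cosets B A)"
  shows "idx B A = idx B A' * idx A' A" "finite (cosets B A')" "finite (cosets A' A)"
proof -
  show f1: "finite (cosets B A')"
    by (rule finite_cosets_hom[OF A(2) A(1) fin, where f = "\<lambda>x. x"]) (use A(4) in auto)
  show f2: "finite (cosets A' A)"
    by (rule finite_cosets_hom[OF A(1) A(1) fin, where f = "\<lambda>x. x"]) (use A(5) in auto)
  obtain F where F: "finite F" "F \<subseteq> B" "card F = idx B A'" "\<forall>x\<in>B. \<exists>p\<in>F. x - p \<in> A'"
    "\<forall>x\<in>F. \<forall>y\<in>F. x - y \<in> A' \<longrightarrow> x = y" using idx_reps[OF A(2) f1] by (elim exE conjE)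
  obtain G where G: "finite G" "G \<subseteq> A'" "card G = idx A' A" "\<forall>x\<in>A'. \<exists>p\<in>G. x - p \<in> A"
    "\<forall>x\<in>G. \<forall>y\<in>G. x - y \<in> A \<longrightarrow> x = y" using idx_reps[OF A(1) f2] by (elim exE conjE)
  define s where "s = (\<lambda>p::'a \<times> 'a. fst p + snd p)"
  have eq: "p = q" if p: "p \<in> F \<times> G" and q: "q \<in> F \<times> G" and d: "s p - s q \<in> A" for p q
  proof -
    obtain a b c e where pq: "p = (a, b)" "q = (c, e)" "a \<in> F" "b \<in> G" "c \<in> F" "e \<in> G" using p q by auto
    have "a - c = (s p - s q) - (b - e)" by (simp add: pq s_def)
    moreover have "b - e \<in> A'" using pq G(2) add_subgroupD(2)[OF A(2)] by blast
    ultimately have "a - c \<in> A'" using d A(4) add_subgroupD(2)[OF A(2), of "s p - s q" "b - e"] by auto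
    then have "a = c" using F(5) pq by blast
    then have "b - e \<in> A" using d by (simp add: pq s_def)
    then show ?thesis using G(5) pq \<open>a = c\<close> by blast
  qed
  have "inj_on s (F \<times> G)" using eq add_subgroupD(1)[OF A(1)] by (intro inj_onI) simp
  then have card: "card (s ` (F \<times> G)) = idx B A' * idx A' A"
    using F G by (simp add: card_image card_cartesian_product)
  have "card (s ` (F \<times> G)) \<le> idx B A"
  proof (rule card_le_idx[OF A(1) fin])
    show "s ` (F \<times> G) \<subseteq> B" using F(2) G(2) A(5) by (auto simp: s_def intro!: add_subgroupD(4)[OF A(3)])
    show "x = y" if "x \<in> s ` (F \<times> G)" "y \<in> s ` (F \<times> G)" "x - y \<in> A" for x y using that eq by blast
  qed
  moreover have "idx B A \<le> card (s ` (F \<times> G))"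
  proof -
    have "cosets B A \<subseteq> (\<lambda>b. (+) b ` A) ` (s ` (F \<times> G))"
    proof
      fix C assume "C \<in> cosets B A"
      then obtain x where x: "x \<in> B" "C = (+) x ` A" by (auto simp: cosets_def)
      obtain p where p: "p \<in> F" "x - p \<in> A'" using F(4) x by blast
      obtain q where q: "q \<in> G" "x - p - q \<in> A" using G(4) p(2) by blast
      have "x - s (p, q) \<in> A" using q(2) by (simp add: s_def algebra_simps)
      then have "C = (+) (s (p, q)) ` A" using coset_eq_iff[OF A(1)] x by blast
      then show "C \<in> (\<lambda>b. (+) b ` A) ` (s ` (F \<times> G))" using p q by blast
    qed
    then have "idx B A \<le> card ((\<lambda>b. (+) b ` A) ` (s ` (F \<times> G)))"
      unfolding idx_def using F(1) G(1) by (intro card_mono) auto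
    also have "\<dots> \<le> card (s ` (F \<times> G))" using F(1) G(1) by (intro card_image_le) auto
    finally show ?thesis .
  qed
  ultimately show "idx B A = idx B A' * idx A' A" using card by simp
qed

context numfield
begin

definition int_ideal :: "'a set \<Rightarrow> bool" where
  "int_ideal J \<longleftrightarrow> add_subgroup J \<and> J \<subseteq> ZK \<and> (\<forall>x\<in>J. \<forall>y\<in>ZK. y * x \<in> J)"

lemma int_idealD:
  assumes "int_ideal J"
  shows "add_subgroup J" "x \<in> J \<Longrightarrow> algebraic_int x" "x \<in> J \<Longrightarrow> algebraic_int y \<Longrightarrow> y * x \<in> J"
    "x \<in> J \<Longrightarrow> algebraic_int y \<Longrightarrow> x * y \<in> J"
  using assms by (auto simp: int_ideal_def mult.commute)

lemma cring_integer_ring: "cring (integer_ring :: 'a ring)"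
proof (rule cringI)
  show "abelian_group (integer_ring :: 'a ring)"
  proof (rule abelian_groupI)
    fix x :: 'a assume "x \<in> carrier integer_ring"
    then show "\<exists>y\<in>carrier integer_ring. y \<oplus>\<^bsub>integer_ring\<^esub> x = \<zero>\<^bsub>integer_ring\<^esub>"
      by (intro bexI[of _ "- x"]) (auto simp: integer_ring_def)
  qed (auto simp: integer_ring_def intro: algebraic_int_plus)
  show "comm_monoid (integer_ring :: 'a ring)"
    by (rule comm_monoidI) (auto simp: integer_ring_def intro: algebraic_int_times)
qed (auto simp: integer_ring_def algebra_simps)

lemma integer_ring_simps [simp]:
  "carrier (integer_ring :: 'a ring) = ZK" "x \<oplus>\<^bsub>integer_ring\<^esub> y = (x::'a) + y"
  "x \<otimes>\<^bsub>integer_ring\<^esub> y = (x::'a) * y" "\<zero>\<^bsub>integer_ring\<^esub> = (0::'a)" "\<one>\<^bsub>integer_ring\<^esub> = (1::'a)"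
  by (auto simp: integer_ring_def)

lemma ideal_iff_int_ideal: "ideal J (integer_ring :: 'a ring) \<longleftrightarrow> int_ideal J"
proof
  assume "ideal J (integer_ring :: 'a ring)"
  then interpret ideal J "integer_ring :: 'a ring" .
  have m: "y * x \<in> J" if "x \<in> J" "algebraic_int y" for x y
    using I_l_closed[of x y] that by simp
  have "x - y \<in> J" if "x \<in> J" "y \<in> J" for x y
  proof -
    have "(-1) * y \<in> J" using that by (intro m) auto
    then show ?thesis using additive_subgroup.a_closed[OF additive_subgroup_axioms, of x "-1 * y"] that by simp
  qed
  moreover have "0 \<in> J" "J \<subseteq> ZK" using additive_subgroup.zero_closed[OF additive_subgroup_axioms] a_subset by auto
  ultimately show "int_ideal J" using m by (auto simp: int_ideal_def add_subgroup_def)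
next
  assume J: "int_ideal J"
  interpret R: cring "integer_ring :: 'a ring" by (rule cring_integer_ring)
  show "ideal J (integer_ring :: 'a ring)"
  proof (rule idealI)
    show "ring (integer_ring :: 'a ring)" by (rule R.ring_axioms)
    show "subgroup J (add_monoid (integer_ring :: 'a ring))"
    proof (rule R.add.subgroupI)
      show "J \<subseteq> carrier (integer_ring :: 'a ring)" using J by (auto simp: int_ideal_def)
      show "J \<noteq> {}" using add_subgroupD(1)[OF int_idealD(1)[OF J]] by auto
      fix x assume x: "x \<in> J"
      have "\<ominus>\<^bsub>integer_ring\<^esub> x = - x"
        by (rule R.minus_equality) (use x int_idealD(2)[OF J] in auto)
      then show "\<ominus>\<^bsub>integer_ring\<^esub> x \<in> J"
        using add_subgroupD(3)[OF int_idealD(1)[OF J] x] by simp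
      fix y assume "y \<in> J"
      then show "x \<oplus>\<^bsub>integer_ring\<^esub> y \<in> J" using add_subgroupD(4)[OF int_idealD(1)[OF J] x] by simp
    qed
  qed (use J int_idealD in auto)
qed

definition int_prime :: "'a set \<Rightarrow> bool" where
  "int_prime P \<longleftrightarrow> primeideal P (integer_ring :: 'a ring) \<and> P \<noteq> {0}"

lemma int_prime_iff:
  "int_prime P \<longleftrightarrow> int_ideal P \<and> P \<noteq> {0} \<and> 1 \<notin> P \<and>
     (\<forall>x y. algebraic_int x \<longrightarrow> algebraic_int y \<longrightarrow> x * y \<in> P \<longrightarrow> x \<in> P \<or> y \<in> P)"
proof
  assume "int_prime P"
  then interpret primeideal P "integer_ring :: 'a ring" by (simp add: int_prime_def)
  have "int_ideal P" using ideal_axioms ideal_iff_int_ideal by blast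
  moreover have "1 \<notin> P"
  proof
    assume "1 \<in> P"
    then have "P = ZK" using int_idealD(2)[OF \<open>int_ideal P\<close>] int_idealD(4)[OF \<open>int_ideal P\<close>, of 1] by auto
    then show False using I_notcarr by simp
  qed
  ultimately show "int_ideal P \<and> P \<noteq> {0} \<and> 1 \<notin> P \<and>
     (\<forall>x y. algebraic_int x \<longrightarrow> algebraic_int y \<longrightarrow> x * y \<in> P \<longrightarrow> x \<in> P \<or> y \<in> P)"
    using I_prime \<open>int_prime P\<close> by (auto simp: int_prime_def)
next
  assume P: "int_ideal P \<and> P \<noteq> {0} \<and> 1 \<notin> P \<and>
     (\<forall>x y. algebraic_int x \<longrightarrow> algebraic_int y \<longrightarrow> x * y \<in> P \<longrightarrow> x \<in> P \<or> y \<in> P)"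
  then have "ideal P (integer_ring :: 'a ring)" using ideal_iff_int_ideal by blast
  then have "primeideal P (integer_ring :: 'a ring)"
    using cring_integer_ring P by (intro primeidealI) auto
  then show "int_prime P" using P by (simp add: int_prime_def)
qed

lemma fin_places_int_prime: "Fin_place P \<in> fin_places \<longleftrightarrow> int_prime P"
  by (auto simp: fin_places_def int_prime_def)

lemma residue_norm_idx: "residue_norm P = idx ZK P"
proof -
  have "carrier ((integer_ring :: 'a ring) Quot P) = cosets ZK P"
    unfolding FactRing_def A_RCOSETS_def' a_r_coset_def' cosets_def by (auto simp: add.commute image_iff)
  then show ?thesis by (simp add: residue_norm_def idx_def)
qed

lemma principal_subset: "int_ideal J \<Longrightarrow> x \<in> J \<Longrightarrow> principal x \<subseteq> J"
  using int_idealD(4) by (auto simp: principal_def)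

lemma int_ideal_principal: "algebraic_int x \<Longrightarrow> int_ideal (principal x)"
  unfolding int_ideal_def using add_subgroup_principal
  by (auto simp: principal_def mult.left_commute intro!: algebraic_int_times)

lemma mem_principal: "x \<in> principal x"
  unfolding principal_def by (intro image_eqI[of _ _ 1]) auto

lemma finite_cosets_int_ideal:
  assumes "int_ideal J" "x \<in> J" "x \<noteq> 0"
  shows "finite (cosets ZK J)" "real (idx ZK J) \<le> cmod (Nm x)"
proof -
  have x: "algebraic_int x" using assms int_idealD by blast
  note fin = idx_principal_le(1)[OF x assms(3)]
  have f: "finite (cosets ZK J)" "idx ZK J \<le> idx ZK (principal x)"
    using principal_subset[OF assms(1,2)]
    by (auto intro!: finite_cosets_hom[OF int_idealD(1)[OF assms(1)] add_subgroup_principal fin, where f = "\<lambda>x. x"])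
  show "finite (cosets ZK J)" by (rule f(1))
  show "real (idx ZK J) \<le> cmod (Nm x)" using f(2) idx_principal[OF x assms(3)] by linarith
qed

lemma int_primeD:
  assumes "int_prime P"
  shows "int_ideal P" "1 \<notin> P" "algebraic_int x \<Longrightarrow> algebraic_int y \<Longrightarrow> x * y \<in> P \<Longrightarrow> x \<in> P \<or> y \<in> P"
    "finite (cosets ZK P)" "\<exists>a\<in>P. a \<noteq> 0" "0 \<in> P"
proof -
  show o: "int_ideal P" and "1 \<notin> P" "algebraic_int x \<Longrightarrow> algebraic_int y \<Longrightarrow> x * y \<in> P \<Longrightarrow> x \<in> P \<or> y \<in> P"
    using assms by (auto simp: int_prime_iff)
  show "0 \<in> P" by (rule add_subgroupD(1)[OF int_idealD(1)[OF o]])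
  then show a: "\<exists>a\<in>P. a \<noteq> 0" using assms by (auto simp: int_prime_iff)
  then show "finite (cosets ZK P)" using finite_cosets_int_ideal(1)[OF o] by blast
qed

lemma int_prime_power_notin: "int_prime P \<Longrightarrow> algebraic_int x \<Longrightarrow> x \<notin> P \<Longrightarrow> x ^ n \<notin> P"
proof (induction n)
  case 0
  then show ?case using int_primeD(2) by simp
next
  case (Suc n)
  then show ?case using int_primeD(3)[of P x "x ^ n"] algebraic_int_power[of x n] by auto
qed

lemma residue_norm_ge_2:
  assumes "int_prime P"
  shows "residue_norm P \<ge> 2"
proof -
  have "card {0, 1::'a} \<le> idx ZK P"
  proof (rule card_le_idx[OF int_idealD(1)[OF int_primeD(1)[OF assms]] int_primeD(4)[OF assms]])
    fix x y assume "x \<in> {0, 1::'a}" "y \<in> {0, 1::'a}" "x - y \<in> P"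
    then show "x = y" using int_primeD(2)[OF assms] add_subgroupD(3)[OF int_idealD(1)[OF int_primeD(1)[OF assms]], of "-1"] by auto
  qed auto
  then show ?thesis by (simp add: residue_norm_idx)
qed

text \<open>The powers of \<open>u\<close> fall into finitely many classes. This is the form in
  which finiteness of residue rings enters the arguments on primes.\<close>

lemma power_diff_mem:
  assumes "add_subgroup A" "finite (cosets ZK A)" "algebraic_int u"
  obtains i j :: nat where "i < j" "u ^ i - u ^ j \<in> A"
proof -
  define f where "f = (\<lambda>i::nat. (+) (u ^ i) ` A)"
  have "range f \<subseteq> cosets ZK A" using algebraic_int_power[OF assms(3)] by (auto simp: f_def cosets_def)
  then have "finite (range f)" using assms(2) finite_subset by blast
  then have "\<not> inj f" using finite_imageD[of f UNIV] by auto
  then obtain i j where ij: "f i = f j" "i \<noteq> j" by (auto simp: inj_def)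
  have "u ^ i - u ^ j \<in> A" using ij(1) coset_eq_iff[OF assms(1)] unfolding f_def by auto
  moreover from this have "u ^ j - u ^ i \<in> A" using add_subgroupD(3)[OF assms(1), of "u ^ i - u ^ j"] by simp
  ultimately
  show ?thesis using that ij(2) by (metis nat_neq_iff)
qed

text \<open>A finite integral domain is a field: u^i (1 - u^(j-i)) lies in \<open>P\<close> for some
  i < j, hence so does the second factor, and u^(j-i-1) is an inverse of \<open>u\<close> modulo
  \<open>P\<close>.\<close>

lemma int_prime_maximal:
  assumes P: "int_prime P" and u: "algebraic_int u" "u \<notin> P"
  obtains z where "algebraic_int z" "1 - u * z \<in> P"
proof -
  obtain i j where ij: "i < j" "u ^ i - u ^ j \<in> P"
    using power_diff_mem[OF int_idealD(1)[OF int_primeD(1)[OF P]] int_primeD(4)[OF P] u(1)] .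
  have "u ^ j = u ^ i * u ^ (j - i)" using ij(1) by (simp add: power_add[symmetric])
  then have "u ^ i * (1 - u ^ (j - i)) \<in> P" using ij(2) by (simp add: algebra_simps)
  moreover have "u ^ i \<notin> P" by (rule int_prime_power_notin[OF P u])
  ultimately have "1 - u ^ (j - i) \<in> P"
    using int_primeD(3)[OF P, of "u ^ i" "1 - u ^ (j - i)"] u(1) algebraic_int_power algebraic_int_diff by blast
  moreover have "u ^ (j - i) = u * u ^ (j - i - 1)" using ij(1) by (metis Suc_diff_1 power_Suc zero_less_diff)
  ultimately show ?thesis using that[of "u ^ (j - i - 1)"] algebraic_int_power[OF u(1)] by simp
qed

lemma int_prime_subset_eq:
  assumes "int_prime P" "int_prime Q" "P \<subseteq> Q"
  shows "P = Q"
proof (rule ccontr)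
  assume "P \<noteq> Q"
  then obtain q where q: "q \<in> Q" "q \<notin> P" using assms(3) by blast
  have qi: "algebraic_int q" using q(1) int_idealD(2)[OF int_primeD(1)[OF assms(2)]] by blast
  obtain z where z: "algebraic_int z" "1 - q * z \<in> P" using int_prime_maximal[OF assms(1) qi q(2)] .
  have "1 - q * z \<in> Q" "q * z \<in> Q" using z assms(3) int_idealD(4)[OF int_primeD(1)[OF assms(2)] q(1)] by auto
  then have "(1 - q * z) + q * z \<in> Q" by (rule add_subgroupD(4)[OF int_idealD(1)[OF int_primeD(1)[OF assms(2)]]])
  then show False using int_primeD(2)[OF assms(2)] by simp
qed

text \<open>
  Below \<open>g\<close> generates the inverse of \<open>P\<close> modulo \<open>\<O>\<close>. It is found as \<open>b / a\<close> with \<open>a \<in> P\<close>, where \<open>b\<close>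
  is a socle element of the localisation of \<open>\<O> / a\<close> at \<open>P\<close>, cleared of denominators; the existence
  of \<open>b\<close> uses only that \<open>\<O> / a\<close> is finite. That \<open>g P\<close> is not contained in \<open>P\<close> is integral closure.
\<close>

lemma prime_inverse:
  assumes P: "int_prime P"
  shows "\<exists>g p0 z p. (\<forall>x\<in>P. algebraic_int (g * x)) \<and> p0 \<in> P \<and> g * p0 \<notin> P \<and>
    algebraic_int z \<and> p \<in> P \<and> 1 = g * p0 * z + p"
proof -
  note oP = int_primeD(1)[OF P]
  note aP = int_idealD(1)[OF oP]
  obtain a where a: "a \<in> P" "a \<noteq> 0" using int_primeD(5)[OF P] by blast
  have ai: "algebraic_int a" using a int_idealD(2)[OF oP] by blast
  note fin = idx_principal_le(1)[OF ai a(2)]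
  have subP: "principal a \<subseteq> P" by (rule principal_subset[OF oP a(1)])
  note oa = int_ideal_principal[OF ai]
  have "P \<subseteq> ZK" using int_idealD(2)[OF oP] by auto
  from cosets_reps[OF add_subgroup_principal fin this]
  obtain F where F: "finite F" "F \<subseteq> P" and F3: "\<forall>x\<in>P. \<exists>p\<in>F. x - p \<in> principal a"
    by (elim exE conjE)
  \<comment> \<open>Multiplying by some \<open>s\<close> outside \<open>P\<close> expresses
    vanishing in the localisation. Thus \<open>b\<close> is nonzero there and killed by each member
    of \<open>G\<close>; the induction enlarges \<open>G\<close> by one element.\<close>
  have bG: "\<exists>b. algebraic_int b \<and> (\<forall>s. algebraic_int s \<longrightarrow> s \<notin> P \<longrightarrow> s * b \<notin> principal a) \<and>
      (\<forall>p\<in>G. \<exists>s. algebraic_int s \<and> s \<notin> P \<and> s * (p * b) \<in> principal a)" if "finite G" "G \<subseteq> P" for G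
    using that
  proof (induction G)
    case empty
    show ?case using subP by (intro exI[of _ 1]) auto
  next
    case (insert p G)
    have "G \<subseteq> P" using insert.prems by simp
    from insert.IH[OF this] obtain b where b1: "algebraic_int b"
      and b2: "\<forall>s. algebraic_int s \<longrightarrow> s \<notin> P \<longrightarrow> s * b \<notin> principal a"
      and b3: "\<forall>p\<in>G. \<exists>s. algebraic_int s \<and> s \<notin> P \<and> s * (p * b) \<in> principal a"
      by (elim exE conjE)
    note b = b1 b2[rule_format] b3[rule_format]
    have pP: "p \<in> P" and pi: "algebraic_int p" using insert.prems int_idealD(2)[OF oP] by auto
    \<comment> \<open>\<open>Q n\<close> says that p^n b vanishes locally. Two powers p^i and p^j
      agree modulo \<open>a\<close>, and 1 - p^(j-i) lies outside \<open>P\<close>, so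
      \<open>Q i\<close> holds. For the least n, p^(n-1) b is still nonzero locally and is killed by
      \<open>p\<close>; it stays killed by \<open>G\<close>, being a multiple of
      \<open>b\<close>.\<close>
    define Q where "Q = (\<lambda>n. \<exists>s. algebraic_int s \<and> s \<notin> P \<and> s * (p ^ n * b) \<in> principal a)"
    obtain i j where ij: "i < j" "p ^ i - p ^ j \<in> principal a"
      using power_diff_mem[OF add_subgroup_principal fin pi] .
    have "p ^ (j - i) = p * p ^ (j - i - 1)" using ij(1) by (metis Suc_diff_1 power_Suc zero_less_diff)
    then have pji: "p ^ (j - i) \<in> P" using int_idealD(4)[OF oP pP algebraic_int_power[OF pi]] by simp
    have "1 - p ^ (j - i) \<notin> P"
    proof
      assume "1 - p ^ (j - i) \<in> P"
      from add_subgroupD(4)[OF aP this pji] show False using int_primeD(2)[OF P] by simp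
    qed
    moreover have "p ^ j = p ^ i * p ^ (j - i)" using ij(1) by (simp add: power_add[symmetric])
    then have e: "(1 - p ^ (j - i)) * (p ^ i * b) = (p ^ i - p ^ j) * b" by (simp add: algebra_simps)
    have "(1 - p ^ (j - i)) * (p ^ i * b) \<in> principal a" unfolding e by (rule int_idealD(4)[OF oa ij(2) b(1)])
    moreover have "algebraic_int (1 - p ^ (j - i))" by (intro algebraic_int_diff algebraic_int_power pi) auto
    ultimately have "Q i" unfolding Q_def by blast
    define n where "n = (LEAST n. Q n)"
    have Qn: "Q n" unfolding n_def by (rule LeastI[of Q i, OF \<open>Q i\<close>])
    have n0: "n \<noteq> 0"
    proof
      assume "n = 0"
      then have "Q 0" using Qn by simp
      then show False using b(2) unfolding Q_def by auto
    qed
    define b' where "b' = p ^ (n - 1) * b"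
    have b'i: "algebraic_int b'" unfolding b'_def by (intro algebraic_int_times algebraic_int_power pi b)
    have "\<not> Q (n - 1)" using n0 not_less_Least[of "n - 1" Q] by (simp add: n_def)
    then have b'2: "s * b' \<notin> principal a" if "algebraic_int s" "s \<notin> P" for s
      using that unfolding Q_def b'_def by blast
    have pb: "p * b' = p ^ n * b" using n0 unfolding b'_def by (cases n) auto
    have b'p: "\<exists>s. algebraic_int s \<and> s \<notin> P \<and> s * (p * b') \<in> principal a"
      using Qn unfolding Q_def pb .
    have b'G: "\<exists>s. algebraic_int s \<and> s \<notin> P \<and> s * (q * b') \<in> principal a" if qG: "q \<in> G" for q
    proof -
      obtain s where s: "algebraic_int s" "s \<notin> P" "s * (q * b) \<in> principal a" using b(3)[OF qG] by blast
      have e: "s * (q * b') = p ^ (n - 1) * (s * (q * b))" by (simp add: b'_def mult_ac)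
      have "s * (q * b') \<in> principal a"
        unfolding e by (rule int_idealD(3)[OF oa s(3) algebraic_int_power[OF pi]])
      then show ?thesis using s by blast
    qed
    show ?case using b'i b'2 b'p b'G by blast
  qed
  from bG[OF F(1,2)] obtain b where b1: "algebraic_int b"
    and b2: "\<forall>s. algebraic_int s \<longrightarrow> s \<notin> P \<longrightarrow> s * b \<notin> principal a"
    and b3: "\<forall>p\<in>F. \<exists>s. algebraic_int s \<and> s \<notin> P \<and> s * (p * b) \<in> principal a"
    by (elim exE conjE)
  note b = b1 b2[rule_format]
  from bchoice[OF b3] obtain s where s': "\<forall>p\<in>F. algebraic_int (s p) \<and> s p \<notin> P \<and> s p * (p * b) \<in> principal a"
    by (elim exE)
  note s = s'[rule_format]
  \<comment> \<open>One element outside \<open>P\<close> that is a denominator for all of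
    \<open>F\<close>, so that t b P lies in the ideal of \<open>a\<close>.\<close>
  define t where "t = (\<Prod>p\<in>F. s p)"
  have ti: "algebraic_int t" unfolding t_def using s by (intro algebraic_int_prod) blast
  have "(\<Prod>p\<in>G. s p) \<notin> P" if "G \<subseteq> F" for G
    using finite_subset[OF that F(1)] that
  proof (induction G)
    case (insert q G)
    have "algebraic_int (\<Prod>p\<in>G. s p)" using s insert.prems by (intro algebraic_int_prod) blast
    then show ?case using insert s int_primeD(3)[OF P, of "s q" "\<Prod>p\<in>G. s p"] by auto
  qed (use int_primeD(2)[OF P] in simp)
  then have tP: "t \<notin> P" unfolding t_def by blast
  define g where "g = t * b / a"
  have gP: "algebraic_int (g * x)" if x: "x \<in> P" for x
  proof -
    obtain q where q: "q \<in> F" "x - q \<in> principal a" using F3 x by blast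
    have "t = (\<Prod>p\<in>F - {q}. s p) * s q" unfolding t_def using prod.remove[OF F(1) q(1)] by (simp add: mult.commute)
    then have e: "t * (q * b) = (\<Prod>p\<in>F - {q}. s p) * (s q * (q * b))" by (simp add: mult.assoc)
    have "algebraic_int (\<Prod>p\<in>F - {q}. s p)" using s by (intro algebraic_int_prod) blast
    then have "t * (q * b) \<in> principal a" unfolding e using int_idealD(3)[OF oa] s[OF q(1)] by blast
    moreover have "(x - q) * (t * b) \<in> principal a" by (rule int_idealD(4)[OF oa q(2) algebraic_int_times[OF ti b(1)]])
    ultimately have "t * (q * b) + (x - q) * (t * b) \<in> principal a" by (rule add_subgroupD(4)[OF add_subgroup_principal])
    then have "x * (t * b) \<in> principal a" by (simp add: algebra_simps)
    then obtain y where "algebraic_int y" "x * (t * b) = a * y" by (auto simp: principal_def)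
    then show ?thesis using a(2) by (simp add: g_def field_simps)
  qed
  have gni: "\<not> algebraic_int g"
  proof
    assume "algebraic_int g"
    then have "t * b \<in> principal a" unfolding principal_def using a(2) by (intro image_eqI[of _ _ g]) (auto simp: g_def)
    then show False using b(2)[OF ti tP] by simp
  qed
  have "\<exists>p0\<in>P. g * p0 \<notin> P"
  proof (rule ccontr)
    assume "\<not> ?thesis"
    then have gPP: "g * x \<in> P" if "x \<in> P" for x using that by blast
    \<comment> \<open>Finitely many generators of \<open>P\<close> as a Z-module: representatives
      modulo \<open>a\<close> together with a Z-basis of a O. If \<open>g\<close> mapped
      \<open>P\<close> into itself, it would be integral by
      \<open>algebraic_int_eigenvector\<close>.\<close>
    define V where "V = insert a (F \<union> range (\<lambda>j. a * int_basis j))"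
    have span: "x \<in> zmod.span V" if x: "x \<in> P" for x
    proof -
      obtain q where q: "q \<in> F" "x - q \<in> principal a" using F3 x by blast
      obtain y where y: "algebraic_int y" "x - q = a * y" using q(2) by (auto simp: principal_def)
      obtain c where "y = (\<Sum>j\<in>UNIV. of_int (c j) * int_basis j)"
        using zbasis_int_basis y(1) unfolding zbasis_def by blast
      then have "x - q = (\<Sum>j\<in>UNIV. of_int (c j) * (a * int_basis j))" using y(2) by (simp add: sum_distrib_left mult.left_commute)
      moreover have "(\<Sum>j\<in>UNIV. of_int (c j) * (a * int_basis j)) \<in> zmod.span V"
        by (intro zmod.span_sum zmod.span_scale zmod.span_base) (auto simp: V_def)
      moreover have "q \<in> zmod.span V" using q(1) by (intro zmod.span_base) (auto simp: V_def)
      ultimately have "q + (x - q) \<in> zmod.span V" using zmod.span_add by metis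
      then show ?thesis by simp
    qed
    have "algebraic_int g"
    proof (rule algebraic_int_eigenvector)
      show "finite V" using F(1) by (simp add: V_def)
      show "a \<in> V" "a \<noteq> 0" using a by (auto simp: V_def)
      have "V \<subseteq> P" using a F(2) int_idealD(4)[OF oP a(1) algebraic_int_basis] by (auto simp: V_def)
      then show "g * v \<in> zmod.span V" if "v \<in> V" for v using that gPP span by blast
    qed
    then show False using gni by blast
  qed
  then obtain p0 where p0: "p0 \<in> P" "g * p0 \<notin> P" by blast
  obtain z where z: "algebraic_int z" "1 - g * p0 * z \<in> P" using int_prime_maximal[OF P gP[OF p0(1)] p0(2)] .
  have "1 = g * p0 * z + (1 - g * p0 * z)" by (metis add.commute diff_add_cancel)
  then show ?thesis using gP p0 z by (intro exI[of _ g] exI[of _ p0] exI[of _ z] exI[of _ "1 - g * p0 * z"]) simp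
qed

end

section \<open>Valuations\<close>

context numfield
begin

abbreviation ppow :: "'a set \<Rightarrow> nat \<Rightarrow> 'a set" where
  "ppow P n \<equiv> P [^]\<^bsub>ideals_set (integer_ring :: 'a ring)\<^esub> n"

lemma one_ideals_set [simp]: "\<one>\<^bsub>ideals_set (integer_ring :: 'a ring)\<^esub> = ZK"
  by (simp add: ideals_set_def)

lemma ppow_0: "ppow P 0 = ZK"
  by (simp add: nat_pow_def ideals_set_def)

lemma ppow_Suc: "ppow P (Suc n) = ppow P n \<cdot>\<^bsub>integer_ring\<^esub> P"
  by (simp add: nat_pow_def ideals_set_def)

lemma int_ideal_ppow:
  assumes "int_ideal P"
  shows "int_ideal (ppow P n)"
proof (induction n)
  case 0
  show ?case unfolding ppow_0 int_ideal_def using add_subgroup_ZK by (auto intro: algebraic_int_times)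
next
  case (Suc n)
  interpret R: cring "integer_ring :: 'a ring" by (rule cring_integer_ring)
  show ?case unfolding ppow_Suc using R.ideal_prod_is_ideal Suc assms by (simp add: ideal_iff_int_ideal)
qed

lemma ppow_Suc_mult: "x \<in> ppow P n \<Longrightarrow> y \<in> P \<Longrightarrow> x * y \<in> ppow P (Suc n)"
  unfolding ppow_Suc using ideal_prod.prod[of x "ppow P n" y P "integer_ring :: 'a ring"] by simp

lemma power_mem_ppow: "x \<in> P \<Longrightarrow> x ^ n \<in> ppow P n"
proof (induction n)
  case (Suc n)
  then show ?case using ppow_Suc_mult[of "x ^ n" P n x] by (simp add: mult.commute)
qed (simp add: ppow_0)

text \<open>\<open>uval g P x n\<close> says that \<open>x\<close> has valuation exactly \<open>n\<close> at \<open>P\<close>, where \<open>g\<close> inverts \<open>P\<close>.\<close>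

definition uval :: "'a \<Rightarrow> 'a set \<Rightarrow> 'a \<Rightarrow> nat \<Rightarrow> bool" where
  "uval g P x n \<longleftrightarrow> (\<forall>i\<le>n. algebraic_int (g ^ i * x)) \<and> g ^ n * x \<notin> P"

section \<open>Powers of a prime described by an element g that inverts it\<close>

context
  fixes P g p0 z p
  assumes P: "int_prime P" and gP: "\<And>x. x \<in> P \<Longrightarrow> algebraic_int (g * x)" and p0: "p0 \<in> P" "g * p0 \<notin> P"
    and z: "algebraic_int z" and p: "p \<in> P" and one: "1 = g * p0 * z + p"
begin

text \<open>If g y is integral, then p0 (g y) = (g p0) y lies in \<open>P\<close>, and g p0 does
  not.\<close>

lemma mem_P_iff:
  assumes "algebraic_int y"
  shows "y \<in> P \<longleftrightarrow> algebraic_int (g * y)"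
proof
  assume "algebraic_int (g * y)"
  then have "p0 * (g * y) \<in> P" using int_idealD(4)[OF int_primeD(1)[OF P] p0(1)] by blast
  then have "(g * p0) * y \<in> P" by (simp add: mult_ac)
  then show "y \<in> P" using int_primeD(3)[OF P gP[OF p0(1)] assms] p0(2) by blast
qed (rule gP)

text \<open>Replaces products of ideals by integrality conditions. For the step to n + 1, x = (g x)
  (p0 z) + x p, where both x and g x lie in the n-th power. All exponents i \<le> n are imposed
  because \<open>g\<close> may vanish at other primes, so that integrality of g^n x alone would not
  control x.\<close>

lemma ppow_eq: "ppow P n = {x. \<forall>i\<le>n. algebraic_int (g ^ i * x)}"
proof (induction n)
  case 0
  show ?case by (simp add: ppow_0)
next
  case (Suc n)
  show ?case
  proof (intro equalityI subsetI)
    fix x assume "x \<in> ppow P (Suc n)"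
    then have "x \<in> ppow P n \<cdot>\<^bsub>integer_ring\<^esub> P" by (simp only: ppow_Suc)
    then show "x \<in> {x. \<forall>i\<le>Suc n. algebraic_int (g ^ i * x)}"
    proof (induction rule: ideal_prod.induct)
      case (prod a b)
      have "algebraic_int (g ^ i * (a * b))" if "i \<le> Suc n" for i
      proof (cases i)
        case 0
        have "algebraic_int a" "algebraic_int b"
          using prod int_idealD(2)[OF int_ideal_ppow[OF int_primeD(1)[OF P]]] int_idealD(2)[OF int_primeD(1)[OF P]] by auto
        then show ?thesis using 0 by (simp add: algebraic_int_times)
      next
        case (Suc k)
        have "algebraic_int (g ^ k * a)" using prod(1) that Suc Suc.IH by simp
        moreover have "algebraic_int (g * b)" by (rule gP[OF prod(2)])
        ultimately have "algebraic_int ((g ^ k * a) * (g * b))" by (rule algebraic_int_times)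
        then show ?thesis by (simp add: Suc mult_ac)
      qed
      then show ?case by simp
    next
      case (sum a b)
      then show ?case by (auto simp: distrib_left intro: algebraic_int_plus)
    qed
  next
    fix x assume x: "x \<in> {x. \<forall>i\<le>Suc n. algebraic_int (g ^ i * x)}"
    then have "x \<in> ppow P n" using Suc.IH by auto
    moreover have "g * x \<in> ppow P n"
    proof -
      have "algebraic_int (g ^ i * (g * x))" if "i \<le> n" for i
        using x that by (auto dest!: spec[of _ "Suc i"] simp: mult.left_commute mult.assoc)
      then show ?thesis unfolding Suc.IH by simp
    qed
    moreover have "p0 * z \<in> P" by (rule int_idealD(4)[OF int_primeD(1)[OF P] p0(1) z])
    ultimately have "(g * x) * (p0 * z) + x * p \<in> ppow P (Suc n)"
      using p ppow_Suc_mult add_subgroupD(4)[OF int_idealD(1)[OF int_ideal_ppow[OF int_primeD(1)[OF P]]]] by blast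
    moreover have "(g * x) * (p0 * z) + x * p = x * (g * p0 * z + p)" by (simp add: algebra_simps)
    ultimately show "x \<in> ppow P (Suc n)" using one by simp
  qed
qed

lemma ppow_antimono: "m \<le> n \<Longrightarrow> ppow P n \<subseteq> ppow P m"
  by (auto simp: ppow_eq)

lemma uval_mem_iff:
  assumes "uval g P x n"
  shows "x \<in> ppow P m \<longleftrightarrow> m \<le> n"
proof
  assume x: "x \<in> ppow P m"
  show "m \<le> n"
  proof (rule ccontr)
    assume "\<not> m \<le> n"
    then have "algebraic_int (g ^ Suc n * x)" using x unfolding ppow_eq by (auto dest: spec[of _ "Suc n"])
    then have "algebraic_int (g * (g ^ n * x))" by (simp add: mult.assoc)
    moreover have "algebraic_int (g ^ n * x)" using assms by (simp add: uval_def)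
    ultimately have "g ^ n * x \<in> P" using mem_P_iff by blast
    then show False using assms by (simp add: uval_def)
  qed
qed (use assms in \<open>auto simp: uval_def ppow_eq\<close>)

lemma integer_valuation_uval:
  assumes "uval g P x n"
  shows "integer_valuation P x = n"
  unfolding integer_valuation_def by (rule Greatest_equality) (simp_all add: uval_mem_iff[OF assms])

lemma uval_times:
  assumes x: "uval g P x m" and y: "uval g P y n"
  shows "uval g P (x * y) (m + n)"
proof -
  have eq: "g ^ (i + j) * (x * y) = (g ^ i * x) * (g ^ j * y)" for i j by (simp add: power_add mult_ac)
  have "algebraic_int (g ^ k * (x * y))" if k: "k \<le> m + n" for k
  proof -
    define i where "i = min k m"
    have "i \<le> m" "k - i \<le> n" "k = i + (k - i)" using k by (auto simp: i_def)
    then have "algebraic_int (g ^ i * x)" "algebraic_int (g ^ (k - i) * y)" using x y by (auto simp: uval_def)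
    then have "algebraic_int (g ^ (i + (k - i)) * (x * y))" unfolding eq by (rule algebraic_int_times)
    then show ?thesis using \<open>k = i + (k - i)\<close> by simp
  qed
  moreover have "g ^ (m + n) * (x * y) \<notin> P"
    unfolding eq using int_primeD(3)[OF P, of "g ^ m * x" "g ^ n * y"] x y by (auto simp: uval_def)
  ultimately show ?thesis by (simp add: uval_def)
qed

text \<open>Multiplication by w p0^n embeds O / P into the quotient of two successive intersections,
  \<open>w\<close> being an element of \<open>M\<close> outside \<open>P\<close>. Each power of
  \<open>P\<close> therefore contributes at least a factor \<open>residue_norm P\<close>.\<close>

lemma idx_ppow_step:
  assumes M: "int_ideal M" and w: "w \<in> M" "w \<notin> P" and fin: "finite (cosets ZK (M \<inter> ppow P n))"
  shows "idx ZK M * residue_norm P ^ n \<le> idx ZK (M \<inter> ppow P n)"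
  using fin
proof (induction n)
  case 0
  have "M \<inter> ppow P 0 = M" using M by (auto simp: ppow_0 int_ideal_def)
  then show ?case by simp
next
  case (Suc n)
  let ?A = "M \<inter> ppow P (Suc n)" and ?B = "M \<inter> ppow P n"
  have add: "add_subgroup (M \<inter> ppow P k)" for k
    using int_idealD(1)[OF M] int_idealD(1)[OF int_ideal_ppow[OF int_primeD(1)[OF P]]] by (auto simp: add_subgroup_def)
  have AB: "?A \<subseteq> ?B" using ppow_antimono[of n "Suc n"] by auto
  have BZ: "?B \<subseteq> ZK" using M by (auto simp: int_ideal_def)
  note tw = idx_tower[OF add add add_subgroup_ZK AB BZ Suc.prems]
  have wi: "algebraic_int w" using w int_idealD(2)[OF M] by blast
  define f where "f = (\<lambda>y. y * (w * p0 ^ n))"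
  have "idx ZK P \<le> idx ?B ?A"
  proof (rule finite_cosets_hom(2)[OF int_idealD(1)[OF int_primeD(1)[OF P]] add tw(3), where f = f])
    fix y assume "y \<in> ZK"
    then have y: "algebraic_int y" by simp
    have "y * w * p0 ^ n \<in> M"
      using int_idealD(3)[OF M w(1) y] int_idealD(4)[OF M] algebraic_int_power int_idealD(2)[OF int_primeD(1)[OF P] p0(1)] by blast
    moreover have "(y * w) * p0 ^ n \<in> ppow P n"
      using int_idealD(3)[OF int_ideal_ppow[OF int_primeD(1)[OF P]] power_mem_ppow[OF p0(1)]] algebraic_int_times[OF y wi] by blast
    ultimately show "f y \<in> ?B" by (simp add: f_def mult.assoc)
  next
    fix x y assume "x \<in> ZK" "y \<in> ZK" "f x - f y \<in> ?A"
    then have xy: "algebraic_int (x - y)" "f (x - y) \<in> ppow P (Suc n)"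
      by (auto simp: f_def algebra_simps intro: algebraic_int_diff)
    then have "algebraic_int (g ^ Suc n * f (x - y))" unfolding ppow_eq by blast
    \<comment> \<open>Of the n + 1 factors \<open>g\<close>, n combine with p0^n to an element
      outside \<open>P\<close>; the last one tests membership in \<open>P\<close> through
      \<open>mem_P_iff\<close>.\<close>
    moreover have e: "g ^ Suc n * f (x - y) = g * ((x - y) * (w * (g * p0) ^ n))"
      by (simp add: f_def power_mult_distrib mult_ac)
    ultimately have gi: "algebraic_int (g * ((x - y) * (w * (g * p0) ^ n)))" by (simp only:)
    have gp: "algebraic_int ((g * p0) ^ n)" by (rule algebraic_int_power[OF gP[OF p0(1)]])
    have wg: "algebraic_int (w * (g * p0) ^ n)" by (rule algebraic_int_times[OF wi gp])
    have "(x - y) * (w * (g * p0) ^ n) \<in> P"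
      using mem_P_iff[OF algebraic_int_times[OF xy(1) wg]] gi by blast
    moreover have "(g * p0) ^ n \<notin> P" by (rule int_prime_power_notin[OF P gP[OF p0(1)] p0(2)])
    then have "w * (g * p0) ^ n \<notin> P" using int_primeD(3)[OF P wi gp] w(2) by blast
    ultimately show "x - y \<in> P" using int_primeD(3)[OF P xy(1) wg] by blast
  qed
  then have "idx ZK ?B * residue_norm P \<le> idx ZK ?A" using tw(1) by (simp add: residue_norm_idx)
  moreover have "idx ZK M * residue_norm P ^ n \<le> idx ZK ?B" by (rule Suc.IH[OF tw(2)])
  ultimately have "idx ZK M * residue_norm P ^ n * residue_norm P \<le> idx ZK ?A"
    by (meson le_trans mult_le_mono1)
  then show ?case by (simp add: mult_ac)
qed

text \<open>A nonzero \<open>x\<close> in all powers of \<open>P\<close> would give them indices at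
  least 2^n, although all these indices are bounded by |Nm x|.\<close>

lemma uval_exists:
  assumes x: "algebraic_int x" "x \<noteq> 0"
  shows "\<exists>n. uval g P x n"
proof -
  have "\<exists>n. x \<notin> ppow P n"
  proof (rule ccontr)
    assume "\<not> ?thesis"
    then have mem: "x \<in> ppow P n" for n by blast
    have ZKo: "int_ideal ZK" using add_subgroup_ZK by (auto simp: int_ideal_def intro: algebraic_int_times)
    have "2 ^ n \<le> nat \<lfloor>cmod (Nm x)\<rfloor>" for n
    proof -
      note f = finite_cosets_int_ideal[OF int_ideal_ppow[OF int_primeD(1)[OF P]] mem x(2), of n]
      have inter: "ZK \<inter> ppow P n = ppow P n" using int_ideal_ppow[OF int_primeD(1)[OF P], of n] by (auto simp: int_ideal_def)
      have "idx ZK ZK * residue_norm P ^ n \<le> idx ZK (ppow P n)"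
        using idx_ppow_step[OF ZKo, of 1 n] int_primeD(2)[OF P] f(1) unfolding inter by simp
      moreover have "idx ZK ZK \<ge> 1"
      proof -
        have "principal 1 = ZK" by (auto simp: principal_def)
        then have "finite (cosets ZK ZK)" using idx_principal_le(1)[of 1] by simp
        then show ?thesis using idx_pos[of ZK ZK] by fastforce
      qed
      ultimately have "residue_norm P ^ n \<le> idx ZK (ppow P n)"
        by (metis (no_types, lifting) le_trans mult_le_mono1 mult_1)
      moreover have "2 ^ n \<le> residue_norm P ^ n" by (rule power_mono[OF residue_norm_ge_2[OF P]]) simp
      ultimately have "2 ^ n \<le> idx ZK (ppow P n)" by linarith
      moreover have "idx ZK (ppow P n) \<le> nat \<lfloor>cmod (Nm x)\<rfloor>" using f(2) by (simp add: le_nat_floor)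
      ultimately show ?thesis by linarith
    qed
    then show False using less_exp[of "nat \<lfloor>cmod (Nm x)\<rfloor>"] by (meson not_le)
  qed
  then obtain n where n: "x \<notin> ppow P n" "\<And>m. m < n \<Longrightarrow> x \<in> ppow P m"
    using exists_least_iff[of "\<lambda>n. x \<notin> ppow P n"] by blast
  then obtain m where m: "n = Suc m" using x(1) by (cases n) (auto simp: ppow_0)
  have xm: "x \<in> ppow P m" using n m by simp
  have "g ^ m * x \<notin> P"
  proof
    assume "g ^ m * x \<in> P"
    then have "algebraic_int (g ^ n * x)" using gP by (simp add: m mult.assoc)
    then have "x \<in> ppow P n" using xm unfolding ppow_eq m by (auto simp: le_Suc_eq)
    then show False using n by blast
  qed
  then show ?thesis using xm unfolding uval_def ppow_eq by blast
qed

end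

lemma integer_valuation_mult:
  assumes P: "int_prime P" and x: "algebraic_int x" "x \<noteq> 0" and y: "algebraic_int y" "y \<noteq> 0"
  shows "integer_valuation P (x * y) = integer_valuation P x + integer_valuation P y"
proof -
  from prime_inverse[OF P] obtain g p0 z p where g1: "\<forall>x\<in>P. algebraic_int (g * x)"
    and g2: "p0 \<in> P" "g * p0 \<notin> P" "algebraic_int z" "p \<in> P" "1 = g * p0 * z + p"
    by (elim exE conjE)
  note g = bspec[OF g1] g2
  obtain m where m: "uval g P x m" using uval_exists[OF P g x] by blast
  obtain n where n: "uval g P y n" using uval_exists[OF P g y] by blast
  show ?thesis
    using integer_valuation_uval[OF P g m] integer_valuation_uval[OF P g n]
      integer_valuation_uval[OF P g uval_times[OF P g m n]] by simp
qed

lemma mem_ppow_iff: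
  assumes P: "int_prime P" and x: "algebraic_int x" "x \<noteq> 0"
  shows "x \<in> ppow P n \<longleftrightarrow> n \<le> integer_valuation P x"
proof -
  from prime_inverse[OF P] obtain g p0 z p where g1: "\<forall>x\<in>P. algebraic_int (g * x)"
    and g2: "p0 \<in> P" "g * p0 \<notin> P" "algebraic_int z" "p \<in> P" "1 = g * p0 * z + p"
    by (elim exE conjE)
  note g = bspec[OF g1] g2
  obtain m where m: "uval g P x m" using uval_exists[OF P g x] by blast
  show ?thesis using integer_valuation_uval[OF P g m] uval_mem_iff[OF P g m] by simp
qed

text \<open>The witness is g^n y with n the common valuation: it lies outside \<open>P\<close>, and
  its product with x / y is g^n x.\<close>

lemma equal_valuation_denominator:
  assumes P: "int_prime P" and x: "algebraic_int x" "x \<noteq> 0" and y: "algebraic_int y" "y \<noteq> 0"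
    and eq: "integer_valuation P x = integer_valuation P y"
  shows "\<exists>w. algebraic_int w \<and> w \<notin> P \<and> algebraic_int (w * (x / y))"
proof -
  from prime_inverse[OF P] obtain g p0 z p where g1: "\<forall>x\<in>P. algebraic_int (g * x)"
    and g2: "p0 \<in> P" "g * p0 \<notin> P" "algebraic_int z" "p \<in> P" "1 = g * p0 * z + p"
    by (elim exE conjE)
  note g = bspec[OF g1] g2
  obtain m where m: "uval g P x m" using uval_exists[OF P g x] by blast
  obtain n where n: "uval g P y n" using uval_exists[OF P g y] by blast
  have "m = n" using integer_valuation_uval[OF P g m] integer_valuation_uval[OF P g n] eq by simp
  then show ?thesis using m n y by (intro exI[of _ "g ^ n * y"]) (auto simp: uval_def)
qed

lemma ppow_1:
  assumes P: "int_prime P"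
  shows "ppow P 1 = P"
proof -
  from prime_inverse[OF P] obtain g p0 z p where g1: "\<forall>x\<in>P. algebraic_int (g * x)"
    and g2: "p0 \<in> P" "g * p0 \<notin> P" "algebraic_int z" "p \<in> P" "1 = g * p0 * z + p"
    by (elim exE conjE)
  note g = bspec[OF g1] g2
  have "ppow P 1 = {x. \<forall>i\<le>1. algebraic_int (g ^ i * x)}" by (rule ppow_eq[OF P g])
  then have "x \<in> ppow P 1 \<longleftrightarrow> algebraic_int x \<and> algebraic_int (g * x)" for x
    by (simp only:) (auto simp: le_Suc_eq)
  moreover have "x \<in> P \<longleftrightarrow> algebraic_int x \<and> algebraic_int (g * x)" for x
    using mem_P_iff[OF P g, of x] int_idealD(2)[OF int_primeD(1)[OF P], of x] by blast
  ultimately have "x \<in> ppow P 1 \<longleftrightarrow> x \<in> P" for x by (simp only:)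
  then show ?thesis by (rule Set.set_eqI)
qed

lemma integer_valuation_eq_0_iff:
  assumes P: "int_prime P" and x: "algebraic_int x" "x \<noteq> 0"
  shows "integer_valuation P x = 0 \<longleftrightarrow> x \<notin> P"
  using mem_ppow_iff[OF assms, of 1] ppow_1[OF P] by auto

lemma idx_ppow_Int:
  assumes P: "int_prime P" and M: "int_ideal M" "\<not> M \<subseteq> P" and fin: "finite (cosets ZK (M \<inter> ppow P n))"
  shows "idx ZK M * residue_norm P ^ n \<le> idx ZK (M \<inter> ppow P n)"
proof -
  from prime_inverse[OF P] obtain g p0 z p where g1: "\<forall>x\<in>P. algebraic_int (g * x)"
    and g2: "p0 \<in> P" "g * p0 \<notin> P" "algebraic_int z" "p \<in> P" "1 = g * p0 * z + p"
    by (elim exE conjE)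
  note g = bspec[OF g1] g2
  obtain w where "w \<in> M" "w \<notin> P" using M by blast
  then show ?thesis using idx_ppow_step[OF P g M(1) _ _ fin] by blast
qed

text \<open>The half of the Chinese remainder theorem that is needed. Primes are added one at a
  time; for a new prime Q, \<open>idx_ppow_Int\<close> applies once the intersection formed so far
  is not contained in Q.\<close>

lemma prod_residue_norm_le:
  assumes T: "finite T" "\<And>P. P \<in> T \<Longrightarrow> int_prime P" and J: "int_ideal J" "y \<in> J" "y \<noteq> 0"
    and sub: "\<And>P. P \<in> T \<Longrightarrow> J \<subseteq> ppow P (k P)"
  shows "(\<Prod>P\<in>T. residue_norm P ^ k P) \<le> idx ZK J"
proof -
  \<comment> \<open>The factor \<open>ZK\<close> makes the intersection over no primes the whole
    ring.\<close>
  define M where "M = (\<lambda>T. ZK \<inter> (\<Inter>P\<in>T. ppow P (k P)))"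
  have ZKo: "int_ideal ZK" using add_subgroup_ZK by (auto simp: int_ideal_def intro: algebraic_int_times)
  have Mo: "int_ideal (M U)" if "U \<subseteq> T" for U
  proof -
    have o: "int_ideal (ppow P (k P))" if "P \<in> U" for P using that \<open>U \<subseteq> T\<close> int_ideal_ppow int_primeD(1) T(2) by blast
    show ?thesis unfolding int_ideal_def M_def add_subgroup_def
      using add_subgroupD(1,2)[OF int_idealD(1)[OF o]] add_subgroupD(1,2)[OF int_idealD(1)[OF ZKo]] int_idealD(3)[OF o] int_idealD(3)[OF ZKo] by simp
  qed
  have y: "y \<in> M U" if "U \<subseteq> T" for U using J sub that int_idealD(2)[OF J(1)] by (auto simp: M_def)
  have "(\<Prod>P\<in>U. residue_norm P ^ k P) \<le> idx ZK (M U)" if "U \<subseteq> T" for U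
    using finite_subset[OF that T(1)] that
  proof (induction U)
    case empty
    have "idx ZK (M {}) > 0" using finite_cosets_int_ideal(1)[OF Mo y J(3), of "{}"] by (intro idx_pos) auto
    then show ?case by simp
  next
    case (insert Q U)
    have Q: "int_prime Q" using insert.prems T(2) by blast
    have "\<exists>w. w \<in> P \<and> w \<notin> Q" if "P \<in> U" for P
    proof -
      have "P \<noteq> Q" using insert.hyps that by blast
      moreover have "int_prime P" using that insert.prems T(2) by blast
      ultimately show ?thesis using int_prime_subset_eq[OF _ Q] by blast
    qed
    then have "\<forall>P\<in>U. \<exists>w. w \<in> P \<and> w \<notin> Q" by blast
    from bchoice[OF this] obtain w where w: "\<forall>P\<in>U. w P \<in> P \<and> w P \<notin> Q" by blast
    have wi: "algebraic_int (w P)" if "P \<in> U" for P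
    proof -
      have "int_prime P" using that insert.prems T(2) by blast
      moreover have "w P \<in> P" using w that by blast
      ultimately show ?thesis using int_idealD(2)[OF int_primeD(1)] by blast
    qed
    \<comment> \<open>Lies in every prescribed power but not in \<open>Q\<close>: each
      \<open>w P\<close> is in P and outside \<open>Q\<close>, as distinct primes do not contain one
      another.\<close>
    define v where "v = (\<Prod>P\<in>U. w P ^ k P)"
    have vi: "algebraic_int (\<Prod>P\<in>V. w P ^ k P)" if "V \<subseteq> U" for V
      using that wi by (intro algebraic_int_prod algebraic_int_power) blast
    have "v \<in> M U"
    proof -
      have "v \<in> ppow P (k P)" if PU: "P \<in> U" for P
      proof -
        have "v = (\<Prod>P\<in>U - {P}. w P ^ k P) * w P ^ k P"
          unfolding v_def using prod.remove[OF insert.hyps(1) PU] by (simp add: mult.commute)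
        moreover have "int_prime P" using PU insert.prems T(2) by blast
        moreover have "w P ^ k P \<in> ppow P (k P)" by (rule power_mem_ppow) (use w PU in blast)
        ultimately show ?thesis using int_idealD(3)[OF int_ideal_ppow[OF int_primeD(1)]] vi[of "U - {P}"] by auto
      qed
      then show ?thesis using vi[of U] by (auto simp: M_def v_def)
    qed
    moreover have "v \<notin> Q"
    proof -
      have "(\<Prod>P\<in>V. w P ^ k P) \<notin> Q" if "V \<subseteq> U" for V
        using finite_subset[OF that insert.hyps(1)] that
      proof (induction V)
        case empty
        then show ?case using int_primeD(2)[OF Q] by simp
      next
        case (insert P V)
        have "w P ^ k P \<notin> Q" using int_prime_power_notin[OF Q wi] w insert.prems by blast
        moreover have "algebraic_int (w P ^ k P)" using wi insert.prems by (intro algebraic_int_power) blast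
        ultimately show ?case using insert int_primeD(3)[OF Q, of "w P ^ k P" "\<Prod>P\<in>V. w P ^ k P"] vi[of V] by auto
      qed
      then show ?thesis unfolding v_def by blast
    qed
    ultimately have "\<not> M U \<subseteq> Q" by blast
    moreover have MI: "M (insert Q U) = M U \<inter> ppow Q (k Q)" by (auto simp: M_def)
    moreover have "finite (cosets ZK (M U \<inter> ppow Q (k Q)))"
      using finite_cosets_int_ideal(1)[OF Mo y J(3), of "insert Q U"] insert.prems MI by simp
    ultimately have "idx ZK (M U) * residue_norm Q ^ k Q \<le> idx ZK (M (insert Q U))"
      using idx_ppow_Int[OF Q Mo] insert.prems by simp
    moreover have "(\<Prod>P\<in>U. residue_norm P ^ k P) \<le> idx ZK (M U)" using insert by blast
    ultimately have "(\<Prod>P\<in>U. residue_norm P ^ k P) * residue_norm Q ^ k Q \<le> idx ZK (M (insert Q U))"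
      by (meson le_trans mult_le_mono1)
    then show ?case using insert.hyps by (simp add: mult.commute)
  qed
  then have "(\<Prod>P\<in>T. residue_norm P ^ k P) \<le> idx ZK (M T)" by blast
  also have "idx ZK (M T) \<le> idx ZK J"
  proof (rule finite_cosets_hom(2)[OF int_idealD(1)[OF Mo] int_idealD(1)[OF J(1)] finite_cosets_int_ideal(1)[OF J], where f = "\<lambda>x. x"])
    show "x - y \<in> M T" if "x - y \<in> J" for x y
      using that sub int_idealD(2)[OF J(1)] by (auto simp: M_def)
  qed auto
  finally show ?thesis .
qed

text \<open>For n the index of x O, n distinct primes containing \<open>x\<close> would give 2^n
  \<le> n.\<close>

lemma finite_primes_containing:
  assumes "algebraic_int x" "x \<noteq> 0"
  shows "finite {P. int_prime P \<and> x \<in> P}"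
proof (rule ccontr)
  assume "infinite {P. int_prime P \<and> x \<in> P}"
  define n where "n = idx ZK (principal x)"
  obtain T where T: "T \<subseteq> {P. int_prime P \<and> x \<in> P}" "finite T" "card T = n"
    using infinite_arbitrarily_large \<open>infinite _\<close> by blast
  have "(\<Prod>P\<in>T. residue_norm P ^ 1) \<le> idx ZK (principal x)"
  proof (rule prod_residue_norm_le[OF T(2) _ int_ideal_principal[OF assms(1)] mem_principal assms(2)])
    show "int_prime P" if "P \<in> T" for P using T(1) that by blast
    show "principal x \<subseteq> ppow P 1" if "P \<in> T" for P
      using T(1) that principal_subset[OF int_primeD(1)] ppow_1 by blast
  qed
  moreover have "(\<Prod>P\<in>T. 2) \<le> (\<Prod>P\<in>T. residue_norm P ^ 1)"
    using T(1) residue_norm_ge_2 by (intro prod_mono) auto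
  ultimately have "2 ^ n \<le> n" using T by (simp add: n_def)
  then show False using less_exp[of n] by linarith
qed

end

section \<open>Places and heights\<close>

context numfield
begin

lemma fraction_exists:
  fixes a :: 'a
  assumes "a \<noteq> 0"
  shows "\<exists>x y. algebraic_int x \<and> x \<noteq> 0 \<and> algebraic_int y \<and> y \<noteq> 0 \<and> a = x / y"
proof -
  obtain k :: int where k: "k > 0" "algebraic_int (of_int k * a)"
    using algebraic_scaled_algebraic_int[OF algebraic] .
  then show ?thesis using assms by (intro exI[of _ "of_int k * a"] exI[of _ "of_int k"]) auto
qed

text \<open>The definite description is legitimate: two fractions for the same element are compared
  by cross multiplication and additivity of \<open>integer_valuation\<close>.\<close>

lemma valuation_quotient:
  assumes P: "int_prime P" and x: "algebraic_int x" "x \<noteq> 0" and y: "algebraic_int y" "y \<noteq> 0"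
  shows "valuation P (x / y) = int (integer_valuation P x) - int (integer_valuation P y)"
  unfolding valuation_def
proof (rule the_equality)
  show "\<exists>x' y'. algebraic_int x' \<and> x' \<noteq> 0 \<and> algebraic_int y' \<and> y' \<noteq> 0 \<and> x / y = x' / y' \<and>
      int (integer_valuation P x) - int (integer_valuation P y) = int (integer_valuation P x') - int (integer_valuation P y')"
    using x y by blast
  fix k assume "\<exists>x' y'. algebraic_int x' \<and> x' \<noteq> 0 \<and> algebraic_int y' \<and> y' \<noteq> 0 \<and> x / y = x' / y' \<and>
      k = int (integer_valuation P x') - int (integer_valuation P y')"
  then obtain x' y' where x': "algebraic_int x'" "x' \<noteq> 0" and y': "algebraic_int y'" "y' \<noteq> 0"
    and e: "x / y = x' / y'" "k = int (integer_valuation P x') - int (integer_valuation P y')"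
    by (elim exE conjE)
  have "x * y' = x' * y" using e(1) y(2) y'(2) by (simp add: frac_eq_eq)
  then have "integer_valuation P x + integer_valuation P y' = integer_valuation P x' + integer_valuation P y"
    using integer_valuation_mult[OF P x y'] integer_valuation_mult[OF P x' y] by simp
  then show "k = int (integer_valuation P x) - int (integer_valuation P y)" using e(2) by linarith
qed

lemma place_abs_Fin:
  assumes P: "int_prime P" and x: "algebraic_int x" "x \<noteq> 0" and y: "algebraic_int y" "y \<noteq> 0"
  shows "place_abs (Fin_place P) (x / y) =
    real (residue_norm P) powi (int (integer_valuation P y) - int (integer_valuation P x))"
  using x(2) y(2) by (simp add: valuation_quotient[OF assms])

lemma place_abs_Fin_mult:
  assumes P: "int_prime P" and "a \<noteq> 0" "b \<noteq> 0"
  shows "place_abs (Fin_place P) (a * b) = place_abs (Fin_place P) a * place_abs (Fin_place P) b"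
proof -
  obtain x y where x: "algebraic_int x" "x \<noteq> 0" "algebraic_int y" "y \<noteq> 0" "a = x / y"
    using fraction_exists[OF assms(2)] by blast
  obtain z w where z: "algebraic_int z" "z \<noteq> 0" "algebraic_int w" "w \<noteq> 0" "b = z / w"
    using fraction_exists[OF assms(3)] by blast
  have N: "real (residue_norm P) \<noteq> 0" using residue_norm_ge_2[OF P] by simp
  let ?v = "\<lambda>x. int (integer_valuation P x)"
  have xz: "algebraic_int (x * z)" "x * z \<noteq> 0" "algebraic_int (y * w)" "y * w \<noteq> 0"
    using x z by (auto intro: algebraic_int_times)
  have e: "?v (y * w) - ?v (x * z) = (?v y - ?v x) + (?v w - ?v z)"
    using integer_valuation_mult[OF P x(1,2) z(1,2)] integer_valuation_mult[OF P x(3,4) z(3,4)] by simp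
  have "a * b = (x * z) / (y * w)" by (simp add: x z)
  then have "place_abs (Fin_place P) (a * b) = real (residue_norm P) powi ((?v y - ?v x) + (?v w - ?v z))"
    by (simp only: place_abs_Fin[OF P xz] e)
  also have "\<dots> = real (residue_norm P) powi (?v y - ?v x) * real (residue_norm P) powi (?v w - ?v z)"
    by (rule power_int_add[OF disjI1[OF N]])
  finally show ?thesis by (simp only: x(5) z(5) place_abs_Fin[OF P x(1-4)] place_abs_Fin[OF P z(1-4)])
qed

lemma place_abs_Fin_eq_1_iff:
  assumes P: "int_prime P" and x: "algebraic_int x" "x \<noteq> 0" and y: "algebraic_int y" "y \<noteq> 0"
  shows "place_abs (Fin_place P) (x / y) = 1 \<longleftrightarrow> integer_valuation P x = integer_valuation P y"
proof -
  have N: "real (residue_norm P) > 1" using residue_norm_ge_2[OF P] by simp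
  have *: "real (residue_norm P) powi k = 1 \<longleftrightarrow> k = 0" for k
  proof (cases k "0 :: int" rule: linorder_cases)
    case less
    then show ?thesis using power_int_strict_increasing[OF less N] by simp
  next
    case greater
    then show ?thesis using power_int_strict_increasing[OF greater N] by simp
  qed simp
  show ?thesis unfolding place_abs_Fin[OF assms] * by linarith
qed

definition arch_place_of :: "'a emb \<Rightarrow> 'a place" where
  "arch_place_of \<sigma> = Arch_place {emb \<sigma>, emb (conj_emb \<sigma>)}"

lemma arch_places_eq_range: "(arch_places :: 'a place set) = range arch_place_of"
proof -
  have r: "(real_places :: 'a place set) = arch_place_of ` {\<sigma>. conj_emb \<sigma> = \<sigma>}"
  proof -
    have "cnj \<circ> emb \<sigma> = emb \<sigma> \<longleftrightarrow> conj_emb \<sigma> = \<sigma>" for \<sigma> :: "'a emb" by (metis emb_conj_emb emb_inject)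
    then show ?thesis unfolding real_places_def arch_place_of_def range_emb[symmetric] by (auto simp: image_iff)
  qed
  have c: "(complex_places :: 'a place set) = arch_place_of ` {\<sigma>. conj_emb \<sigma> \<noteq> \<sigma>}"
  proof -
    have "cnj \<circ> emb \<sigma> \<noteq> emb \<sigma> \<longleftrightarrow> conj_emb \<sigma> \<noteq> \<sigma>" for \<sigma> :: "'a emb" by (metis emb_conj_emb emb_inject)
    then show ?thesis unfolding complex_places_def arch_place_of_def range_emb[symmetric] by (auto simp: emb_conj_emb image_iff)
  qed
  show ?thesis unfolding arch_places_def r c by blast
qed

lemma arch_place_of_eq_iff: "arch_place_of \<sigma> = arch_place_of \<tau> \<longleftrightarrow> \<tau> = \<sigma> \<or> \<tau> = conj_emb \<sigma>"
proof
  assume "arch_place_of \<sigma> = arch_place_of \<tau>"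
  then have "emb \<tau> \<in> {emb \<sigma>, emb (conj_emb \<sigma>)}" by (auto simp: arch_place_of_def)
  then show "\<tau> = \<sigma> \<or> \<tau> = conj_emb \<sigma>" by (auto simp: emb_inject)
qed (auto simp: arch_place_of_def)

text \<open>At a complex place the absolute value is a square, and max 1 (r^2) = (max 1 r)^2
  distributes over the two conjugate embeddings. The infinite part of the height can thus be treated
  embedding by embedding.\<close>

lemma prod_arch_places:
  "(\<Prod>v\<in>arch_places. max 1 (place_abs v a)) = (\<Prod>\<sigma>\<in>UNIV. max 1 (cmod (emb (\<sigma> :: 'a emb) a)))"
proof -
  have "(\<Prod>\<sigma>\<in>UNIV. max 1 (cmod (emb (\<sigma> :: 'a emb) a)))
      = (\<Prod>v\<in>range arch_place_of. \<Prod>\<sigma>\<in>{\<sigma> \<in> UNIV. arch_place_of \<sigma> = v}. max 1 (cmod (emb \<sigma> a)))"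
    by (rule prod.group[symmetric]) auto
  also have "\<dots> = (\<Prod>v\<in>range arch_place_of. max 1 (place_abs v a))"
  proof (rule prod.cong)
    fix v assume "v \<in> range (arch_place_of :: 'a emb \<Rightarrow> _)"
    then obtain \<tau> :: "'a emb" where v: "v = arch_place_of \<tau>" by auto
    have s: "{\<sigma> \<in> UNIV. arch_place_of \<sigma> = v} = {\<tau>, conj_emb \<tau>}" by (auto simp: v arch_place_of_eq_iff)
    show "(\<Prod>\<sigma>\<in>{\<sigma> \<in> UNIV. arch_place_of \<sigma> = v}. max 1 (cmod (emb \<sigma> a))) = max 1 (place_abs v a)"
    proof (cases "conj_emb \<tau> = \<tau>")
      case True
      then show ?thesis unfolding s by (simp add: v arch_place_of_def)
    next
      case False
      then have "emb \<tau> \<noteq> emb (conj_emb \<tau>)" by (simp add: emb_inject)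
      then have pa: "place_abs v a = (cmod (emb \<tau> a))\<^sup>2" by (simp add: v arch_place_of_def power2_eq_square)
      have "max 1 (r * r) = max 1 r * max 1 r" if "r \<ge> 0" for r :: real
      proof (cases "r \<ge> 1")
        case True
        then have "r * r \<ge> 1" using mult_mono[of 1 r 1 r] by simp
        then show ?thesis using True by simp
      next
        case False
        then have "r * r \<le> 1" using that by (intro mult_le_one) auto
        then show ?thesis using False by simp
      qed
      then show ?thesis unfolding s pa using False by (simp add: power2_eq_square)
    qed
  qed simp
  finally show ?thesis by (simp add: arch_places_eq_range)
qed

text \<open>A prime not containing \<open>c\<close> contributes 1, so the height reduces to a finite
  product. Truncated subtraction of natural numbers takes over the role of the maximum with 1 at
  finite places.\<close>

lemma height_quotient:
  assumes b: "algebraic_int b" "b \<noteq> 0" and c: "algebraic_int c" "c \<noteq> 0"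
    and T: "finite T" "\<And>P. P \<in> T \<Longrightarrow> int_prime P" "\<And>P. int_prime P \<Longrightarrow> c \<in> P \<Longrightarrow> P \<in> T"
  shows "height (b / c) = (\<Prod>\<sigma>\<in>UNIV. max 1 (cmod (emb (\<sigma> :: 'a emb) (b / c)))) *
    real (\<Prod>P\<in>T. residue_norm P ^ (integer_valuation P c - integer_valuation P b))"
proof -
  define f where "f = (\<lambda>v. max 1 (place_abs v (b / c)))"
  have fin: "f (Fin_place P) = real (residue_norm P) ^ (integer_valuation P c - integer_valuation P b)" if P: "int_prime P" for P
  proof -
    define e where "e = int (integer_valuation P c) - int (integer_valuation P b)"
    have f: "f (Fin_place P) = max 1 (real (residue_norm P) powi e)"
      unfolding f_def place_abs_Fin[OF P b c] e_def ..
    show ?thesis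
    proof (cases "integer_valuation P b \<le> integer_valuation P c")
      case True
      then have "e = int (integer_valuation P c - integer_valuation P b)" by (simp add: e_def)
      moreover have "real (residue_norm P) ^ (integer_valuation P c - integer_valuation P b) \<ge> 1"
        using residue_norm_ge_2[OF P] by (intro one_le_power) simp
      ultimately show ?thesis unfolding f by (simp add: power_int_of_nat)
    next
      case False
      then have "real (residue_norm P) powi e \<le> real (residue_norm P) powi 0"
        using residue_norm_ge_2[OF P] by (intro power_int_increasing) (auto simp: e_def)
      then show ?thesis unfolding f using False by simp
    qed
  qed
  have f1: "f (Fin_place P) = 1" if P: "int_prime P" "P \<notin> T" for P
  proof -
    have "integer_valuation P c = 0" using integer_valuation_eq_0_iff[OF P(1) c] T(3) P by blast
    then show ?thesis using fin[OF P(1)] by simp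
  qed
  define X where "X = arch_places \<union> Fin_place ` T"
  have "height (b / c) = (\<Prod>v\<in>{v \<in> places. f v \<noteq> 1}. f v)" by (simp add: height_def f_def)
  also have "\<dots> = (\<Prod>v\<in>X. f v)"
  proof (rule prod.mono_neutral_left)
    show "finite X" using T(1) by (simp add: X_def arch_places_eq_range)
    show "{v \<in> places. f v \<noteq> 1} \<subseteq> X"
    proof
      fix v assume v: "v \<in> {v \<in> places. f v \<noteq> 1}"
      then consider "v \<in> arch_places" | "v \<in> fin_places" by (auto simp: places_def)
      then show "v \<in> X"
      proof cases
        case 2
        then obtain P where "v = Fin_place P" "int_prime P" using fin_places_int_prime by (auto simp: fin_places_def)
        then show ?thesis using f1 v by (auto simp: X_def)
      qed (simp add: X_def)
    qed
    have "X \<subseteq> places" using T(2) fin_places_int_prime by (auto simp: X_def places_def)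
    then show "\<forall>v\<in>X - {v \<in> places. f v \<noteq> 1}. f v = 1" by auto
  qed
  also have "\<dots> = (\<Prod>v\<in>arch_places. f v) * (\<Prod>v\<in>Fin_place ` T. f v)"
    unfolding X_def by (rule prod.union_disjoint) (use T(1) in \<open>auto simp: arch_places_eq_range arch_place_of_def\<close>)
  also have "(\<Prod>v\<in>Fin_place ` T. f v) = (\<Prod>P\<in>T. f (Fin_place P))"
    by (subst prod.reindex) (auto simp: inj_on_def)
  also have "\<dots> = real (\<Prod>P\<in>T. residue_norm P ^ (integer_valuation P c - integer_valuation P b))"
    using fin T(2) by simp
  finally show ?thesis by (simp add: f_def prod_arch_places)
qed

lemma height_integer:
  assumes "algebraic_int a" "a \<noteq> 0"
  shows "height a = (\<Prod>\<sigma>\<in>UNIV. max 1 (cmod (emb (\<sigma> :: 'a emb) a)))"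
  using height_quotient[OF assms, of 1 "{}"] int_primeD(2) by auto

text \<open>The ideal quotient (J : y) inside O. For \<open>y\<close> in O it is the annihilator of
  the class of \<open>y\<close> modulo \<open>J\<close>; for fractional \<open>y\<close> and J = O
  it is the ideal of denominators of \<open>y\<close>.\<close>

definition colon :: "'a \<Rightarrow> 'a set \<Rightarrow> 'a set" where
  "colon y J = {z. algebraic_int z \<and> z * y \<in> J}"

lemma int_ideal_colon:
  assumes "int_ideal J"
  shows "int_ideal (colon y J)"
  unfolding int_ideal_def add_subgroup_def
proof (intro conjI ballI)
  show "0 \<in> colon y J" using add_subgroupD(1)[OF int_idealD(1)[OF assms]] by (simp add: colon_def)
  show "colon y J \<subseteq> ZK" by (auto simp: colon_def)
  fix u v assume u: "u \<in> colon y J"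
  { assume "v \<in> colon y J"
    then show "u - v \<in> colon y J"
      using u add_subgroupD(2)[OF int_idealD(1)[OF assms], of "u * y" "v * y"]
      by (auto simp: colon_def left_diff_distrib intro: algebraic_int_diff) }
  { assume "v \<in> ZK"
    then show "v * u \<in> colon y J"
      using u int_idealD(3)[OF assms, of "u * y" v] by (auto simp: colon_def mult.assoc intro: algebraic_int_times) }
qed

text \<open>Multiplication by \<open>b\<close> embeds O / (c O : b) into I / c O, and [O:I] [I:c O]
  = |Nm c|.\<close>

lemma idx_colon:
  assumes I: "int_ideal I" "b \<in> I" "c \<in> I" "c \<noteq> 0"
  shows "real (idx ZK I) * real (idx ZK (colon b (principal c))) \<le> cmod (Nm c)"
    "c \<in> colon b (principal c)"
proof -
  have ci: "algebraic_int c" and bi: "algebraic_int b" using I int_idealD by blast+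
  note fin = idx_principal_le(1)[OF ci I(4)]
  have IZ: "I \<subseteq> ZK" using I(1) by (simp add: int_ideal_def)
  note tw = idx_tower[OF add_subgroup_principal int_idealD(1)[OF I(1)] add_subgroup_ZK principal_subset[OF I(1,3)] IZ fin]
  have "idx ZK (colon b (principal c)) \<le> idx I (principal c)"
  proof (rule finite_cosets_hom(2)[OF int_idealD(1)[OF int_ideal_colon[OF int_ideal_principal[OF ci]]] add_subgroup_principal tw(3), where f = "\<lambda>y. y * b"])
    show "y * b \<in> I" if "y \<in> ZK" for y using that int_idealD(3)[OF I(1,2)] by simp
    show "x - y \<in> colon b (principal c)" if "x \<in> ZK" "y \<in> ZK" "x * b - y * b \<in> principal c" for x y
      using that by (auto simp: colon_def left_diff_distrib intro: algebraic_int_diff)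
  qed
  then have "idx ZK I * idx ZK (colon b (principal c)) \<le> idx ZK (principal c)"
    unfolding tw(1) by (rule mult_le_mono2)
  then show "real (idx ZK I) * real (idx ZK (colon b (principal c))) \<le> cmod (Nm c)"
    unfolding idx_principal[OF ci I(4), symmetric] of_nat_mult[symmetric] of_nat_le_iff .
  show "c \<in> colon b (principal c)" using ci bi by (auto simp: colon_def principal_def)
qed

lemma cmod_Nm: "cmod (Nm x) = (\<Prod>\<sigma>\<in>UNIV. cmod (emb (\<sigma> :: 'a emb) x))"
  by (simp add: Nm_def prod_norm)

lemma prod_max_quotient:
  assumes "c \<noteq> 0"
  shows "(\<Prod>\<sigma>\<in>UNIV. max 1 (cmod (emb (\<sigma> :: 'a emb) (b / c)))) * cmod (Nm c)
    = (\<Prod>\<sigma>\<in>UNIV. max (cmod (emb (\<sigma> :: 'a emb) b)) (cmod (emb \<sigma> c)))"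
  unfolding cmod_Nm prod.distrib[symmetric]
proof (rule prod.cong)
  fix \<sigma> :: "'a emb"
  have c0: "cmod (emb \<sigma> c) > 0" using assms by simp
  have "emb \<sigma> b = emb \<sigma> (b / c) * emb \<sigma> c" using assms by (simp add: emb.hom_mult[symmetric])
  then have "cmod (emb \<sigma> b) = cmod (emb \<sigma> (b / c)) * cmod (emb \<sigma> c)" by (simp add: norm_mult)
  then show "max 1 (cmod (emb \<sigma> (b / c))) * cmod (emb \<sigma> c) = max (cmod (emb \<sigma> b)) (cmod (emb \<sigma> c))"
    using c0 by (simp add: max_mult_distrib_right max.commute)
qed simp

text \<open>The finite part of the height of b / c is at most the index of the denominator ideal C =
  (c O : b), because \<open>C\<close> lies in P^(k P) for each prime P containing \<open>c\<close>.
  Combined with [O:I] [O:C] \<le> |Nm c|, this replaces a formula for the norm of the ideal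
  generated by b and c.\<close>

lemma height_le:
  assumes I: "int_ideal I" "b \<in> I" "c \<in> I" "b \<noteq> 0" "c \<noteq> 0"
  shows "height (b / c) * real (idx ZK I) \<le> (\<Prod>\<sigma>\<in>UNIV. max (cmod (emb (\<sigma> :: 'a emb) b)) (cmod (emb \<sigma> c)))"
proof -
  have ci: "algebraic_int c" and bi: "algebraic_int b" using I int_idealD by blast+
  define C where "C = colon b (principal c)"
  define T where "T = {P. int_prime P \<and> c \<in> P}"
  define k where "k = (\<lambda>P. integer_valuation P c - integer_valuation P b)"
  note col = idx_colon[OF I(1-3,5)]
  have T: "finite T" "\<And>P. P \<in> T \<Longrightarrow> int_prime P" "\<And>P. int_prime P \<Longrightarrow> c \<in> P \<Longrightarrow> P \<in> T"
    using finite_primes_containing[OF ci I(5)] by (auto simp: T_def)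
  have sub: "C \<subseteq> ppow P (k P)" if "P \<in> T" for P
  proof
    fix y assume y: "y \<in> C"
    have P: "int_prime P" using that T(2) by blast
    show "y \<in> ppow P (k P)"
    proof (cases "y = 0")
      case True
      then show ?thesis using add_subgroupD(1)[OF int_idealD(1)[OF int_ideal_ppow[OF int_primeD(1)[OF P]]]] by simp
    next
      case False
      have yi: "algebraic_int y" using y by (simp add: C_def colon_def)
      obtain w where w: "algebraic_int w" "y * b = c * w" using y by (auto simp: C_def colon_def principal_def)
      have w0: "w \<noteq> 0" using w(2) False I(4) by auto
      have "integer_valuation P y + integer_valuation P b = integer_valuation P c + integer_valuation P w"
        using integer_valuation_mult[OF P yi False bi I(4)] integer_valuation_mult[OF P ci I(5) w(1) w0] w(2) by simp
      then show ?thesis unfolding mem_ppow_iff[OF P yi False] k_def by linarith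
    qed
  qed
  have "(\<Prod>P\<in>T. residue_norm P ^ k P) \<le> idx ZK C"
    unfolding C_def
    by (rule prod_residue_norm_le[OF T(1,2) int_ideal_colon[OF int_ideal_principal[OF ci]] col(2) I(5)])
      (use sub in \<open>auto simp: C_def\<close>)
  then have le: "real (\<Prod>P\<in>T. residue_norm P ^ k P) \<le> real (idx ZK C)" by (simp only: of_nat_le_iff)
  define H where "H = (\<Prod>\<sigma>\<in>UNIV. max 1 (cmod (emb (\<sigma> :: 'a emb) (b / c))))"
  have H: "H \<ge> 0" unfolding H_def by (intro prod_nonneg) auto
  have hq: "height (b / c) = H * real (\<Prod>P\<in>T. residue_norm P ^ k P)"
    unfolding H_def k_def
    by (rule height_quotient[OF bi I(4) ci I(5) T(1)], rule T(2), assumption, rule T(3), assumption+)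
  have "height (b / c) * real (idx ZK I) = H * (real (idx ZK I) * real (\<Prod>P\<in>T. residue_norm P ^ k P))"
    by (simp only: hq mult_ac)
  also have "\<dots> \<le> H * (real (idx ZK I) * real (idx ZK C))"
    using H le by (intro mult_left_mono) auto
  also have "\<dots> \<le> H * cmod (Nm c)"
    using H col(1) by (intro mult_left_mono) (auto simp: C_def)
  also have "\<dots> = (\<Prod>\<sigma>\<in>UNIV. max (cmod (emb (\<sigma> :: 'a emb) b)) (cmod (emb \<sigma> c)))"
    unfolding H_def by (rule prod_max_quotient[OF I(5)])
  finally show ?thesis .
qed

end

section \<open>Generators of the group of S-units\<close>

context numfield
begin

definition mult_subgroup :: "'a set \<Rightarrow> bool" where
  "mult_subgroup G \<longleftrightarrow> 0 \<notin> G \<and> 1 \<in> G \<and> (\<forall>x\<in>G. \<forall>y\<in>G. x * y \<in> G \<and> x / y \<in> G)"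

lemma inv_mult_of_class_ring:
  assumes "(x :: 'a) \<noteq> 0"
  shows "inv\<^bsub>mult_of class_ring\<^esub> x = inverse x"
proof -
  interpret G: group "mult_of (class_ring :: 'a ring)"
    by (rule field.field_mult_group[OF class_field])
  show ?thesis by (rule G.inv_equality) (use assms in auto)
qed

lemma generate_subset_mult_subgroup:
  assumes "mult_subgroup G" "H \<subseteq> G"
  shows "generate (mult_of class_ring) H \<subseteq> G"
proof
  fix x assume "x \<in> generate (mult_of class_ring) H"
  then show "x \<in> G"
  proof (induction rule: generate.induct)
    case (inv h)
    then have h: "h \<in> G" using assms(2) by blast
    then have h0: "h \<noteq> 0" using assms(1) by (auto simp: mult_subgroup_def)
    have "1 / h \<in> G" using h assms(1) by (simp add: mult_subgroup_def)
    then show ?case unfolding inv_mult_of_class_ring[OF h0] by (simp add: inverse_eq_divide)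
  qed (use assms in \<open>auto simp: mult_subgroup_def\<close>)
qed

lemma mult_subgroup_generate:
  assumes "0 \<notin> H"
  shows "mult_subgroup (generate (mult_of class_ring) (H :: 'a set))"
proof -
  interpret G: group "mult_of (class_ring :: 'a ring)"
    by (rule field.field_mult_group[OF class_field])
  have H: "H \<subseteq> carrier (mult_of (class_ring :: 'a ring))" using assms by auto
  let ?G = "generate (mult_of class_ring) H"
  have nz: "0 \<notin> ?G" using G.generate_incl[OF H] by auto
  have "1 \<in> ?G" using generate.one[of "mult_of (class_ring :: 'a ring)" H] by simp
  moreover have mul: "x * y \<in> ?G" if "x \<in> ?G" "y \<in> ?G" for x y
    using generate.eng[OF that] by simp
  moreover have "x / y \<in> ?G" if xy: "x \<in> ?G" "y \<in> ?G" for x y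
  proof -
    have "y \<noteq> 0" using nz xy(2) by blast
    then have "inverse y \<in> ?G" using G.generate_m_inv_closed[OF H xy(2)] inv_mult_of_class_ring by simp
    then show ?thesis using mul[OF xy(1)] by (simp add: divide_inverse)
  qed
  ultimately show ?thesis using nz by (simp add: mult_subgroup_def)
qed

definition degree_root :: "real \<Rightarrow> real" where
  "degree_root r = root CARD('a emb) r"

lemma degree_root:
  assumes "r > 0"
  shows "degree_root r > 0" "(\<Prod>\<sigma>\<in>(UNIV :: 'a emb set). degree_root r) = r"
  using assms by (auto simp: degree_root_def)

definition admissible :: "'a set \<Rightarrow> ('a emb \<Rightarrow> real) \<Rightarrow> bool" where
  "admissible J t \<longleftrightarrow> (\<forall>\<sigma>. t \<sigma> > 0) \<and> (\<forall>\<sigma>. t (conj_emb \<sigma>) = t \<sigma>) \<and> (\<Prod>\<sigma>\<in>UNIV. t \<sigma>) = mink_const * real (idx ZK J)"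

definition small_elems :: "'a set \<Rightarrow> ('a emb \<Rightarrow> real) \<Rightarrow> 'a set" where
  "small_elems J t = {x \<in> J. x \<noteq> 0 \<and> (\<forall>\<sigma>. cmod (emb \<sigma> x) \<le> t \<sigma>)}"

lemma small_elems_nonempty:
  assumes "int_ideal J" "x \<in> J" "x \<noteq> 0" "admissible J t"
  shows "small_elems J t \<noteq> {}"
  using minkowski[OF int_idealD(1)[OF assms(1)] finite_cosets_int_ideal(1)[OF assms(1-3)], of t] assms(4)
  by (auto simp: admissible_def small_elems_def)

lemma cmod_Nm_le:
  assumes "x \<in> small_elems J t"
  shows "cmod (Nm x) \<le> (\<Prod>\<sigma>\<in>UNIV. t \<sigma>)"
  unfolding cmod_Nm by (rule prod_mono) (use assms in \<open>auto simp: small_elems_def\<close>)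

lemma int_ideal_ZK: "int_ideal ZK"
  using add_subgroup_ZK by (auto simp: int_ideal_def intro: algebraic_int_times)

lemma idx_ZK_ZK: "idx ZK ZK = 1"
proof -
  have "cosets ZK ZK = {ZK}"
  proof -
    have "(+) b ` ZK = ZK" if "b \<in> ZK" for b
    proof -
      have "(+) b ` ZK = (+) 0 ` ZK" using that by (subst coset_eq_iff[OF add_subgroup_ZK]) simp
      then show ?thesis by simp
    qed
    then show ?thesis unfolding cosets_def by auto
  qed
  then show ?thesis by (simp add: idx_def)
qed

text \<open>Minkowski's theorem for O itself gives a nonzero integer of norm at most
  \<open>mink_const\<close>, and its norm is at least 1.\<close>

lemma mink_const_ge_1: "mink_const \<ge> 1"
proof -
  have a: "admissible ZK (\<lambda>_. degree_root mink_const)"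
    using degree_root[OF mink_const_pos] by (simp add: admissible_def idx_ZK_ZK)
  obtain x where x: "x \<in> small_elems ZK (\<lambda>_. degree_root mink_const)" using small_elems_nonempty[OF int_ideal_ZK, of 1, OF _ _ a] by auto
  then have "1 \<le> cmod (Nm x)" by (intro Nm_ge_1) (auto simp: small_elems_def)
  also have "\<dots> \<le> mink_const" using cmod_Nm_le[OF x] degree_root(2)[OF mink_const_pos] by simp
  finally show ?thesis .
qed

end

locale sunit_setting = numfield K for K :: "'a::field_char_0 itself" +
  fixes S :: "'a place set"
  assumes finS: "finite S" and Spl: "S \<subseteq> places" and archS: "arch_places \<subseteq> S"
    and smallS: "\<And>P. int_prime P \<Longrightarrow> real (residue_norm P) \<le> mink_const \<Longrightarrow> Fin_place P \<in> S"
begin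

abbreviation max_resnorm :: real where "max_resnorm \<equiv> real (max_residue_norm S)"

lemma residue_norm_le_max_resnorm:
  assumes "int_prime P" "Fin_place P \<in> S"
  shows "real (residue_norm P) \<le> max_resnorm"
proof -
  have P: "Fin_place P \<in> S - arch_places" using assms(2) by (auto simp: arch_places_eq_range arch_place_of_def)
  have "{residue_norm P |P. Fin_place P \<in> S - arch_places}
      \<subseteq> (\<lambda>v. case v of Fin_place P \<Rightarrow> residue_norm P | _ \<Rightarrow> 0) ` S" by force
  then have "finite {residue_norm P |P. Fin_place P \<in> S - arch_places}" using finS finite_surj by blast
  then have "residue_norm P \<le> Max {residue_norm P |P. Fin_place P \<in> S - arch_places}"
    using P by (intro Max_ge) auto
  moreover have "S \<noteq> arch_places" using P by auto
  ultimately show ?thesis by (simp add: max_residue_norm_def)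
qed

lemma max_resnorm_ge_1: "max_resnorm \<ge> 1"
proof (cases "S = arch_places")
  case True
  then show ?thesis by (simp add: max_residue_norm_def)
next
  case False
  then obtain v where v: "v \<in> S" "v \<notin> arch_places" using archS by blast
  then have "v \<in> fin_places" using Spl by (auto simp: places_def)
  then obtain P where P: "v = Fin_place P" "int_prime P" using fin_places_int_prime by (auto simp: fin_places_def)
  then have "real (residue_norm P) \<le> max_resnorm" using residue_norm_le_max_resnorm v by blast
  then show ?thesis using residue_norm_ge_2[OF P(2)] by linarith
qed

lemma S_units_iff:
  "a \<in> S_units S \<longleftrightarrow> a \<noteq> 0 \<and> (\<forall>P. int_prime P \<longrightarrow> Fin_place P \<notin> S \<longrightarrow> place_abs (Fin_place P) a = 1)"
proof -
  have "(fin_places :: 'a place set) = Fin_place ` {P. int_prime P}"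
    by (auto simp: fin_places_def int_prime_def)
  then have *: "places - S = Fin_place ` {P. int_prime P \<and> Fin_place P \<notin> S}"
    using archS by (auto simp: places_def)
  show ?thesis
    unfolding S_units_def * by (simp add: imp_conjL del: place_abs.simps)
qed

lemma S_units_integer_iff:
  assumes "algebraic_int x" "x \<noteq> 0"
  shows "x \<in> S_units S \<longleftrightarrow> (\<forall>P. int_prime P \<longrightarrow> Fin_place P \<notin> S \<longrightarrow> x \<notin> P)"
proof -
  have "place_abs (Fin_place P) x = 1 \<longleftrightarrow> x \<notin> P" if P: "int_prime P" for P
  proof -
    have "integer_valuation P 1 = 0" using integer_valuation_eq_0_iff[OF P, of 1] int_primeD(2)[OF P] by simp
    then show ?thesis
      using place_abs_Fin_eq_1_iff[OF P assms, of 1] integer_valuation_eq_0_iff[OF P assms] by (simp del: place_abs.simps)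
  qed
  then show ?thesis unfolding S_units_iff using assms by blast
qed

lemma mult_subgroup_S_units: "mult_subgroup (S_units S)"
  unfolding mult_subgroup_def
proof (intro conjI ballI)
  show "0 \<notin> S_units S" by (simp add: S_units_iff)
  show "1 \<in> S_units S" using int_primeD(2) by (subst S_units_integer_iff) auto
  fix x y assume x: "x \<in> S_units S" and y: "y \<in> S_units S"
  show "x * y \<in> S_units S"
    using x y place_abs_Fin_mult[of _ x y] unfolding S_units_iff by (simp del: place_abs.simps)
  have e: "x / y * y = x" using y by (simp add: S_units_iff)
  have "place_abs (Fin_place P) (x / y) = 1" if P: "int_prime P" "Fin_place P \<notin> S" for P
  proof -
    have "place_abs (Fin_place P) (x / y) * place_abs (Fin_place P) y = place_abs (Fin_place P) x"
      using place_abs_Fin_mult[OF P(1), of "x / y" y] x y e by (simp add: S_units_iff del: place_abs.simps)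
    moreover have "place_abs (Fin_place P) y = 1" "place_abs (Fin_place P) x = 1"
      using x y P unfolding S_units_iff by blast+
    ultimately show ?thesis by (simp only: mult_1_right)
  qed
  then show "x / y \<in> S_units S" using x y by (simp add: S_units_iff del: place_abs.simps)
qed

text \<open>Here the hypothesis that \<open>S\<close> contains all primes of norm at most \<open>d\<close> enters.\<close>

lemma small_elems_S_units:
  assumes J: "int_ideal J" and t: "admissible J t" and x: "x \<in> small_elems J t"
    and w: "\<And>P. int_prime P \<Longrightarrow> Fin_place P \<notin> S \<Longrightarrow> \<exists>w\<in>J. w \<notin> P"
  shows "x \<in> S_units S"
proof -
  have xJ: "x \<in> J" "x \<noteq> 0" using x by (auto simp: small_elems_def)
  have xi: "algebraic_int x" using int_idealD(2)[OF J xJ(1)] .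
  have "x \<notin> P" if P: "int_prime P" "Fin_place P \<notin> S" for P
  proof
    assume xP: "x \<in> P"
    obtain w where w: "w \<in> J" "w \<notin> P" using w[OF P] by blast
    have wi: "algebraic_int w" using int_idealD(2)[OF J w(1)] .
    have JZ: "J \<subseteq> ZK" using J by (simp add: int_ideal_def)
    note tw = idx_tower[OF add_subgroup_principal int_idealD(1)[OF J] add_subgroup_ZK principal_subset[OF J xJ(1)] JZ idx_principal_le(1)[OF xi xJ(2)]]
    \<comment> \<open>Multiplication by \<open>w\<close> embeds O / P into J / x O. But [J:x O] is
      at most d by the bounds on \<open>x\<close>, while the norm of \<open>P\<close> exceeds
      d.\<close>
    have "idx ZK P \<le> idx J (principal x)"
    proof (rule finite_cosets_hom(2)[OF int_idealD(1)[OF int_primeD(1)[OF P(1)]] add_subgroup_principal tw(3), where f = "\<lambda>y. y * w"])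
      show "y * w \<in> J" if "y \<in> ZK" for y using int_idealD(3)[OF J w(1)] that by simp
      fix y z assume yz: "y \<in> ZK" "z \<in> ZK" "y * w - z * w \<in> principal x"
      have "y * w - z * w \<in> P" using yz(3) principal_subset[OF int_primeD(1)[OF P(1)] xP] by blast
      then have "(y - z) * w \<in> P" by (simp add: left_diff_distrib)
      moreover have "algebraic_int (y - z)" using yz algebraic_int_diff by blast
      ultimately show "y - z \<in> P" using int_primeD(3)[OF P(1) _ wi] w(2) by blast
    qed
    moreover have "real (residue_norm P) > mink_const" using smallS[OF P(1)] P(2) by force
    ultimately have "real (idx J (principal x)) > mink_const" by (simp add: residue_norm_idx)
    moreover have "real (idx ZK J) > 0" using idx_pos[OF finite_cosets_int_ideal(1)[OF J xJ]] algebraic_int_0 by fastforce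
    ultimately have "real (idx ZK J) * mink_const < real (idx ZK J) * real (idx J (principal x))" by simp
    also have "\<dots> = cmod (Nm x)" unfolding idx_principal[OF xi xJ(2), symmetric] tw(1) by simp
    also have "\<dots> \<le> mink_const * real (idx ZK J)" using cmod_Nm_le[OF x] t by (simp add: admissible_def)
    finally show False by simp
  qed
  then show ?thesis using S_units_integer_iff[OF xi xJ(2)] by blast
qed

text \<open>The path argument is carried out for any group \<open>G\<close> that contains the
  quotients described by \<open>gen\<close>. The groups generated by the two sets in the theorem
  both qualify, but for different reasons: in the first case the quotient is itself a generator, in
  the second it is a quotient of two generators.\<close>

context
  fixes G
  assumes G: "mult_subgroup G"
    and gen: "\<And>J \<alpha> \<beta>. int_ideal J \<Longrightarrow> \<alpha> \<in> J \<Longrightarrow> \<beta> \<in> J \<Longrightarrow> \<alpha> \<in> S_units S \<Longrightarrow> \<beta> \<in> S_units S \<Longrightarrow>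
      (\<Prod>\<sigma>\<in>UNIV. max (cmod (emb (\<sigma> :: 'a emb) \<beta>)) (cmod (emb \<sigma> \<alpha>))) \<le> mink_const * max_resnorm * real (idx ZK J) \<Longrightarrow> \<beta> / \<alpha> \<in> G"
begin

lemma small_elems_pair:
  assumes J: "int_ideal J" and t: "admissible J t" and s: "\<And>P. int_prime P \<Longrightarrow> Fin_place P \<notin> S \<Longrightarrow> \<exists>w\<in>J. w \<notin> P"
    and x: "x \<in> small_elems J t" "y \<in> small_elems J t"
  shows "y / x \<in> G"
proof (rule gen[OF J])
  show "x \<in> J" "y \<in> J" using x by (auto simp: small_elems_def)
  show "x \<in> S_units S" "y \<in> S_units S" using small_elems_S_units[OF J t _ s] x by blast+
  have "(\<Prod>\<sigma>\<in>UNIV. max (cmod (emb (\<sigma> :: 'a emb) y)) (cmod (emb \<sigma> x))) \<le> (\<Prod>\<sigma>\<in>UNIV. t \<sigma>)"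
    by (rule prod_mono) (use x in \<open>auto simp: small_elems_def le_max_iff_disj\<close>)
  also have "\<dots> = mink_const * real (idx ZK J)" using t by (simp add: admissible_def)
  also have "\<dots> \<le> mink_const * max_resnorm * real (idx ZK J)"
    using max_resnorm_ge_1 mink_const_pos by (intro mult_right_mono) (auto simp: mult_le_cancel_left1)
  finally show "(\<Prod>\<sigma>\<in>UNIV. max (cmod (emb (\<sigma> :: 'a emb) y)) (cmod (emb \<sigma> x))) \<le> mink_const * max_resnorm * real (idx ZK J)" .
qed

lemma small_elems_path:
  assumes J: "int_ideal J" and t: "admissible J t" "admissible J t'" and s: "\<And>P. int_prime P \<Longrightarrow> Fin_place P \<notin> S \<Longrightarrow> \<exists>w\<in>J. w \<notin> P"
    and x: "x \<in> small_elems J t" and y: "y \<in> small_elems J t'"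
  shows "y / x \<in> G"
proof -
  \<comment> \<open>Geometric interpolation keeps the product of the bounds constant, so every
    intermediate datum is admissible for the same \<open>J\<close>.\<close>
  define r where "r = (\<lambda>u \<sigma>. t \<sigma> powr (1 - u) * t' \<sigma> powr u)"
  have tpos: "t \<sigma> > 0" "t' \<sigma> > 0" for \<sigma> using t by (auto simp: admissible_def)
  have xJ: "x \<in> J" "x \<noteq> 0" using x by (auto simp: small_elems_def)
  have idp: "mink_const * real (idx ZK J) > 0"
    using t(1) tpos(1) prod_pos[of UNIV t] by (simp add: admissible_def)
  have admissible: "admissible J (r u)" for u
  proof -
    have "(\<Prod>\<sigma>\<in>UNIV. r u \<sigma>) = (\<Prod>\<sigma>\<in>UNIV. t \<sigma>) powr (1 - u) * (\<Prod>\<sigma>\<in>UNIV. t' \<sigma>) powr u"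
      unfolding r_def prod.distrib using tpos by (simp add: prod_powr_distrib less_imp_le)
    also have "\<dots> = mink_const * real (idx ZK J)"
      using t idp by (simp add: admissible_def powr_add[symmetric])
    finally show ?thesis
      using t less_imp_neq[OF tpos(1), THEN not_sym] less_imp_neq[OF tpos(2), THEN not_sym]
      by (auto simp: admissible_def r_def)
  qed
  have r01: "r 0 = t" "r 1 = t'"
    using tpos less_imp_neq[OF tpos(1), THEN not_sym] less_imp_neq[OF tpos(2), THEN not_sym]
    by (simp_all add: r_def abs_of_pos)
  define F where "F = {z \<in> J. z \<noteq> 0 \<and> (\<forall>\<sigma>. cmod (emb \<sigma> z) \<le> max (t \<sigma>) (t' \<sigma>))}"
  have "F \<subseteq> {z. algebraic_int z \<and> (\<forall>\<sigma>. cmod (emb \<sigma> z) \<le> max (t \<sigma>) (t' \<sigma>))}"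
    using int_idealD(2)[OF J] by (auto simp: F_def)
  then have finF: "finite F"
    by (rule finite_subset) (rule finite_bounded_integers[of "\<lambda>\<sigma>. max (t \<sigma>) (t' \<sigma>)"])
  have AF: "small_elems J (r u) \<subseteq> F" if u: "u \<in> {0..1}" for u
  proof
    fix z assume z: "z \<in> small_elems J (r u)"
    have "r u \<sigma> \<le> max (t \<sigma>) (t' \<sigma>)" for \<sigma>
    proof -
      define m where "m = max (t \<sigma>) (t' \<sigma>)"
      have m: "m > 0" "t \<sigma> \<le> m" "t' \<sigma> \<le> m" using tpos by (auto simp: m_def less_max_iff_disj)
      have "r u \<sigma> \<le> m powr (1 - u) * m powr u"
        unfolding r_def using m tpos u by (intro mult_mono powr_mono2) (auto intro: less_imp_le)
      also have "\<dots> = m" using m(1) by (simp add: powr_add[symmetric])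
      finally show ?thesis by (simp add: m_def)
    qed
    then show "z \<in> F" using z by (auto simp: small_elems_def F_def intro: order_trans)
  qed
  \<comment> \<open>The parameters at which \<open>z\<close> is small form a closed set, and only
    the finitely many z in \<open>F\<close> occur; so the unions \<open>U\<close> and
    \<open>V\<close>, over z with z / x in \<open>G\<close> or not, are closed. They are disjoint
    because elements belonging to the same parameter have a quotient in \<open>G\<close>, and
    connectedness of [0,1] leaves only \<open>U\<close>.\<close>
  define C where "C = (\<lambda>z. {u \<in> {0..1}. z \<in> small_elems J (r u)})"
  have closed: "closed (C z)" if "z \<in> F" for z
  proof -
    have cont: "continuous_on UNIV (\<lambda>u. r u \<sigma>)" for \<sigma>
      unfolding r_def using tpos by (intro continuous_intros) (auto simp: less_imp_neq[THEN not_sym])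
    have "C z = {0..1} \<inter> {u. \<forall>\<sigma>. cmod (emb \<sigma> z) \<le> r u \<sigma>}"
      using that by (auto simp: C_def small_elems_def F_def)
    also have "closed \<dots>"
      by (intro closed_Int closed_atLeastAtMost closed_Collect_all closed_Collect_le continuous_on_const cont)
    finally show ?thesis .
  qed
  define U where "U = (\<Union>z\<in>{z \<in> F. z / x \<in> G}. C z)"
  define V where "V = (\<Union>z\<in>{z \<in> F. z / x \<notin> G}. C z)"
  have cU: "closed U" "closed V" unfolding U_def V_def using finF closed by (auto intro!: closed_UN)
  have cover: "{0..1} \<subseteq> U \<union> V"
  proof
    fix u :: real assume u: "u \<in> {0..1}"
    obtain z where "z \<in> small_elems J (r u)" using small_elems_nonempty[OF J xJ admissible[of u]] by blast
    then show "u \<in> U \<union> V" using AF[OF u] u by (auto simp: U_def V_def C_def)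
  qed
  have disj: "U \<inter> V = {}"
  proof (rule ccontr)
    assume "U \<inter> V \<noteq> {}"
    then obtain u z z' where z: "z / x \<in> G" "z' / x \<notin> G" "z \<in> small_elems J (r u)" "z' \<in> small_elems J (r u)"
      by (auto simp: U_def V_def C_def)
    have "z' / z \<in> G" by (rule small_elems_pair[OF J admissible s z(3,4)])
    then have "z' / z * (z / x) \<in> G" using G z(1) unfolding mult_subgroup_def by blast
    moreover have "z \<noteq> 0" using z(3) by (simp add: small_elems_def)
    ultimately show False using z(2) by simp
  qed
  have "0 \<in> U"
  proof -
    have "x \<in> F" "0 \<in> C x" using x AF[of 0] by (auto simp: C_def r01)
    moreover have "x / x \<in> G" using xJ G by (simp add: mult_subgroup_def)
    ultimately show ?thesis by (auto simp: U_def)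
  qed
  have "1 \<notin> V"
  proof
    assume "1 \<in> V"
    then have "V \<inter> {0..1} \<noteq> {}" "U \<inter> {0..1} \<noteq> {}" using \<open>0 \<in> U\<close> by auto
    moreover have "connected {0..1::real}" by simp
    ultimately show False using cU cover disj unfolding connected_closed by blast
  qed
  moreover have "y \<in> F" "1 \<in> C y" using y AF[of 1] by (auto simp: C_def r01)
  ultimately show ?thesis by (auto simp: V_def)
qed

text \<open>Induction on [O:J], replacing \<open>J\<close> by a larger ideal with one prime less.
  The integral S-unit \<open>x0\<close> in \<open>J\<close> stays fixed: it makes the index finite
  and keeps \<open>J\<close> out of all primes outside \<open>S\<close>, so that
  \<open>small_elems_S_units\<close> applies at every stage.\<close>

lemma small_elems_mem:
  assumes x0: "algebraic_int x0" "x0 \<in> S_units S"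
    and "int_ideal J" "x0 \<in> J" "admissible J t" "\<alpha> \<in> small_elems J t"
  shows "\<alpha> \<in> G"
  using assms(3-)
proof (induction "idx ZK J" arbitrary: J t \<alpha> rule: less_induct)
  case less
  note J = less.prems(1) and x0J = less.prems(2) and t = less.prems(3) and \<alpha> = less.prems(4)
  have x00: "x0 \<noteq> 0" using x0(2) by (simp add: S_units_iff)
  note finJ = finite_cosets_int_ideal(1)[OF J x0J x00]
  have s: "\<exists>w\<in>J'. w \<notin> P" if "int_prime P" "Fin_place P \<notin> S" "x0 \<in> J'" for P J'
    using S_units_integer_iff[OF x0(1) x00] x0(2) that by blast
  show ?case
  proof (cases "1 \<in> J")
    case True
    have "J = ZK" using J int_idealD(4)[OF J True] by (auto simp: int_ideal_def)
    \<comment> \<open>End of the path: for J = O, the equal bounds d^(1/n) \<ge> 1 admit the element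
      1, and \<open>small_elems_path\<close> joins the given bounds to these.\<close>
    then have a: "admissible J (\<lambda>_. degree_root mink_const)" using degree_root[OF mink_const_pos] by (simp add: admissible_def idx_ZK_ZK)
    have "degree_root mink_const \<ge> 1" using mink_const_ge_1 by (simp add: degree_root_def)
    then have "1 \<in> small_elems J (\<lambda>_. degree_root mink_const)" using True by (simp add: small_elems_def)
    then have "\<alpha> / 1 \<in> G" using small_elems_path[OF J a t s] \<alpha> x0J by blast
    then show ?thesis by simp
  next
    case False
    \<comment> \<open>Among the annihilators of nonzero classes of O / J, one of least index is
      maximal under inclusion and hence prime.\<close>
    define Y where "Y = {y. algebraic_int y \<and> y \<notin> J}"
    have "1 \<in> Y" using False by (simp add: Y_def)
    then obtain y where y: "y \<in> Y" and ymin: "\<And>z. z \<in> Y \<Longrightarrow> idx ZK (colon y J) \<le> idx ZK (colon z J)"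
      using ex_has_least_nat[of "\<lambda>y. y \<in> Y" 1 "\<lambda>y. idx ZK (colon y J)"] by blast
    have yi: "algebraic_int y" "y \<notin> J" using y by (auto simp: Y_def)
    define P where "P = colon y J"
    have oP: "int_ideal P" unfolding P_def by (rule int_ideal_colon[OF J])
    have JP: "J \<subseteq> P" using J int_idealD(4)[OF J _ yi(1)] by (auto simp: P_def colon_def int_ideal_def)
    have P: "int_prime P"
      unfolding int_prime_iff
    proof (intro conjI allI impI)
      show "int_ideal P" by (rule oP)
      show "P \<noteq> {0}" using JP x0J x00 by blast
      show "1 \<notin> P" using yi by (simp add: P_def colon_def)
      fix a b assume a: "algebraic_int a" and b: "algebraic_int b" and ab: "a * b \<in> P"
      show "a \<in> P \<or> b \<in> P"
      proof (cases "a \<in> P")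
        case False
        \<comment> \<open>The annihilator of a y contains \<open>P\<close> and the element
          \<open>b\<close>. By minimality its index is not smaller than that of \<open>P\<close>, so
          it equals \<open>P\<close> and contains \<open>b\<close> only if \<open>P\<close>
          does.\<close>
        define Q where "Q = colon (a * y) J"
        have oQ: "int_ideal Q" unfolding Q_def by (rule int_ideal_colon[OF J])
        have "a * y \<in> Y" using False a yi by (auto simp: Y_def P_def colon_def intro: algebraic_int_times)
        then have le: "idx ZK P \<le> idx ZK Q" unfolding P_def Q_def by (rule ymin)
        have PQ: "P \<subseteq> Q"
        proof
          fix z assume "z \<in> P"
          then have z: "algebraic_int z" "z * y \<in> J" by (auto simp: P_def colon_def)
          have e: "z * (a * y) = (z * y) * a" by simp
          have "z * (a * y) \<in> J" unfolding e by (rule int_idealD(4)[OF J z(2) a])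
          then show "z \<in> Q" using z(1) by (simp add: Q_def colon_def)
        qed
        have QZ: "Q \<subseteq> ZK" using oQ by (simp add: int_ideal_def)
        have finP: "finite (cosets ZK P)" using finite_cosets_int_ideal(1)[OF oP] JP x0J x00 by blast
        note tw = idx_tower[OF int_idealD(1)[OF oP] int_idealD(1)[OF oQ] add_subgroup_ZK PQ QZ finP]
        have pos: "idx ZK Q > 0" using idx_pos[OF tw(2)] algebraic_int_0 by blast
        have "idx ZK Q * idx Q P \<le> idx ZK Q * 1" using le tw(1) by simp
        then have QP1: "idx Q P \<le> 1" using pos by simp
        have bQ: "b \<in> Q" using ab b by (simp add: P_def Q_def colon_def mult_ac)
        have "b \<in> P"
        proof (rule ccontr)
          assume "b \<notin> P"
          have "card {0, b} \<le> idx Q P"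
          proof (rule card_le_idx[OF int_idealD(1)[OF oP] tw(3)])
            show "{0, b} \<subseteq> Q" using bQ add_subgroupD(1)[OF int_idealD(1)[OF oQ]] by simp
            fix u v assume "u \<in> {0, b}" "v \<in> {0, b}" "u - v \<in> P"
            then show "u = v" using \<open>b \<notin> P\<close> add_subgroupD(3)[OF int_idealD(1)[OF oP], of "- b"] by auto
          qed
          moreover have "b \<noteq> 0" using \<open>b \<notin> P\<close> add_subgroupD(1)[OF int_idealD(1)[OF oP]] by auto
          ultimately show False using QP1 by simp
        qed
        then show ?thesis ..
      qed simp
    qed
    have PS: "Fin_place P \<in> S" using s[of P P] P JP x0J by blast
    \<comment> \<open>J' = J + O y. The coefficient of \<open>y\<close> embeds J' / J into O / P,
      which bounds q by the norm of \<open>P\<close>; q \<ge> 2 because \<open>y\<close> is not in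
      \<open>J\<close>.\<close>
    define J' where "J' = {w. \<exists>z. algebraic_int z \<and> w - z * y \<in> J}"
    have mem: "w \<in> J'" if "algebraic_int z" "w - z * y \<in> J" for w z using that by (auto simp: J'_def)
    have JJ': "J \<subseteq> J'" using mem[of 0] by auto
    have yJ': "y \<in> J'" using mem[of 1 y] add_subgroupD(1)[OF int_idealD(1)[OF J]] by simp
    have oJ': "int_ideal J'"
      unfolding int_ideal_def add_subgroup_def
    proof (intro conjI ballI)
      show "0 \<in> J'" using JJ' add_subgroupD(1)[OF int_idealD(1)[OF J]] by blast
      show "J' \<subseteq> ZK"
      proof
        fix w assume "w \<in> J'"
        then obtain z where z: "algebraic_int z" "w - z * y \<in> J" by (auto simp: J'_def)
        have "algebraic_int ((w - z * y) + z * y)"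
          by (intro algebraic_int_plus algebraic_int_times z yi int_idealD(2)[OF J z(2)])
        then show "w \<in> ZK" by simp
      qed
      fix u v assume "u \<in> J'"
      then obtain a where a: "algebraic_int a" "u - a * y \<in> J" by (auto simp: J'_def)
      { assume "v \<in> J'"
        then obtain b where b: "algebraic_int b" "v - b * y \<in> J" by (auto simp: J'_def)
        have e: "(u - v) - (a - b) * y = (u - a * y) - (v - b * y)" by (simp add: algebra_simps)
        show "u - v \<in> J'"
          by (rule mem[OF algebraic_int_diff[OF a(1) b(1)]], unfold e)
            (rule add_subgroupD(2)[OF int_idealD(1)[OF J] a(2) b(2)]) }
      { assume "v \<in> ZK"
        then have v: "algebraic_int v" by simp
        have e: "v * u - (v * a) * y = v * (u - a * y)" by (simp add: algebra_simps)
        show "v * u \<in> J'"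
          by (rule mem[OF algebraic_int_times[OF v a(1)]], unfold e) (rule int_idealD(3)[OF J a(2) v]) }
    qed
    have J'Z: "J' \<subseteq> ZK" using oJ' by (simp add: int_ideal_def)
    note tw = idx_tower[OF int_idealD(1)[OF J] int_idealD(1)[OF oJ'] add_subgroup_ZK JJ' J'Z finJ]
    define q where "q = idx J' J"
    have qle: "q \<le> residue_norm P"
    proof -
      have "\<forall>w\<in>J'. \<exists>z. algebraic_int z \<and> w - z * y \<in> J" by (auto simp: J'_def)
      from bchoice[OF this] obtain f where f: "\<forall>w\<in>J'. algebraic_int (f w) \<and> w - f w * y \<in> J" by blast
      have "idx J' J \<le> idx ZK P"
      proof (rule finite_cosets_hom(2)[OF int_idealD(1)[OF J] int_idealD(1)[OF oP] int_primeD(4)[OF P], where f = f])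
        show "f w \<in> ZK" if "w \<in> J'" for w using f that by simp
        fix u v assume uv: "u \<in> J'" "v \<in> J'" "f u - f v \<in> P"
        have "(f u - f v) * y \<in> J" using uv(3) by (simp add: P_def colon_def)
        moreover have "u - f u * y \<in> J" "v - f v * y \<in> J" using f uv by auto
        ultimately have "(f u - f v) * y + ((u - f u * y) - (v - f v * y)) \<in> J"
          using add_subgroupD(2,4)[OF int_idealD(1)[OF J]] by blast
        then show "u - v \<in> J" by (simp add: algebra_simps)
      qed
      then show ?thesis by (simp add: q_def residue_norm_idx)
    qed
    have q2: "q \<ge> 2"
    proof -
      have "card {0, y} \<le> idx J' J"
      proof (rule card_le_idx[OF int_idealD(1)[OF J] tw(3)])
        show "{0, y} \<subseteq> J'" using yJ' add_subgroupD(1)[OF int_idealD(1)[OF oJ']] by simp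
        fix u v assume "u \<in> {0, y}" "v \<in> {0, y}" "u - v \<in> J"
        then show "u = v" using yi(2) add_subgroupD(3)[OF int_idealD(1)[OF J], of "- y"] by auto
      qed
      moreover have "y \<noteq> 0" using yi(2) add_subgroupD(1)[OF int_idealD(1)[OF J]] by auto
      ultimately show ?thesis by (simp add: q_def)
    qed
    have idx: "idx ZK J = idx ZK J' * q" unfolding q_def by (rule tw(1))
    have pos': "idx ZK J' > 0" using idx_pos[OF tw(2)] algebraic_int_0 by blast
    have lt: "idx ZK J' < idx ZK J" using q2 pos' unfolding idx by simp
    \<comment> \<open>The shrinking factor q^(-1/n) compensates the drop of the index, so the new
      bounds are admissible for J'. As e \<le> 1, the element \<open>\<beta>\<close> also satisfies
      the old bounds \<open>t\<close>.\<close>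
    define e where "e = degree_root (1 / real q)"
    have e: "e > 0" "(\<Prod>\<sigma>\<in>(UNIV :: 'a emb set). e) = 1 / real q" using degree_root[of "1 / real q"] q2 by (auto simp: e_def)
    have e1: "e \<le> 1" using q2 by (simp add: e_def degree_root_def)
    have tpos: "t \<sigma> > 0" for \<sigma> using t by (simp add: admissible_def)
    have t': "admissible J' (\<lambda>\<sigma>. t \<sigma> * e)"
    proof -
      have "(\<Prod>\<sigma>\<in>UNIV. t \<sigma> * e) = mink_const * real (idx ZK J) * (1 / real q)"
        unfolding prod.distrib e(2) using t by (simp add: admissible_def)
      also have "\<dots> = mink_const * real (idx ZK J')" using q2 by (simp add: idx)
      finally show ?thesis using t e(1) by (simp add: admissible_def)
    qed
    have x0J': "x0 \<in> J'" using x0J JJ' by blast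
    obtain \<beta> where \<beta>: "\<beta> \<in> small_elems J' (\<lambda>\<sigma>. t \<sigma> * e)" using small_elems_nonempty[OF oJ' x0J' x00 t'] by blast
    have \<beta>G: "\<beta> \<in> G" by (rule less.hyps[OF lt oJ' x0J' t' \<beta>])
    have "\<alpha> / \<beta> \<in> G"
    proof (rule gen[OF oJ'])
      show "\<beta> \<in> J'" "\<alpha> \<in> J'" using \<alpha> \<beta> JJ' by (auto simp: small_elems_def)
      show "\<beta> \<in> S_units S" using small_elems_S_units[OF oJ' t' \<beta>] s x0J' by blast
      show "\<alpha> \<in> S_units S" using small_elems_S_units[OF J t \<alpha>] s x0J by blast
      have "(\<Prod>\<sigma>\<in>UNIV. max (cmod (emb (\<sigma> :: 'a emb) \<alpha>)) (cmod (emb \<sigma> \<beta>))) \<le> (\<Prod>\<sigma>\<in>UNIV. t \<sigma>)"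
      proof (rule prod_mono)
        fix \<sigma> :: "'a emb"
        have "cmod (emb \<sigma> \<beta>) \<le> t \<sigma> * e" using \<beta> by (simp add: small_elems_def)
        also have "\<dots> \<le> t \<sigma>" using e1 tpos[of \<sigma>] by (simp add: mult_le_cancel_left1)
        finally show "0 \<le> max (cmod (emb \<sigma> \<alpha>)) (cmod (emb \<sigma> \<beta>)) \<and> max (cmod (emb \<sigma> \<alpha>)) (cmod (emb \<sigma> \<beta>)) \<le> t \<sigma>"
          using \<alpha> by (simp add: small_elems_def le_max_iff_disj)
      qed
      also have "\<dots> = mink_const * real q * real (idx ZK J')" using t by (simp add: admissible_def idx)
      also have "\<dots> \<le> mink_const * max_resnorm * real (idx ZK J')"
        using qle residue_norm_le_max_resnorm[OF P PS] mink_const_pos by (intro mult_right_mono mult_left_mono) auto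
      finally show "(\<Prod>\<sigma>\<in>UNIV. max (cmod (emb (\<sigma> :: 'a emb) \<alpha>)) (cmod (emb \<sigma> \<beta>))) \<le> mink_const * max_resnorm * real (idx ZK J')" .
    qed
    then have "\<alpha> / \<beta> * \<beta> \<in> G" using \<beta>G G unfolding mult_subgroup_def by blast
    moreover have "\<beta> \<noteq> 0" using \<beta> by (simp add: small_elems_def)
    ultimately show ?thesis by simp
  qed
qed

text \<open>Start of the path: J = x O with bounds d^(1/n) |\<sigma> x|, whose product is d |Nm x|
  and which \<open>x\<close> itself satisfies because d \<ge> 1.\<close>

lemma integral_S_unit_mem:
  assumes x: "algebraic_int x" "x \<in> S_units S"
  shows "x \<in> G"
proof (rule small_elems_mem[OF x int_ideal_principal[OF x(1)] mem_principal])
  have x0: "x \<noteq> 0" using x(2) by (simp add: S_units_iff)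
  have r: "degree_root mink_const > 0" "(\<Prod>\<sigma>\<in>(UNIV :: 'a emb set). degree_root mink_const) = mink_const"
    using degree_root[OF mink_const_pos] by auto
  show "admissible (principal x) (\<lambda>\<sigma>. degree_root mink_const * cmod (emb \<sigma> x))"
    unfolding admissible_def prod.distrib r(2) cmod_Nm[symmetric] idx_principal[OF x(1) x0] using r(1) x0 by simp
  have "degree_root mink_const \<ge> 1" using mink_const_ge_1 by (simp add: degree_root_def)
  then show "x \<in> small_elems (principal x) (\<lambda>\<sigma>. degree_root mink_const * cmod (emb \<sigma> x))"
    using x0 mem_principal by (simp add: small_elems_def mult_le_cancel_right1)
qed

text \<open>A fractional S-unit \<open>a\<close> is a quotient (c a) / c of integral ones:
  \<open>c\<close> is a small element of the ideal of denominators of \<open>a\<close>. That ideal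
  lies in no prime outside \<open>S\<close>, since \<open>a\<close> has valuation 0 there, and this
  makes \<open>c\<close> an S-unit.\<close>

lemma S_units_subset: "S_units S \<subseteq> G"
proof
  fix a assume a: "a \<in> S_units S"
  then have a0: "a \<noteq> 0" by (simp add: S_units_iff)
  obtain x y where x: "algebraic_int x" "x \<noteq> 0" "algebraic_int y" "y \<noteq> 0" "a = x / y"
    using fraction_exists[OF a0] by blast
  define C where "C = colon a ZK"
  have oC: "int_ideal C" unfolding C_def by (rule int_ideal_colon[OF int_ideal_ZK])
  have yC: "y \<in> C" using x by (simp add: C_def colon_def)
  have w: "\<exists>w\<in>C. w \<notin> P" if P: "int_prime P" "Fin_place P \<notin> S" for P
  proof -
    have "place_abs (Fin_place P) (x / y) = 1" using a P unfolding x(5) S_units_iff by blast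
    then have "integer_valuation P x = integer_valuation P y"
      using place_abs_Fin_eq_1_iff[OF P(1) x(1-4)] by blast
    then obtain w where "algebraic_int w" "w \<notin> P" "algebraic_int (w * (x / y))"
      using equal_valuation_denominator[OF P(1) x(1-4)] by blast
    then show ?thesis by (auto simp: C_def colon_def x(5))
  qed
  have pos: "mink_const * real (idx ZK C) > 0"
    using mink_const_pos idx_pos[OF finite_cosets_int_ideal(1)[OF oC yC x(4)]] algebraic_int_0 by fastforce
  define t where "t = (\<lambda>_ :: 'a emb. degree_root (mink_const * real (idx ZK C)))"
  have t: "admissible C t" using degree_root[OF pos] by (simp add: admissible_def t_def)
  obtain c where c: "c \<in> small_elems C t" using small_elems_nonempty[OF oC yC x(4) t] by blast
  have cS: "c \<in> S_units S" by (rule small_elems_S_units[OF oC t c w])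
  have c': "algebraic_int c" "algebraic_int (c * a)" "c \<noteq> 0" using c by (auto simp: small_elems_def C_def colon_def)
  have "c * a \<in> S_units S" using mult_subgroup_S_units cS a by (auto simp: mult_subgroup_def)
  then have "c * a \<in> G" "c \<in> G" using integral_S_unit_mem c' cS by auto
  then have "(c * a) / c \<in> G" using G unfolding mult_subgroup_def by blast
  then show "a \<in> G" using c'(3) by simp
qed

end

text \<open>The quotients demanded by \<open>gen\<close> are themselves generators:
  \<open>height_le\<close> bounds their height, the index of \<open>J\<close> cancelling on both
  sides.\<close>

lemma generate_height:
  "generate (mult_of class_ring) {a \<in> S_units S. height a \<le> mink_const * max_resnorm} = S_units S"
proof
  have S0: "0 \<notin> S_units S" by (simp add: S_units_iff)
  show "generate (mult_of class_ring) {a \<in> S_units S. height a \<le> mink_const * max_resnorm} \<subseteq> S_units S"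
    by (rule generate_subset_mult_subgroup[OF mult_subgroup_S_units]) auto
  show "S_units S \<subseteq> generate (mult_of class_ring) {a \<in> S_units S. height a \<le> mink_const * max_resnorm}"
  proof (rule S_units_subset[OF mult_subgroup_generate])
    fix J \<alpha> \<beta>
    assume J: "int_ideal J" "\<alpha> \<in> J" "\<beta> \<in> J" and S: "\<alpha> \<in> S_units S" "\<beta> \<in> S_units S"
      and le: "(\<Prod>\<sigma>\<in>UNIV. max (cmod (emb (\<sigma> :: 'a emb) \<beta>)) (cmod (emb \<sigma> \<alpha>))) \<le> mink_const * max_resnorm * real (idx ZK J)"
    have nz: "\<alpha> \<noteq> 0" "\<beta> \<noteq> 0" using S S0 by auto
    have "real (idx ZK J) > 0" using idx_pos[OF finite_cosets_int_ideal(1)[OF J(1,2) nz(1)]] algebraic_int_0 by fastforce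
    moreover have "height (\<beta> / \<alpha>) * real (idx ZK J) \<le> mink_const * max_resnorm * real (idx ZK J)"
      using height_le[OF J(1,3,2) nz(2,1)] le by linarith
    ultimately have "height (\<beta> / \<alpha>) \<le> mink_const * max_resnorm" by (simp only: mult_le_cancel_right_pos)
    moreover have "\<beta> / \<alpha> \<in> S_units S" using S mult_subgroup_S_units by (simp add: mult_subgroup_def)
    ultimately show "\<beta> / \<alpha> \<in> generate (mult_of class_ring) {a \<in> S_units S. height a \<le> mink_const * max_resnorm}"
      by (intro generate.incl) simp
  qed (use S0 in auto)
qed

text \<open>
  A quotient \<open>\<beta> / \<alpha>\<close> as above is written with a small denominator \<open>c\<close>, chosen by Minkowski's theorem
  in the ideal of all its denominators with the same bound at all infinite places.
\<close>

lemma generate_integral_height: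
  "generate (mult_of class_ring) {a \<in> S_units S. algebraic_int a \<and> height a \<le> mink_const\<^sup>2 * max_resnorm} = S_units S"
proof
  define H where "H = {a \<in> S_units S. algebraic_int a \<and> height a \<le> mink_const\<^sup>2 * max_resnorm}"
  have S0: "0 \<notin> S_units S" by (simp add: S_units_iff)
  show "generate (mult_of class_ring) {a \<in> S_units S. algebraic_int a \<and> height a \<le> mink_const\<^sup>2 * max_resnorm} \<subseteq> S_units S"
    by (rule generate_subset_mult_subgroup[OF mult_subgroup_S_units]) auto
  have mg: "mult_subgroup (generate (mult_of class_ring) H)" by (rule mult_subgroup_generate) (use S0 in \<open>auto simp: H_def\<close>)
  have "S_units S \<subseteq> generate (mult_of class_ring) H"
  proof (rule S_units_subset[OF mg])
    fix J \<alpha> \<beta>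
    assume J: "int_ideal J" "\<alpha> \<in> J" "\<beta> \<in> J" and S: "\<alpha> \<in> S_units S" "\<beta> \<in> S_units S"
      and le: "(\<Prod>\<sigma>\<in>UNIV. max (cmod (emb (\<sigma> :: 'a emb) \<beta>)) (cmod (emb \<sigma> \<alpha>))) \<le> mink_const * max_resnorm * real (idx ZK J)"
    have nz: "\<alpha> \<noteq> 0" "\<beta> \<noteq> 0" using S S0 by auto
    have ai: "algebraic_int \<alpha>" using J int_idealD by blast
    define C where "C = colon \<beta> (principal \<alpha>)"
    have oC: "int_ideal C" unfolding C_def by (rule int_ideal_colon[OF int_ideal_principal[OF ai]])
    note col = idx_colon[OF J(1,3,2) nz(1), folded C_def]
    have Jpos: "real (idx ZK J) > 0" using idx_pos[OF finite_cosets_int_ideal(1)[OF J(1,2) nz(1)]] algebraic_int_0 by fastforce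
    have Cpos: "idx ZK C > 0" using idx_pos[OF finite_cosets_int_ideal(1)[OF oC col(2) nz(1)]] algebraic_int_0 by blast
    define M where "M = mink_const * real (idx ZK C)"
    have M1: "M \<ge> 1" using mink_const_ge_1 Cpos mult_mono[of 1 mink_const 1 "real (idx ZK C)"] by (simp add: M_def)
    define t where "t = (\<lambda>_ :: 'a emb. degree_root M)"
    \<comment> \<open>Equal bounds are at least 1 because their product is. They therefore dominate
      max 1 |\<sigma> c| as well as |\<sigma> c|, and the product M bounds the height of
      \<open>c\<close>.\<close>
    have t1: "t \<sigma> \<ge> 1" for \<sigma> using M1 by (simp add: t_def degree_root_def)
    have tM: "(\<Prod>\<sigma>\<in>UNIV. t \<sigma>) = M" unfolding t_def by (rule degree_root) (use M1 in simp)
    have t: "admissible C t" using degree_root(1)[of M] M1 tM by (simp add: admissible_def M_def t_def)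
    obtain c where c: "c \<in> small_elems C t" using small_elems_nonempty[OF oC col(2) nz(1) t] by blast
    have cS: "c \<in> S_units S"
      by (rule small_elems_S_units[OF oC t c]) (use S(1) col(2) S_units_integer_iff[OF ai nz(1)] in blast)
    have c': "algebraic_int c" "c \<noteq> 0" "\<And>\<sigma>. cmod (emb \<sigma> c) \<le> t \<sigma>" "c * \<beta> \<in> principal \<alpha>"
      using c by (auto simp: small_elems_def C_def colon_def)
    define b where "b = c * (\<beta> / \<alpha>)"
    obtain z where "algebraic_int z" "c * \<beta> = \<alpha> * z" using c'(4) by (auto simp: principal_def)
    then have bi: "algebraic_int b" using nz by (simp add: b_def field_simps)
    have b0: "b \<noteq> 0" using c' nz by (simp add: b_def)
    have bS: "b \<in> S_units S" using mult_subgroup_S_units cS S by (simp add: b_def mult_subgroup_def)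
    define R where "R = (\<Prod>\<sigma>\<in>UNIV. max 1 (cmod (emb (\<sigma> :: 'a emb) (\<beta> / \<alpha>))))"
    have R1: "R \<ge> 1" unfolding R_def by (rule prod_ge_1) simp
    \<comment> \<open>|Nm \<alpha>| R is the product of maxima bounded in \<open>le\<close>, and
      [O:J] [O:C] \<le> |Nm \<alpha>|; cancelling [O:J] gives [O:C] R \<le> d m_S. The second factor
      d is the one contained in \<open>M\<close>.\<close>
    have MR: "M * R \<le> mink_const\<^sup>2 * max_resnorm"
    proof -
      have "real (idx ZK C) * R * real (idx ZK J) \<le> cmod (Nm \<alpha>) * R"
        using mult_right_mono[OF col(1), of R] R1 by (simp add: mult_ac)
      also have "\<dots> \<le> mink_const * max_resnorm * real (idx ZK J)"
        using le prod_max_quotient[OF nz(1), of \<beta>] by (simp add: R_def mult.commute)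
      finally have "real (idx ZK C) * R \<le> mink_const * max_resnorm" using Jpos by (simp only: mult_le_cancel_right_pos)
      then have "mink_const * (real (idx ZK C) * R) \<le> mink_const * (mink_const * max_resnorm)" using mink_const_pos by (intro mult_left_mono) auto
      then show ?thesis by (simp add: M_def power2_eq_square mult_ac)
    qed
    have "height c \<le> mink_const\<^sup>2 * max_resnorm"
    proof -
      have "height c \<le> (\<Prod>\<sigma>\<in>UNIV. t \<sigma>)"
        unfolding height_integer[OF c'(1,2)] by (rule prod_mono) (use c'(3) t1 in auto)
      also have "\<dots> \<le> M * R" unfolding tM using M1 R1 by (simp add: mult_le_cancel_left1)
      finally show ?thesis using MR by linarith
    qed
    then have cH: "c \<in> H" using cS c'(1) by (simp add: H_def)
    have "height b \<le> mink_const\<^sup>2 * max_resnorm"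
    proof -
      have "height b \<le> (\<Prod>\<sigma>\<in>UNIV. t \<sigma> * max 1 (cmod (emb \<sigma> (\<beta> / \<alpha>))))"
        unfolding height_integer[OF bi b0]
      proof (rule prod_mono)
        fix \<sigma> :: "'a emb"
        have "cmod (emb \<sigma> b) = cmod (emb \<sigma> c) * cmod (emb \<sigma> (\<beta> / \<alpha>))"
          unfolding b_def emb.hom_mult norm_mult ..
        also have "\<dots> \<le> t \<sigma> * max 1 (cmod (emb \<sigma> (\<beta> / \<alpha>)))"
          using c'(3)[of \<sigma>] t1[of \<sigma>] by (intro mult_mono) auto
        finally have 1: "cmod (emb \<sigma> b) \<le> t \<sigma> * max 1 (cmod (emb \<sigma> (\<beta> / \<alpha>)))" .
        have 2: "1 * 1 \<le> t \<sigma> * max 1 (cmod (emb \<sigma> (\<beta> / \<alpha>)))"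
          using t1[of \<sigma>] by (intro mult_mono) auto
        show "0 \<le> max 1 (cmod (emb \<sigma> b)) \<and> max 1 (cmod (emb \<sigma> b)) \<le> t \<sigma> * max 1 (cmod (emb \<sigma> (\<beta> / \<alpha>)))"
          using 1 2 by simp
      qed
      also have "\<dots> = M * R" unfolding prod.distrib tM R_def ..
      finally show ?thesis using MR by linarith
    qed
    then have bH: "b \<in> H" using bS bi by (simp add: H_def)
    have "b / c \<in> generate (mult_of class_ring) H"
      using mg generate.incl[OF bH] generate.incl[OF cH] unfolding mult_subgroup_def by blast
    then show "\<beta> / \<alpha> \<in> generate (mult_of class_ring) H" using c'(2) by (simp add: b_def)
  qed
  then show "S_units S \<subseteq> generate (mult_of class_ring) {a \<in> S_units S. algebraic_int a \<and> height a \<le> mink_const\<^sup>2 * max_resnorm}"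
    by (simp add: H_def)
qed

end

theorem theorem6p2:
  fixes S :: "'a::field_char_0 place set" and d :: real
  assumes "number_field TYPE('a)"
    and d: "d = (2 / pi) ^ card (complex_places :: 'a place set) *
                    sqrt \<bar>real_of_int (discriminant TYPE('a))\<bar>"
    and "finite S" and "S \<subseteq> places"
    and "arch_places \<subseteq> S"
    and "\<forall>P. Fin_place P \<in> fin_places \<and> real (residue_norm P) \<le> d
           \<longrightarrow> Fin_place P \<in> S"
  shows "generate (mult_of class_ring)
           {a \<in> S_units S. height a \<le> d * real (max_residue_norm S)} = S_units S \<and>
         generate (mult_of class_ring)
           {a \<in> S_units S. algebraic_int a \<and> height a \<le> d\<^sup>2 * real (max_residue_norm S)}
           = S_units S"
proof -
  interpret numfield "TYPE('a)" by unfold_locales (rule assms(1))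
  have d_eq: "d = mink_const" by (simp add: d mink_const_def)
  interpret sunit_setting "TYPE('a)" S
    by unfold_locales (use assms fin_places_int_prime d_eq in auto)
  show ?thesis using generate_height generate_integral_height by (simp add: d_eq)
qed

end
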